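(* Let $p$ be a prime and let $G$ be a finite $p$-group of rank $k$. Then every $p$-subgroup $Q$ of $Aut(G)$ can be generated by $\frac{9k^2}{4}$ elements if $p>2$, and by $\frac{7k^2-k}{2}$ elements if $p=2$; that is, $d(Q)\le \frac{9k^2}{4}$ if $p>2$ and $d(Q)\le\frac{7k^2-k}{2}$ if $p=2$.
   Context: For a group $G$, $d(G)$ is the minimal number of generators of $G$, and the (Prüfer) rank of $G$ is $rk(G)=\sup\{d(H): H \text{ a finitely generated subgroup of } G\}$. *)

theory Defs
  imports "HOL-Algebra.Algebra" "HOL-Library.Extended_Real"
begin

text \<open>
  The minimal number of generators, with value \<open>\<infinity>\<close> (the infimum of the empty set)
  if the group is not finitely generated.
\<close>

definition min_gens :: "('a, 'b) monoid_scheme \<Rightarrow> enat" where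
  "min_gens G =
     (INF S \<in> {S. S \<subseteq> carrier G \<and> finite S \<and> generate G S = carrier G}. enat (card S))"

definition finitely_generated_group :: "('a, 'b) monoid_scheme \<Rightarrow> bool" where
  "finitely_generated_group G \<longleftrightarrow>
     group G \<and> (\<exists>S \<subseteq> carrier G. finite S \<and> generate G S = carrier G)"

definition prufer_rank :: "('a, 'b) monoid_scheme \<Rightarrow> enat" where
  "prufer_rank G =
     (SUP H \<in> {H. subgroup H G \<and> finitely_generated_group (G\<lparr>carrier := H\<rparr>)}.
        min_gens (G\<lparr>carrier := H\<rparr>))"

text \<open>
  \<open>group.ord G x\<close> is 0 for an element of infinite order, so for a prime \<open>p\<close>
  the condition below forces every element to have finite order.
\<close>

definition p_group :: "nat \<Rightarrow> ('a, 'b) monoid_scheme \<Rightarrow> bool" where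
  "p_group p G \<longleftrightarrow> group G \<and> (\<forall>x \<in> carrier G. \<exists>n. group.ord G x = p ^ n)"

end

theory Submission
  imports Defs
begin

text \<open>
  Let \<open>Q\<close> be a \<open>p\<close>-group acting faithfully on a finite \<open>p\<close>-group \<open>G\<close> of rank \<open>k\<close>.  By Burnside's
  basis theorem \<open>d(Q) \<le> m\<close> as soon as \<open>|Q| \<le> p^m |P|\<close> for every subgroup \<open>P\<close> that contains all
  \<open>p\<close>-th powers and commutators (\<open>min_gens_le\<close>).  Fix such a \<open>P\<close>.  The index of \<open>P\<close> is estimated along
  a descending chain of subgroups of \<open>Q\<close>: \<open>layer_bound P c S N\<close> says that passing from \<open>N\<close> up to \<open>S\<close>
  multiplies the index of the intersection with \<open>P\<close> by at most \<open>c\<close>, and such bounds multiply.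

  Let \<open>A\<close> be maximal among the abelian normal \<open>Q\<close>-invariant subgroups of \<open>G\<close>.  Since only \<open>p\<close>-groups
  act, \<open>A\<close> is its own centralizer (\<open>self_centralizing_normal_abelian\<close>).  The chain has three or
  four layers.

  (1) \<open>Q\<close> down to the subgroup acting trivially on \<open>A / A^p\<close>.  The space \<open>A / A^p\<close> has dimension
  \<open>r \<le> k\<close> and an invariant full flag, so \<open>Q\<close> acts by unitriangular matrices.  Give every element the
  position \<open>(i, j)\<close> of its leading entry, with positions ordered by column first and then by row.
  A commutator of elements leading at \<open>(i, j)\<close> and \<open>(j, k)\<close> leads at \<open>(i, k)\<close>, so the positions that
  occur in \<open>Q\<close> but not in \<open>P\<close> are the edges of a triangle-free graph on \<open>r\<close> vertices.  By Mantel's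
  theorem there are at most \<open>r^2/4\<close> of them (\<open>layer_flag\<close>).

  (2) For \<open>p = 2\<close> only: from trivial action on \<open>A / A^2\<close> to trivial action on \<open>A / A^4\<close>.  The index is
  at most \<open>2^(k^2)\<close> (\<open>card_congruence_subgroup_step\<close>).

  (3) From there to the kernel of the action on \<open>A\<close>, written additively.  Counting the fibres of \<open>\<alpha> \<mapsto> \<alpha>^p\<close> bounds
  the index of the set of \<open>p\<close>-th powers.  If \<open>\<alpha>^p = \<beta>^p\<close> and \<open>\<delta> = \<alpha> - \<beta>\<close> maps into \<open>A^(p^s)\<close>,
  then \<open>p \<delta>\<close> maps not only into \<open>A^(p^(s+1))\<close> but into \<open>A^(p^(s+2))\<close> (\<open>equal_powers_gain\<close>).  Hence
  a fibre has no more elements than there are tuples of elements of order dividing \<open>p\<close>, at most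
  \<open>p^(k^2)\<close> (\<open>layer_congruence_kernel\<close>).

  (4) The automorphisms that fix \<open>A\<close> pointwise.  They have the form \<open>g \<mapsto> g d(g)\<close> with \<open>d(g)\<close> in \<open>A\<close>
  because \<open>A\<close> is self-centralizing, their powers are \<open>g \<mapsto> g d(g)^n\<close>, and the fibres of the power
  map again have at most \<open>p^(k^2)\<close> elements (\<open>layer_stabilizer\<close>).

  The exponents add up to \<open>k^2/4 + 2 k^2 = 9 k^2/4\<close> for odd \<open>p\<close>, and for \<open>p = 2\<close> to
  \<open>\<lfloor>k^2/4\<rfloor> + 3 k^2\<close>, which is at most \<open>(7 k^2 - k)/2\<close> for every natural number \<open>k\<close>.
\<close>

section \<open>Finite p-groups and fixed points\<close>

lemma (in group) pow_card_carrier: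
  assumes "finite (carrier G)" "x \<in> carrier G"
  shows "x [^] (card (carrier G)) = \<one>"
  using pow_order_eq_1[OF assms(2)] by (simp add: order_def)

lemma (in group) finite_subgroupI:
  assumes fin: "finite (carrier G)" and sub: "H \<subseteq> carrier G" and one: "\<one> \<in> H"
    and cl: "\<And>x y. x \<in> H \<Longrightarrow> y \<in> H \<Longrightarrow> x \<otimes> y \<in> H"
  shows "subgroup H G"
proof (rule subgroupI)
  fix x assume x: "x \<in> H"
  then have xc: "x \<in> carrier G" using sub by blast
  have pos: "card (carrier G) > 0" using fin one sub by (auto simp: card_gt_0_iff)
  have pw: "x [^] (n::nat) \<in> H" for n
    by (induction n) (auto simp: one cl x)
  have "x [^] (card (carrier G) - 1) \<otimes> x = \<one>"
    using pow_card_carrier[OF fin xc] pos nat_pow_Suc[of x "card (carrier G) - 1"] by simp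
  then have "inv x = x [^] (card (carrier G) - 1)"
    using xc by (simp add: inv_equality)
  then show "inv x \<in> H" using pw by simp
qed (use assms in auto)

lemma (in group) subgroup_nat_pow:
  assumes "subgroup V G" "y \<in> V"
  shows "y [^] (n::nat) \<in> V"
  using assms(2) by (induction n) (auto simp: subgroup.one_closed[OF assms(1)] subgroup.m_closed[OF assms(1)])

lemma (in group) card_subgroup_dvd:
  assumes fin: "finite (carrier G)" and "subgroup H G" "subgroup K G" "H \<subseteq> K"
  shows "card H dvd card K"
proof -
  interpret K: group "G\<lparr>carrier := K\<rparr>" using assms by (simp add: subgroup_imp_group)
  have "subgroup H (G\<lparr>carrier := K\<rparr>)" using assms by (simp add: subgroup_incl)
  from K.lagrange[OF this] have "card K = card (rcosets\<^bsub>G\<lparr>carrier := K\<rparr>\<^esub> H) * card H"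
    by (simp add: order_def)
  then show ?thesis by simp
qed

lemma (in group) card_subgroup_pos:
  assumes "finite (carrier G)" "subgroup H G"
  shows "card H > 0"
  using assms subgroup.finite_imp_card_positive by blast

locale finite_p_group = group +
  fixes p :: nat
  assumes prime_p: "Factorial_Ring.prime p"
    and fin [simp]: "finite (carrier G)"
    and card_prime_power: "\<exists>n. card (carrier G) = p ^ n"
begin

lemma p_gt_1: "p > 1" using prime_p prime_gt_1_nat by blast

lemma card_subgroup_prime_power:
  assumes "subgroup H G" shows "\<exists>n. card H = p ^ n"
proof -
  obtain n where n: "card (carrier G) = p ^ n" using card_prime_power by blast
  have "card H dvd p ^ n"
    using card_subgroup_dvd[OF fin assms subgroup_self] assms n subgroup.subset by force
  then show ?thesis using divides_primepow_nat[OF prime_p] by blast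
qed

lemma subgroup_p_group:
  assumes "subgroup H G" shows "finite_p_group (G\<lparr>carrier := H\<rparr>) p"
proof -
  interpret H: group "G\<lparr>carrier := H\<rparr>" using assms by (simp add: subgroup_imp_group)
  show ?thesis
    using prime_p card_subgroup_prime_power[OF assms] finite_subset[OF subgroup.subset[OF assms]]
    by unfold_locales auto
qed

lemma dvd_index:
  assumes "subgroup H G" "subgroup K G" "H \<subset> K"
  shows "p * card H dvd card K"
proof -
  obtain a b where ab: "card H = p ^ a" "card K = p ^ b"
    using assms card_subgroup_prime_power by meson
  have "finite K" using assms finite_subset[OF subgroup.subset fin] by auto
  then have "card H < card K" using assms psubset_card_mono by blast
  then have "a < b" using ab p_gt_1 by simp
  then have "p ^ Suc a dvd p ^ b" by (intro le_imp_power_dvd) auto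
  then show ?thesis using ab by simp
qed

lemma index_le:
  assumes "subgroup H G" "subgroup K G" "H \<subset> K"
  shows "p * card H \<le> card K"
  using dvd_index[OF assms] card_subgroup_pos[OF fin assms(2)] by (simp add: dvd_imp_le)

end

text \<open>
  A prime divisor \<open>q\<close> of the order gives a subgroup of order \<open>q\<close> by Sylow's theorem, hence an
  element whose order divides \<open>q\<close> and is a nontrivial power of \<open>p\<close>.
\<close>

lemma p_group_imp_finite_p_group:
  fixes G (structure)
  assumes "p_group p G" "finite (carrier G)" "Factorial_Ring.prime p"
  shows "finite_p_group G p"
proof -
  interpret group G using assms(1) by (simp add: p_group_def)
  have ordp: "\<exists>n. ord x = p ^ n" if "x \<in> carrier G" for x
    using assms(1) that by (simp add: p_group_def)
  have only_p: "q = p" if q: "Factorial_Ring.prime q" "q dvd card (carrier G)" for q :: nat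
  proof -
    obtain m where m: "order G = q ^ 1 * m" using q by (auto simp: order_def elim: dvdE)
    obtain H where H: "subgroup H G" "card H = q"
      using sylow_thm[OF q(1) is_group m] assms(2) by auto
    have "H \<noteq> {\<one>}" using H q(1) by (auto simp: prime_nat_iff)
    moreover have "\<one> \<in> H" using H(1) subgroup.one_closed by blast
    ultimately obtain x where x: "x \<in> H" "x \<noteq> \<one>" by blast
    have xc: "x \<in> carrier G" using x H subgroup.subset by blast
    obtain n where n: "ord x = p ^ n" using ordp[OF xc] by blast
    have "n \<noteq> 0" using n x xc ord_eq_1 by (metis power_0)
    then have "p dvd ord x" using n by simp
    moreover have "ord x dvd q"
    proof -
      interpret H: group "G\<lparr>carrier := H\<rparr>" using H by (simp add: subgroup_imp_group)
      have "x [^]\<^bsub>G\<lparr>carrier := H\<rparr>\<^esub> card H = \<one>"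
        using H.pow_order_eq_1[of x] x by (simp add: order_def)
      then show ?thesis using xc H(2) by (metis pow_eq_id nat_pow_consistent)
    qed
    ultimately have "p dvd q" by (rule dvd_trans)
    then show ?thesis using q(1) assms(3) primes_dvd_imp_eq by blast
  qed
  have "\<exists>n. card (carrier G) = p ^ n"
  proof -
    have pos: "card (carrier G) > 0" using assms(2) by (metis card_gt_0_iff carrier_not_empty)
    have "set_mset (prime_factorization (card (carrier G))) \<subseteq> {p}"
      using only_p by (auto simp: prime_factors_dvd)
    then have "prime_factorization (card (carrier G)) = replicate_mset (size (prime_factorization (card (carrier G)))) p"
      using set_mset_subset_singletonD by fastforce
    then show ?thesis using prod_mset_prime_factorization_nat[of "card (carrier G)"] pos
      by (metis prod_mset_replicate_mset)
  qed
  then show ?thesis using assms by unfold_locales auto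
qed

text \<open>
  Orbits of length greater than one have length divisible by \<open>p\<close>, so the number of fixed points is
  divisible by \<open>p\<close> and cannot be one.
\<close>

lemma p_group_second_fixed_point:
  fixes H (structure)
  assumes "finite_p_group H p" and finE: "finite E" and dvd: "p dvd card E" and x0: "x0 \<in> E"
    and cl: "\<And>h x. h \<in> carrier H \<Longrightarrow> x \<in> E \<Longrightarrow> f h x \<in> E"
    and one: "\<And>x. x \<in> E \<Longrightarrow> f \<one> x = x"
    and mult: "\<And>h h' x. h \<in> carrier H \<Longrightarrow> h' \<in> carrier H \<Longrightarrow> x \<in> E \<Longrightarrow> f (h \<otimes> h') x = f h (f h' x)"
    and fix0: "\<And>h. h \<in> carrier H \<Longrightarrow> f h x0 = x0"
  shows "\<exists>x\<in>E. x \<noteq> x0 \<and> (\<forall>h\<in>carrier H. f h x = x)"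
proof (rule ccontr)
  assume neg: "\<not> ?thesis"
  interpret finite_p_group H p by fact
  define \<phi> where "\<phi> = (\<lambda>h. restrict (f h) E)"
  have bij: "\<phi> h \<in> Bij E" if h: "h \<in> carrier H" for h
  proof -
    have "bij_betw (f h) E E"
      using h cl one mult[of "inv h" h] mult[of h "inv h"]
      by (intro bij_betw_byWitness[where f' = "f (inv h)"]) auto
    then show ?thesis by (simp add: Bij_def \<phi>_def bij_betw_restrict_eq)
  qed
  have "\<phi> \<in> hom H (BijGroup E)"
    using bij cl mult by (auto simp: hom_def BijGroup_def \<phi>_def compose_def fun_eq_iff)
  then interpret A: group_action H E \<phi>
    by (simp add: group_action_def group_hom_def group_hom_axioms_def group_BijGroup)
  have orb: "orbit H \<phi> x = (\<lambda>h. f h x) ` carrier H" if "x \<in> E" for x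
    using that by (auto simp: orbit_def \<phi>_def)
  have x0orb: "orbit H \<phi> x0 = {x0}" using orb[OF x0] fix0 by auto
  obtain n where n: "order H = p ^ n" using card_prime_power by (auto simp: order_def)
  have div: "p dvd card Ob" if Ob: "Ob \<in> orbits H E \<phi> - {{x0}}" for Ob
  proof -
    obtain x where x: "x \<in> E" "Ob = orbit H \<phi> x" using Ob by (auto simp: orbits_def)
    have xne: "x \<noteq> x0" using x Ob x0orb by auto
    have "card Ob dvd p ^ n" using A.orbit_stabilizer_theorem[OF x(1)] x(2) n by (metis dvd_triv_left)
    then obtain m where m: "card Ob = p ^ m" using divides_primepow_nat[OF prime_p] by blast
    have xO: "x \<in> Ob" using A.orbit_refl x by blast
    have "m \<noteq> 0"
    proof
      assume "m = 0"
      then have "Ob = {x}" using m xO by (metis card_1_singletonE power_0 singletonD)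
      then have "\<forall>h\<in>carrier H. f h x = x" using orb[OF x(1)] x(2) by auto
      then show False using neg x xne by blast
    qed
    then show ?thesis using m by simp
  qed
  have fo: "finite (orbits H E \<phi>)" using finE by (auto simp: orbits_def)
  have in0: "{x0} \<in> orbits H E \<phi>" using x0orb x0 by (auto simp: orbits_def)
  have "card E = (\<Sum>Ob\<in>orbits H E \<phi>. card Ob)"
    using A.disjoint_sum[OF finE, of "\<lambda>_. 1::nat"] by simp
  also have "\<dots> = 1 + (\<Sum>Ob\<in>orbits H E \<phi> - {{x0}}. card Ob)"
    using sum.remove[OF fo in0, of card] by simp
  finally have "p dvd 1 + (\<Sum>Ob\<in>orbits H E \<phi> - {{x0}}. card Ob)" using dvd by simp
  moreover have "p dvd (\<Sum>Ob\<in>orbits H E \<phi> - {{x0}}. card Ob)" using div by (rule dvd_sum)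
  ultimately have "p dvd 1" by (metis dvd_add_left_iff)
  then show False using p_gt_1 by simp
qed

text \<open>
  The fixed point argument for the cosets of an invariant proper subgroup, one of which (the subgroup
  itself) is certainly fixed.  With different choices of the action this yields normality of maximal
  subgroups, invariant flags, and the extension of abelian normal subgroups.
\<close>

lemma p_group_fixes_coset:
  assumes "finite_p_group G p" "finite_p_group H p"
    and A: "subgroup A G" "A \<noteq> carrier G"
    and cl: "\<And>h x. h \<in> carrier H \<Longrightarrow> x \<in> carrier G \<Longrightarrow> f h x \<in> carrier G"
    and clA: "\<And>h x. h \<in> carrier H \<Longrightarrow> x \<in> A \<Longrightarrow> f h x \<in> A"
    and hom: "\<And>h x y. h \<in> carrier H \<Longrightarrow> x \<in> carrier G \<Longrightarrow> y \<in> carrier G \<Longrightarrow>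
                f h (x \<otimes>\<^bsub>G\<^esub> y) = f h x \<otimes>\<^bsub>G\<^esub> f h y"
    and one: "\<And>x. x \<in> carrier G \<Longrightarrow> f \<one>\<^bsub>H\<^esub> x = x"
    and mult: "\<And>h h' x. h \<in> carrier H \<Longrightarrow> h' \<in> carrier H \<Longrightarrow> x \<in> carrier G \<Longrightarrow>
                f (h \<otimes>\<^bsub>H\<^esub> h') x = f h (f h' x)"
  obtains x where "x \<in> carrier G" "x \<notin> A"
    "\<And>h. h \<in> carrier H \<Longrightarrow> f h x \<otimes>\<^bsub>G\<^esub> inv\<^bsub>G\<^esub> x \<in> A"
proof -
  interpret G: finite_p_group G p by fact
  interpret H: finite_p_group H p by fact
  have Asub: "A \<subseteq> carrier G" using A subgroup.subset by blast
  have finA: "finite A" using Asub finite_subset G.fin by blast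
  have imA: "f h ` A = A" if h: "h \<in> carrier H" for h
  proof
    show "f h ` A \<subseteq> A" using clA h by blast
    show "A \<subseteq> f h ` A"
    proof
      fix x assume x: "x \<in> A"
      then have "x = f h (f (inv\<^bsub>H\<^esub> h) x)"
        using mult[of h "inv\<^bsub>H\<^esub> h" x] h one Asub by auto
      then show "x \<in> f h ` A" using clA[of "inv\<^bsub>H\<^esub> h" x] h x by blast
    qed
  qed
  have imC: "f h ` (A #>\<^bsub>G\<^esub> x) = A #>\<^bsub>G\<^esub> f h x" if h: "h \<in> carrier H" and x: "x \<in> carrier G" for h x
  proof -
    have "f h ` (A #>\<^bsub>G\<^esub> x) = (\<lambda>a. f h (a \<otimes>\<^bsub>G\<^esub> x)) ` A"
      by (auto simp: r_coset_def)
    also have "\<dots> = (\<lambda>a. f h a \<otimes>\<^bsub>G\<^esub> f h x) ` A"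
      using hom[OF h subsetD[OF Asub] x] by simp
    also have "\<dots> = (\<lambda>b. b \<otimes>\<^bsub>G\<^esub> f h x) ` (f h ` A)" by (simp add: image_image)
    finally show ?thesis using imA[OF h] by (auto simp: r_coset_def)
  qed
  let ?E = "rcosets\<^bsub>G\<^esub> A"
  have "p * card A dvd card (carrier G)"
    using G.dvd_index[OF A(1) G.subgroup_self] A(2) Asub by auto
  moreover have "card ?E * card A = card (carrier G)" using G.lagrange[OF A(1)] by (simp add: order_def)
  ultimately have dvd: "p dvd card ?E"
    using G.card_subgroup_pos[OF G.fin A(1)] by (metis dvd_mult_cancel2 dvd_times_right_cancel_iff gr_implies_not0)
  have "\<exists>C\<in>?E. C \<noteq> A \<and> (\<forall>h\<in>carrier H. f h ` C = C)"
  proof (rule p_group_second_fixed_point[OF assms(2) _ dvd, where f = "\<lambda>h C. f h ` C"])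
    show "finite ?E" using G.rcosets_finite G.fin by (metis Asub RCOSETS_def finite_UN_I finite.emptyI finite.insertI)
    show "A \<in> ?E" by (rule subgroup.subgroup_in_rcosets[OF A(1) G.is_group])
    fix h C assume h: "h \<in> carrier H" and C: "C \<in> ?E"
    then obtain x where x: "x \<in> carrier G" "C = A #>\<^bsub>G\<^esub> x" by (auto simp: RCOSETS_def)
    show "f h ` C \<in> ?E" using imC[OF h x(1)] x cl[OF h] Asub by (auto intro: G.rcosetsI)
  next
    fix C assume "C \<in> ?E"
    then have "C \<subseteq> carrier G" using G.rcosets_part_G[OF A(1)] by blast
    then have "f \<one>\<^bsub>H\<^esub> ` C = id ` C" using one by (intro image_cong) auto
    then show "f \<one>\<^bsub>H\<^esub> ` C = C" by simp
  next
    fix h h' C assume h: "h \<in> carrier H" "h' \<in> carrier H" and "C \<in> ?E"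
    then have C: "C \<subseteq> carrier G" using G.rcosets_part_G[OF A(1)] by blast
    show "f (h \<otimes>\<^bsub>H\<^esub> h') ` C = f h ` f h' ` C" unfolding image_image by (rule image_cong[OF refl]) (use mult[OF h] C in blast)
  next
    fix h assume "h \<in> carrier H" then show "f h ` A = A" by (rule imA)
  qed
  then obtain C where C: "C \<in> ?E" "C \<noteq> A" "\<And>h. h \<in> carrier H \<Longrightarrow> f h ` C = C" by blast
  then obtain x where x: "x \<in> carrier G" "C = A #>\<^bsub>G\<^esub> x" by (auto simp: RCOSETS_def)
  show thesis
  proof (rule that[of x])
    show "x \<notin> A" using C x A by (auto simp: G.coset_join2)
    fix h assume h: "h \<in> carrier H"
    have "x \<in> C" using x A by (simp add: G.rcos_self)
    then have "f h x \<in> A #>\<^bsub>G\<^esub> x" using C(3)[OF h] x by blast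
    then show "f h x \<otimes>\<^bsub>G\<^esub> inv\<^bsub>G\<^esub> x \<in> A"
      using subgroup.rcos_module_imp[OF A(1) G.is_group x(1)] by blast
  qed (fact x)
qed

section \<open>The Frattini quotient\<close>

text \<open>
  For \<open>x\<close> normalizing \<open>V\<close> this is the subgroup generated by \<open>V\<close> and \<open>x\<close>; the explicit form gives its
  order.
\<close>

definition (in monoid) adjoin :: "'a set \<Rightarrow> 'a \<Rightarrow> 'a set" where
  "adjoin V x = {v \<otimes> x [^] i | v (i :: nat). v \<in> V}"

lemma (in monoid) adjoinI: "v \<in> V \<Longrightarrow> v \<otimes> x [^] (i :: nat) \<in> adjoin V x"
  by (auto simp: adjoin_def)

lemma (in monoid) adjoinE:
  assumes "a \<in> adjoin V x"
  obtains v and i :: nat where "v \<in> V" "a = v \<otimes> x [^] i"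
  using assms by (auto simp: adjoin_def)

lemma (in group) adjoin_subset:
  assumes "subgroup V G" "x \<in> carrier G"
  shows "V \<subseteq> adjoin V x" "x \<in> adjoin V x" "adjoin V x \<subseteq> carrier G"
proof -
  have V: "V \<subseteq> carrier G" using assms(1) by (rule subgroup.subset)
  show "V \<subseteq> adjoin V x"
  proof
    fix v assume "v \<in> V"
    then show "v \<in> adjoin V x" using adjoinI[of v V x 0] V by auto
  qed
  show "x \<in> adjoin V x"
    using adjoinI[OF subgroup.one_closed[OF assms(1)], of x 1] assms by simp
  show "adjoin V x \<subseteq> carrier G" using V assms(2) by (auto simp: adjoin_def)
qed

lemma (in group) conj_pow_closed:
  assumes V: "V \<subseteq> carrier G" and x: "x \<in> carrier G"
    and nrm: "\<And>v. v \<in> V \<Longrightarrow> x \<otimes> v \<otimes> inv x \<in> V" and v: "v \<in> V"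
  shows "x [^] (i::nat) \<otimes> v \<otimes> inv (x [^] i) \<in> V"
  using v
proof (induction i arbitrary: v)
  case 0 then show ?case using V by auto
next
  case (Suc i)
  have "v \<in> carrier G" using Suc.prems V by blast
  then have "x [^] Suc i \<otimes> v \<otimes> inv (x [^] Suc i) = x [^] i \<otimes> (x \<otimes> v \<otimes> inv x) \<otimes> inv (x [^] i)"
    using x by (simp add: m_assoc inv_mult_group)
  then show ?case using Suc.IH[OF nrm[OF Suc.prems]] by simp
qed

lemma (in group) adjoin_is_subgroup:
  assumes fin: "finite (carrier G)" and V: "subgroup V G" and x: "x \<in> carrier G"
    and nrm: "\<And>v. v \<in> V \<Longrightarrow> x \<otimes> v \<otimes> inv x \<in> V"
  shows "subgroup (adjoin V x) G"
proof (rule finite_subgroupI[OF fin])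
  have Vc: "v \<in> carrier G" if "v \<in> V" for v by (rule subgroup.mem_carrier[OF V that])
  fix a b assume "a \<in> adjoin V x" "b \<in> adjoin V x"
  then obtain v i w j where v: "v \<in> V" "a = v \<otimes> x [^] (i::nat)" and w: "w \<in> V" "b = w \<otimes> x [^] (j::nat)"
    by (auto simp: adjoin_def)
  have "x [^] i \<otimes> w = (x [^] i \<otimes> w \<otimes> inv (x [^] i)) \<otimes> x [^] i"
    using Vc[OF w(1)] x by (simp add: m_assoc)
  then have "a \<otimes> b = (v \<otimes> (x [^] i \<otimes> w \<otimes> inv (x [^] i))) \<otimes> x [^] (i + j)"
    using Vc[OF v(1)] Vc[OF w(1)] x v(2) w(2)
    by (simp add: m_assoc nat_pow_mult[symmetric] inv_solve_left)
  then show "a \<otimes> b \<in> adjoin V x"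
    using subgroup.m_closed[OF V v(1) conj_pow_closed[OF subgroup.subset[OF V] x nrm w(1)]] adjoinI by simp
qed (use adjoin_subset[OF V x] subgroup.one_closed[OF V] in auto)

lemma (in group) card_adjoin_le:
  assumes fin: "finite (carrier G)" and V: "subgroup V G" and x: "x \<in> carrier G"
    and xp: "x [^] (p::nat) \<in> V" and p: "p > 0"
  shows "card (adjoin V x) \<le> p * card V"
proof -
  have Vc: "v \<in> carrier G" if "v \<in> V" for v by (rule subgroup.mem_carrier[OF V that])
  have "adjoin V x \<subseteq> (\<lambda>(v, i). v \<otimes> x [^] i) ` (V \<times> {..<p})"
  proof
    fix a assume "a \<in> adjoin V x"
    then obtain v i where v: "v \<in> V" "a = v \<otimes> x [^] (i::nat)" by (auto simp: adjoin_def)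
    have "x [^] i = x [^] (p * (i div p) + i mod p)" by simp
    also have "\<dots> = (x [^] p) [^] (i div p) \<otimes> x [^] (i mod p)"
      using x by (simp only: nat_pow_mult[symmetric] nat_pow_pow)
    finally have "a = (v \<otimes> (x [^] p) [^] (i div p)) \<otimes> x [^] (i mod p)"
      using v Vc x by (simp add: m_assoc)
    moreover have "v \<otimes> (x [^] p) [^] (i div p) \<in> V" using subgroup.m_closed[OF V v(1) subgroup_nat_pow[OF V xp]] .
    moreover have "i mod p \<in> {..<p}" using p by simp
    ultimately show "a \<in> (\<lambda>(v, i). v \<otimes> x [^] i) ` (V \<times> {..<p})"
      by (intro image_eqI[where x = "(v \<otimes> (x [^] p) [^] (i div p), i mod p)"]) auto
  qed
  then have "card (adjoin V x) \<le> card (V \<times> {..<p})"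
    using finite_subset[OF subgroup.subset[OF V] fin] by (intro surj_card_le) auto
  then show ?thesis by (simp add: card_cartesian_product mult.commute)
qed

context finite_p_group
begin

lemma pow_p_tower_one:
  assumes "x \<in> carrier G" shows "\<exists>n. x [^] (p ^ n) = \<one>"
  using pow_card_carrier[OF fin assms] card_prime_power by auto

lemma card_adjoin:
  assumes V: "subgroup V G" and x: "x \<in> carrier G" "x \<notin> V" "x [^] p \<in> V"
    and nrm: "\<And>v. v \<in> V \<Longrightarrow> x \<otimes> v \<otimes> inv x \<in> V"
  shows "card (adjoin V x) = p * card V"
proof (rule antisym)
  show "card (adjoin V x) \<le> p * card V"
    using card_adjoin_le[OF fin V x(1,3)] p_gt_1 by simp
  have "V \<subset> adjoin V x" using adjoin_subset[OF V x(1)] x(2) by blast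
  with index_le[OF V adjoin_is_subgroup[OF fin V x(1) nrm]]
  show "p * card V \<le> card (adjoin V x)" by simp
qed

definition maximal_subgroup :: "'a set \<Rightarrow> bool" where
  "maximal_subgroup M \<longleftrightarrow> subgroup M G \<and> M \<noteq> carrier G \<and>
     (\<forall>K. subgroup K G \<longrightarrow> M \<subseteq> K \<longrightarrow> K = M \<or> K = carrier G)"

lemma maximal_subgroup_above:
  assumes "subgroup K G" "K \<noteq> carrier G"
  obtains M where "maximal_subgroup M" "K \<subseteq> M"
proof -
  let ?S = "{M. subgroup M G \<and> K \<subseteq> M \<and> M \<noteq> carrier G}"
  have "?S \<subseteq> Pow (carrier G)" using subgroup.subset by blast
  then have "finite ?S" using finite_subset fin by blast
  moreover have "K \<in> ?S" using assms by simp
  ultimately obtain M where M: "M \<in> ?S" "\<forall>L\<in>?S. M \<subseteq> L \<longrightarrow> M = L"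
    using finite_has_maximal2[of ?S K] by blast
  have "maximal_subgroup M" unfolding maximal_subgroup_def using M by blast
  then show thesis using that M by blast
qed

text \<open>
  If \<open>M\<close> acts on \<open>G\<close> by conjugation, a fixed coset other than \<open>M\<close> provides an element outside \<open>M\<close> that
  normalizes \<open>M\<close>; together with \<open>M\<close> it generates the whole group.
\<close>

lemma maximal_subgroup_normal:
  assumes M: "maximal_subgroup M"
  shows "M \<lhd> G"
proof -
  have sub: "subgroup M G" "M \<noteq> carrier G" using M by (auto simp: maximal_subgroup_def)
  have Mc: "m \<in> carrier G" if "m \<in> M" for m using subgroup.mem_carrier[OF sub(1) that] .
  interpret HM: finite_p_group "G\<lparr>carrier := M\<rparr>" p by (rule subgroup_p_group[OF sub(1)])
  obtain x where x: "x \<in> carrier G" "x \<notin> M"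
    and fx: "\<And>m. m \<in> carrier (G\<lparr>carrier := M\<rparr>) \<Longrightarrow> m \<otimes> x \<otimes> inv m \<otimes> inv x \<in> M"
    by (rule p_group_fixes_coset[of G p "G\<lparr>carrier := M\<rparr>" M "\<lambda>m x. m \<otimes> x \<otimes> inv m"])
      (use sub Mc in \<open>auto intro: finite_p_group_axioms HM.finite_p_group_axioms simp: m_assoc inv_mult_group
          inv_solve_left subgroup.m_closed subgroup.m_inv_closed\<close>)
  have nx: "x \<otimes> m \<otimes> inv x \<in> M" if m: "m \<in> M" for m
  proof -
    have i: "inv m \<in> M" using m sub by (simp add: subgroup.m_inv_closed)
    have "inv m \<otimes> x \<otimes> m \<otimes> inv x \<in> M" using fx[of "inv m"] i Mc[OF m] by simp
    then have "m \<otimes> (inv m \<otimes> x \<otimes> m \<otimes> inv x) \<in> M" by (rule subgroup.m_closed[OF sub(1) m])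
    then show ?thesis using Mc[OF m] x by (simp add: m_assoc[symmetric])
  qed
  have "subgroup (adjoin M x) G" by (rule adjoin_is_subgroup[OF fin sub(1) x(1) nx])
  then have all: "adjoin M x = carrier G"
    using M adjoin_subset[OF sub(1) x(1)] x(2) unfolding maximal_subgroup_def by blast
  show ?thesis
  proof (rule normal_invI[OF sub(1)])
    fix g m assume g: "g \<in> carrier G" and m: "m \<in> M"
    then obtain n i where n: "n \<in> M" "g = n \<otimes> x [^] (i::nat)" using adjoinE[of g M x] all g by metis
    have "g \<otimes> m \<otimes> inv g = n \<otimes> (x [^] i \<otimes> m \<otimes> inv (x [^] i)) \<otimes> inv n"
      using Mc[OF m] Mc[OF n(1)] x n(2) by (simp add: m_assoc inv_mult_group)
    then show "g \<otimes> m \<otimes> inv g \<in> M"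
      using conj_pow_closed[OF subgroup.subset[OF sub(1)] x(1) nx m] n(1) sub(1) by (simp add: subgroup.m_closed subgroup.m_inv_closed)
  qed
qed

text \<open>
  The quotient by a maximal subgroup is generated by one element \<open>y\<close> of order \<open>p\<close>.
\<close>

lemma maximal_subgroup_quotient:
  assumes M: "maximal_subgroup M" and a: "a \<in> carrier G" and b: "b \<in> carrier G"
  shows "a [^] p \<in> M" "a \<otimes> b \<otimes> inv a \<otimes> inv b \<in> M"
proof -
  have sub: "subgroup M G" "M \<noteq> carrier G" using M by (auto simp: maximal_subgroup_def)
  interpret M: normal M G by (rule maximal_subgroup_normal[OF M])
  interpret Q: group "G Mod M" by (rule M.factorgroup_is_group)
  interpret \<pi>: group_hom G "G Mod M" "\<lambda>g. M #> g"
    using M.r_coset_hom_Mod by unfold_locales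
  have inM: "g \<in> M" if "g \<in> carrier G" "M #> g = M" for g
    using that by (metis rcos_self sub(1))
  obtain x where x: "x \<in> carrier G" "x \<notin> M" using sub subgroup.subset by blast
  obtain n where "x [^] (p ^ n) = \<one>" using pow_p_tower_one[OF x(1)] by blast
  then have ex: "\<exists>n. x [^] (p ^ n) \<in> M" using subgroup.one_closed[OF sub(1)] by metis
  \<comment> \<open>The last iterated p-th power of x outside M serves as the generator y.\<close>
  define n0 where "n0 = (LEAST n. x [^] (p ^ n) \<in> M)"
  have n0: "x [^] (p ^ n0) \<in> M" unfolding n0_def using ex by (rule LeastI_ex)
  then have "n0 \<noteq> 0" using x by (auto intro: gr0I)
  then obtain l where l: "n0 = Suc l" by (cases n0) auto
  define y where "y = x [^] (p ^ l)"
  have yc: "y \<in> carrier G" using x by (simp add: y_def)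
  have yM: "y \<notin> M" using not_less_Least[of l "\<lambda>n. x [^] (p ^ n) \<in> M"] l by (simp add: n0_def y_def)
  have yp: "y [^] p \<in> M" using n0 l x by (simp add: y_def nat_pow_pow mult.commute)
  have nrm: "y \<otimes> m \<otimes> inv y \<in> M" if "m \<in> M" for m using M.inv_op_closed2[OF yc that] .
  have "subgroup (adjoin M y) G" by (rule adjoin_is_subgroup[OF fin sub(1) yc nrm])
  then have all: "adjoin M y = carrier G"
    using M adjoin_subset[OF sub(1) yc] yM unfolding maximal_subgroup_def by blast
  have pow: "\<exists>i::nat. M #> g = (M #> y) [^]\<^bsub>G Mod M\<^esub> i" if g: "g \<in> carrier G" for g
  proof -
    obtain m i where m: "m \<in> M" "g = m \<otimes> y [^] (i::nat)" using adjoinE[of g M y] all g by metis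
    have "M #> g = (M #> m) \<otimes>\<^bsub>G Mod M\<^esub> (M #> y [^] i)" using m yc M.mem_carrier by (simp only: \<pi>.hom_mult nat_pow_closed)
    also have "M #> m = \<one>\<^bsub>G Mod M\<^esub>" using m M.mem_carrier sub by (simp add: coset_join2)
    also have "\<one>\<^bsub>G Mod M\<^esub> \<otimes>\<^bsub>G Mod M\<^esub> (M #> y [^] i) = M #> y [^] i"
      by (rule Q.l_one) (rule \<pi>.hom_closed, simp add: yc)
    also have "\<dots> = (M #> y) [^]\<^bsub>G Mod M\<^esub> i" using yc by (rule \<pi>.hom_nat_pow)
    finally show ?thesis by blast
  qed
  have Yc: "M #> y \<in> carrier (G Mod M)" using yc by (rule \<pi>.hom_closed)
  obtain i where i: "M #> a = (M #> y) [^]\<^bsub>G Mod M\<^esub> (i::nat)" using pow[OF a] by blast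
  obtain j where j: "M #> b = (M #> y) [^]\<^bsub>G Mod M\<^esub> (j::nat)" using pow[OF b] by blast
  have Yp: "(M #> y) [^]\<^bsub>G Mod M\<^esub> p = \<one>\<^bsub>G Mod M\<^esub>"
    using \<pi>.hom_nat_pow[OF yc, of p] yp yc sub by (simp add: coset_join2)
  have "M #> (a [^] p) = (M #> a) [^]\<^bsub>G Mod M\<^esub> p" using a by (rule \<pi>.hom_nat_pow)
  also have "\<dots> = ((M #> y) [^]\<^bsub>G Mod M\<^esub> p) [^]\<^bsub>G Mod M\<^esub> i"
    using Yc i by (simp only: Q.nat_pow_pow mult.commute)
  also have "\<dots> = M" using Yp Q.nat_pow_one[of i] by simp
  finally show "a [^] p \<in> M" using inM a by simp
  have "M #> (a \<otimes> b) = M #> (b \<otimes> a)"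
    using a b i j Yc by (simp only: \<pi>.hom_mult Q.nat_pow_mult add.commute)
  then have "a \<otimes> b \<otimes> inv (b \<otimes> a) \<in> M"
    using a b sub(1) by (metis m_closed rcos_self M.rcos_module_imp is_group)
  then show "a \<otimes> b \<otimes> inv a \<otimes> inv b \<in> M" using a b by (simp add: inv_mult_group m_assoc)
qed

lemma generate_chain:
  assumes "subgroup P G" "card (carrier G) \<le> p ^ m * card P"
  shows "\<exists>S \<subseteq> carrier G. finite S \<and> card S \<le> m \<and> generate G (S \<union> P) = carrier G"
  using assms
proof (induction m arbitrary: P)
  case 0
  have "P = carrier G"
    using 0 subgroup.subset[OF 0(1)] by (intro card_seteq) auto
  then show ?case using generate_incl[of "carrier G"] generate.incl[of _ "carrier G" G]
    by (intro exI[of _ "{}"]) auto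
next
  case (Suc m)
  show ?case
  proof (cases "P = carrier G")
    case True
    then show ?thesis using generate_incl[of "carrier G"] generate.incl[of _ "carrier G" G]
      by (intro exI[of _ "{}"]) auto
  next
    case False
    have Pc: "P \<subseteq> carrier G" using subgroup.subset[OF Suc.prems(1)] .
    then obtain x where x: "x \<in> carrier G" "x \<notin> P" using False by blast
    let ?P = "generate G (insert x P)"
    have sub: "subgroup ?P G" using x Pc by (intro generate_is_subgroup) auto
    have "P \<subseteq> ?P" "x \<in> ?P" by (auto intro: generate.incl)
    then have "p * card P \<le> card ?P" using index_le[OF Suc.prems(1) sub] x by blast
    then have "p ^ m * (p * card P) \<le> p ^ m * card ?P" by (rule mult_le_mono2)
    then have "card (carrier G) \<le> p ^ m * card ?P"
      using Suc.prems(2) by (metis le_trans mult.assoc mult.commute power_Suc)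
    from Suc.IH[OF sub this] obtain S where S: "S \<subseteq> carrier G" "finite S" "card S \<le> m"
      "generate G (S \<union> ?P) = carrier G" by blast
    have "S \<union> ?P \<subseteq> generate G (insert x S \<union> P)"
      using mono_generate[of "insert x P" "insert x S \<union> P"] generate.incl[of _ "insert x S \<union> P" G] by auto
    then have "generate G (S \<union> ?P) \<subseteq> generate G (insert x S \<union> P)"
      using generate_subgroup_incl generate_is_subgroup S(1) x(1) Pc by (metis insert_subset le_sup_iff)
    then have "generate G (insert x S \<union> P) = carrier G"
      using S(1,4) x Pc generate_incl[of "insert x S \<union> P"] by auto
    moreover have "card (insert x S) \<le> Suc m" using S(2,3) by (simp add: card_insert_if)
    ultimately show ?thesis using S x by (intro exI[of _ "insert x S"]) auto
  qed
qed

text \<open>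
  Burnside's basis theorem in the form needed here: elements of the Frattini subgroup are redundant in
  every generating set, and it is one of the subgroups \<open>P\<close> for which the bound is assumed.
\<close>

theorem min_gens_le:
  assumes bound: "\<And>P. subgroup P G \<Longrightarrow> (\<And>x. x \<in> carrier G \<Longrightarrow> x [^] p \<in> P) \<Longrightarrow>
      (\<And>x y. x \<in> carrier G \<Longrightarrow> y \<in> carrier G \<Longrightarrow> x \<otimes> y \<otimes> inv x \<otimes> inv y \<in> P) \<Longrightarrow>
      card (carrier G) \<le> p ^ m * card P"
  shows "min_gens G \<le> enat m"
proof -
  define P where "P = \<Inter> (insert (carrier G) {M. maximal_subgroup M})"
  have "subgroup P G"
    unfolding P_def by (rule subgroups_Inter) (auto simp: subgroup_self maximal_subgroup_def)
  moreover have "x [^] p \<in> P" if "x \<in> carrier G" for x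
    using that maximal_subgroup_quotient(1) by (auto simp: P_def)
  moreover have "x \<otimes> y \<otimes> inv x \<otimes> inv y \<in> P" if "x \<in> carrier G" "y \<in> carrier G" for x y
    using that maximal_subgroup_quotient(2) by (auto simp: P_def)
  ultimately obtain S where S: "S \<subseteq> carrier G" "finite S" "card S \<le> m" "generate G (S \<union> P) = carrier G"
    using generate_chain[of P m] bound[of P] by blast
  have "generate G S = carrier G"
  proof (rule ccontr)
    assume ne: "generate G S \<noteq> carrier G"
    obtain M where M: "maximal_subgroup M" "generate G S \<subseteq> M"
      using maximal_subgroup_above[OF generate_is_subgroup[OF S(1)] ne] by blast
    have "S \<union> P \<subseteq> M" using M generate.incl[of _ S G] by (auto simp: P_def)
    then have "carrier G \<subseteq> M"
      using S(4) generate_subgroup_incl M(1) unfolding maximal_subgroup_def by metis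
    then show False using M(1) subgroup.subset unfolding maximal_subgroup_def by blast
  qed
  then have "min_gens G \<le> enat (card S)"
    unfolding min_gens_def using S by (intro INF_lower) auto
  also have "\<dots> \<le> enat m" using S by simp
  finally show ?thesis .
qed

end

section \<open>Index estimates, triangle-free graphs and torsion\<close>

text \<open>
  For subgroups \<open>N \<subseteq> S\<close> this is the inequality
  \<open>[S : S \<inter> P] \<le> c [N : N \<inter> P]\<close> without divisions.
\<close>

definition layer_bound :: "'a set \<Rightarrow> nat \<Rightarrow> 'a set \<Rightarrow> 'a set \<Rightarrow> bool" where
  "layer_bound P c S N \<longleftrightarrow> card S * card (N \<inter> P) \<le> c * (card N * card (S \<inter> P))"

lemma layer_bound_trans:
  assumes 1: "layer_bound P c S N" and 2: "layer_bound P d N L" and pos: "card N > 0" "card (N \<inter> P) > 0"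
  shows "layer_bound P (c * d) S L"
proof -
  have "(card S * card (N \<inter> P)) * (card N * card (L \<inter> P)) \<le>
      (c * (card N * card (S \<inter> P))) * (d * (card L * card (N \<inter> P)))"
    using 1 2 unfolding layer_bound_def by (rule mult_le_mono)
  then have "(card N * card (N \<inter> P)) * (card S * card (L \<inter> P)) \<le>
      (card N * card (N \<inter> P)) * (c * d * (card L * card (S \<inter> P)))"
    by (simp add: ac_simps)
  then show ?thesis using pos unfolding layer_bound_def by simp
qed

lemma layer_bound_mono:
  assumes "layer_bound P c S N" "c \<le> d" shows "layer_bound P d S N"
  using assms le_trans mult_le_mono1 unfolding layer_bound_def by blast

lemma layer_bound_index:
  assumes "card S \<le> c * card N" "N \<subseteq> S" "finite S"
  shows "layer_bound P c S N"
proof -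
  have "card (N \<inter> P) \<le> card (S \<inter> P)" using assms by (intro card_mono) auto
  with assms(1) have "card S * card (N \<inter> P) \<le> (c * card N) * card (S \<inter> P)" by (rule mult_le_mono)
  then show ?thesis by (simp add: layer_bound_def ac_simps)
qed

lemma (in group) card_eq_card_image_times:
  assumes fin: "finite (carrier G)" and S: "subgroup S G" and N: "subgroup N G" "N \<subseteq> S"
    and f: "\<And>x y. x \<in> S \<Longrightarrow> y \<in> S \<Longrightarrow> f x = f y \<longleftrightarrow> x \<otimes> inv y \<in> N"
  shows "card S = card (f ` S) * card N"
proof -
  have finS: "finite S" using finite_subset[OF subgroup.subset[OF S] fin] .
  have Sc: "x \<in> carrier G" if "x \<in> S" for x using subgroup.mem_carrier[OF S that] .
  have Nc: "N \<subseteq> carrier G" using subgroup.subset[OF N(1)] .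
  have fibre: "card {x \<in> S. f x = f z} = card N" if z: "z \<in> S" for z
  proof -
    have "{x \<in> S. f x = f z} = N #> z"
    proof (intro equalityI subsetI)
      fix x assume "x \<in> {x \<in> S. f x = f z}"
      then have x: "x \<in> S" "x \<otimes> inv z \<in> N" using f z by auto
      have "x = (x \<otimes> inv z) \<otimes> z" using Sc[OF x(1)] Sc[OF z] by (simp add: m_assoc)
      then show "x \<in> N #> z" using x(2) by (auto simp: r_coset_def)
    next
      fix x assume "x \<in> N #> z"
      then obtain n where n: "n \<in> N" "x = n \<otimes> z" by (auto simp: r_coset_def)
      have "x \<in> S" using n z N(2) subgroup.m_closed[OF S] by auto
      moreover have "x \<otimes> inv z = n" using n Nc Sc[OF z] by (auto simp: m_assoc)
      ultimately show "x \<in> {x \<in> S. f x = f z}" using f z n by auto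
    qed
    moreover have "N #> z \<in> rcosets N" using Nc Sc[OF z] by (rule rcosetsI)
    ultimately show ?thesis using card_rcosets_equal[OF _ Nc] by metis
  qed
  have "card S = (\<Sum>y\<in>f ` S. card {x \<in> S. f x = y})"
    using sum.image_gen[OF finS, of "\<lambda>_. 1::nat" f] by simp
  also have "\<dots> = (\<Sum>y\<in>f ` S. card N)" by (rule sum.cong) (auto simp: fibre)
  finally show ?thesis by simp
qed

text \<open>
  The map \<open>f\<close> stands for reduction modulo \<open>N\<close>.  The image of \<open>S \<inter> P\<close> contains all classes of
  \<open>p\<close>-th powers, and their number is at least that of the classes of \<open>S\<close> divided by the largest
  fibre of the power map.
\<close>

lemma (in group) layer_bound_power:
  assumes fin: "finite (carrier G)" and S: "subgroup S G" and N: "subgroup N G" "N \<subseteq> S"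
    and P: "subgroup P G" and pw: "\<And>x. x \<in> S \<Longrightarrow> x [^] (p::nat) \<in> P"
    and f: "\<And>x y. x \<in> S \<Longrightarrow> y \<in> S \<Longrightarrow> f x = f y \<longleftrightarrow> x \<otimes> inv y \<in> N"
    and fibre: "\<And>x. x \<in> S \<Longrightarrow> card (f ` {y \<in> S. f (y [^] p) = f (x [^] p)}) \<le> c"
  shows "layer_bound P c S N"
proof -
  have finS: "finite S" using finite_subset[OF subgroup.subset[OF S] fin] .
  have SP: "subgroup (S \<inter> P) G" "subgroup (N \<inter> P) G"
    using S P N by (auto intro: subgroups_Inter_pair)
  have powS: "x [^] (n::nat) \<in> S" if "x \<in> S" for x n using subgroup_nat_pow[OF S that] .
  have 1: "card S = card (f ` S) * card N" by (rule card_eq_card_image_times[OF fin S N f])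
  have 2: "card (S \<inter> P) = card (f ` (S \<inter> P)) * card (N \<inter> P)"
  proof (rule card_eq_card_image_times[OF fin SP])
    show "N \<inter> P \<subseteq> S \<inter> P" using N by blast
    fix x y assume "x \<in> S \<inter> P" "y \<in> S \<inter> P"
    then show "f x = f y \<longleftrightarrow> x \<otimes> inv y \<in> N \<inter> P"
      using f[of x y] subgroup.m_closed[OF P] subgroup.m_inv_closed[OF P] by auto
  qed
  have "f ` S = (\<Union>w\<in>f ` (S \<inter> P). f ` {y \<in> S. f (y [^] p) = w})"
    using powS pw by auto
  then have "card (f ` S) \<le> (\<Sum>w\<in>f ` (S \<inter> P). card (f ` {y \<in> S. f (y [^] p) = w}))"
    using card_UN_le[of "f ` (S \<inter> P)" "\<lambda>w. f ` {y \<in> S. f (y [^] p) = w}"] finS by simp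
  also have "\<dots> \<le> (\<Sum>w\<in>f ` (S \<inter> P). c)"
  proof (rule sum_mono)
    fix w
    show "card (f ` {y \<in> S. f (y [^] p) = w}) \<le> c"
    proof (cases "\<exists>x\<in>S. f (x [^] p) = w")
      case True then show ?thesis using fibre by auto
    next
      case False
      then have "{y \<in> S. f (y [^] p) = w} = {}" by blast
      then show ?thesis by (simp only: image_empty card.empty)
    qed
  qed
  finally have "card (f ` S) \<le> card (f ` (S \<inter> P)) * c" by simp
  then have "card (f ` S) * (card N * card (N \<inter> P)) \<le> card (f ` (S \<inter> P)) * c * (card N * card (N \<inter> P))"
    by (rule mult_le_mono1)
  then show ?thesis unfolding layer_bound_def 1 2 by (simp add: ac_simps)
qed

text \<open>
  A step of index \<open>p\<close> that already occurs inside \<open>P\<close> costs nothing.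
\<close>

lemma (in finite_p_group) layer_bound_jump:
  assumes S: "subgroup S G" and N: "subgroup N G" "N \<subseteq> S" and P: "subgroup P G"
    and idx: "card S \<le> p * card N" and c: "c \<in> S" "c \<in> P" "c \<notin> N"
  shows "layer_bound P 1 S N"
proof -
  have "subgroup (S \<inter> P) G" "subgroup (N \<inter> P) G"
    using S P N by (auto intro: subgroups_Inter_pair)
  moreover have "N \<inter> P \<subset> S \<inter> P" using N c by blast
  ultimately have "p * card (N \<inter> P) \<le> card (S \<inter> P)" by (intro index_le)
  then have "card N * (p * card (N \<inter> P)) \<le> card N * card (S \<inter> P)" by (rule mult_le_mono2)
  moreover have "card S * card (N \<inter> P) \<le> p * card N * card (N \<inter> P)" using idx by (rule mult_le_mono1)
  ultimately have "card S * card (N \<inter> P) \<le> card N * card (S \<inter> P)"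
    by (metis le_trans mult.assoc mult.commute)
  then show ?thesis by (simp add: layer_bound_def)
qed

text \<open>
  Mantel's theorem, for graphs whose edges are increasing pairs.  Removing both ends of an edge loses
  that edge and at most one further edge for each remaining vertex.
\<close>

lemma triangle_free_card_le:
  fixes E :: "(nat \<times> nat) set"
  assumes "finite V" "E \<subseteq> V \<times> V" "\<And>a b. (a, b) \<in> E \<Longrightarrow> a < b"
    and "\<And>a b c. (a, b) \<in> E \<Longrightarrow> (b, c) \<in> E \<Longrightarrow> (a, c) \<notin> E"
  shows "4 * card E \<le> (card V)\<^sup>2"
  using assms
proof (induction "card V" arbitrary: V E rule: less_induct)
  case less
  show ?case
  proof (cases "E = {}")
    case True then show ?thesis by simp
  next
    case False
    then obtain u v where uv: "(u, v) \<in> E" by auto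
    have uvV: "u \<in> V" "v \<in> V" "u < v" using uv less.prems by auto
    define V' where "V' = V - {u, v}"
    define E' where "E' = E \<inter> V' \<times> V'"
    define D where "D = E - E' - {(u, v)}"
    have finE: "finite E" using less.prems(1,2) finite_subset finite_cartesian_product by metis
    have "V = insert u (insert v V')" "u \<notin> insert v V'" "v \<notin> V'" "finite V'"
      using uvV less.prems(1) by (auto simp: V'_def)
    then have cV: "card V = card V' + 2" by simp
    have IH: "4 * card E' \<le> (card V')\<^sup>2"
    proof (rule less.hyps)
      show "card V' < card V" using cV by simp
      show "finite V'" using less.prems(1) by (simp add: V'_def)
    qed (use less.prems(3,4) in \<open>auto simp: E'_def\<close>)
    \<comment> \<open>The end of an edge that survives the removal of u and v.\<close>
    define g where "g = (\<lambda>(a, b). if a = u \<or> a = v then b else a :: nat)"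
    have D: "(a, b) \<in> D \<Longrightarrow> (a, b) \<in> E \<and> (a, b) \<noteq> (u, v) \<and> (a = u \<or> a = v \<or> b = u \<or> b = v)" for a b
      using less.prems(2) by (auto simp: D_def E'_def V'_def)
    have "inj_on g D"
    proof (rule inj_onI)
      fix x y assume x: "x \<in> D" and y: "y \<in> D" and g: "g x = g y"
      obtain a b c d where ab: "x = (a, b)" "y = (c, d)" by (metis surj_pair)
      have 1: "(a, b) \<in> E" "(a, b) \<noteq> (u, v)" "a = u \<or> a = v \<or> b = u \<or> b = v" using D x ab by blast+
      have 2: "(c, d) \<in> E" "(c, d) \<noteq> (u, v)" "c = u \<or> c = v \<or> d = u \<or> d = v" using D y ab by blast+
      have 3: "a < b" "c < d" using 1 2 less.prems(3) by auto
      have T1: "(u, w) \<in> E \<Longrightarrow> (v, w) \<in> E \<Longrightarrow> False" for w using less.prems(4) uv by blast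
      have T2: "(w, u) \<in> E \<Longrightarrow> (w, v) \<in> E \<Longrightarrow> False" for w using less.prems(4) uv by blast
      have T3: "(u, w) \<in> E \<Longrightarrow> (w, v) \<in> E \<Longrightarrow> False" for w using less.prems(4) uv by blast
      show "x = y" using g 1 2 3 T1 T2 T3 uvV(3) unfolding ab g_def
        by (auto split: if_splits)
    qed
    moreover have "g ` D \<subseteq> V'"
    proof
      fix w assume "w \<in> g ` D"
      then obtain a b where ab: "(a, b) \<in> D" "w = g (a, b)" by auto
      then have "(a, b) \<in> E" "(a, b) \<noteq> (u, v)" "a = u \<or> a = v \<or> b = u \<or> b = v" "a < b" "a \<in> V" "b \<in> V"
        using D less.prems(2,3) by blast+
      then show "w \<in> V'" using uvV ab(2) by (auto simp: V'_def g_def split: if_splits)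
    qed
    ultimately have "card D \<le> card V'"
      using less.prems(1) by (metis card_inj_on_le V'_def finite_Diff)
    moreover have "card E \<le> card E' + 1 + card D"
    proof -
      have "E \<subseteq> E' \<union> {(u, v)} \<union> D" by (auto simp: D_def)
      then have "card E \<le> card (E' \<union> {(u, v)} \<union> D)"
        using finE by (intro card_mono) (auto simp: D_def E'_def)
      also have "\<dots> \<le> card (E' \<union> {(u, v)}) + card D" by (rule card_Un_le)
      also have "card (E' \<union> {(u, v)}) \<le> card E' + card {(u, v)}" by (rule card_Un_le)
      finally show ?thesis by simp
    qed
    ultimately have "4 * card E \<le> (card V')\<^sup>2 + 4 * (1 + card V')" using IH by simp
    also have "\<dots> = (card V)\<^sup>2" by (simp add: cV power2_eq_square algebra_simps)
    finally show ?thesis .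
  qed
qed

context comm_group
begin

definition power_image :: "nat \<Rightarrow> 'a set" where
  "power_image n = (\<lambda>x. x [^] n) ` carrier G"

definition torsion :: "nat \<Rightarrow> 'a set" where
  "torsion n = {x \<in> carrier G. x [^] n = \<one>}"

lemma power_image_subgroup: "subgroup (power_image n) G"
proof -
  have "(\<lambda>x. x [^] n) \<in> hom G G" by (auto simp: hom_def nat_pow_distrib)
  then interpret group_hom G G "\<lambda>x. x [^] n" by unfold_locales
  show ?thesis unfolding power_image_def by (rule img_is_subgroup)
qed

lemma torsion_subgroup: "subgroup (torsion n) G"
  by (rule subgroupI) (auto simp: torsion_def nat_pow_distrib nat_pow_inv)

lemma power_image_mult_subset: "power_image (m * n) \<subseteq> power_image m"
  by (auto simp: power_image_def) (metis image_eqI mult.commute nat_pow_closed nat_pow_pow)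

lemma power_image_pow:
  assumes "x \<in> power_image m" shows "x [^] n \<in> power_image (m * n)"
  using assms by (auto simp: power_image_def nat_pow_pow)

lemma power_image_root:
  assumes "x \<in> power_image (m * n)" shows "\<exists>y\<in>power_image m. x = y [^] n"
  using assms by (auto simp: power_image_def nat_pow_pow[symmetric])

lemma power_image_carrier: "x \<in> power_image n \<Longrightarrow> x \<in> carrier G"
  by (auto simp: power_image_def)

text \<open>
  If differences gained just one power of \<open>p\<close> under \<open>x \<mapsto> x^p\<close>, nothing could be said about the size
  of \<open>F\<close>.  The extra power forces a difference lying in \<open>G^(p^s)\<close> to agree modulo \<open>G^(p^(s+1))\<close> with
  an element of order dividing \<open>p\<close> in \<open>G^(p^s)\<close>.  Descending through the filtration, the classes of
  \<open>F\<close> are therefore no more numerous than those of the torsion subgroup.  The induction counts pairs of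
  an element of \<open>F\<close> and a torsion element close to it in two ways.
\<close>

lemma card_le_torsion_of_gain:
  assumes fin: "finite (carrier G)" and triv: "power_image (p ^ e) = {\<one>}"
    and F: "F \<subseteq> carrier G"
    and close: "\<And>x y. x \<in> F \<Longrightarrow> y \<in> F \<Longrightarrow> x \<otimes> inv y \<in> power_image (p ^ s)"
    and gain: "\<And>x y t. x \<in> F \<Longrightarrow> y \<in> F \<Longrightarrow> s \<le> t \<Longrightarrow> x \<otimes> inv y \<in> power_image (p ^ t) \<Longrightarrow>
        (x \<otimes> inv y) [^] p \<in> power_image (p ^ (t + 2))"
  shows "card F \<le> card (torsion p \<inter> power_image (p ^ s))"
  using F close gain
proof (induction "e - s" arbitrary: s F)
  case 0
  then have "power_image (p ^ s) \<subseteq> {\<one>}"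
    using power_image_mult_subset[of "p ^ e" "p ^ (s - e)"] triv by (simp add: power_add[symmetric])
  then have "x = y" if "x \<in> F" "y \<in> F" for x y
  proof -
    have "x \<otimes> inv y = \<one>" using \<open>power_image (p ^ s) \<subseteq> {\<one>}\<close> "0.prems"(2)[OF that] by blast
    moreover have "x \<in> carrier G" "y \<in> carrier G" using that "0.prems"(1) by auto
    ultimately show ?thesis using inv_equality[of x "inv y"] by simp
  qed
  then have "card F \<le> 1" by (metis card_le_Suc0_iff_eq One_nat_def F card.infinite le0)
  also have "\<one> \<in> torsion p \<inter> power_image (p ^ s)"
    using subgroup.one_closed[OF torsion_subgroup] subgroup.one_closed[OF power_image_subgroup] by blast
  then have "1 \<le> card (torsion p \<inter> power_image (p ^ s))"
    using fin by (metis One_nat_def Suc_leI card_gt_0_iff empty_iff finite_Int finite_subset power_image_subgroup subgroup.subset)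
  finally show ?case .
next
  case (Suc d)
  define B where "B = power_image (p ^ Suc s)"
  define T where "T = torsion p \<inter> power_image (p ^ s)"
  define T' where "T' = torsion p \<inter> B"
  have subB: "subgroup B G" unfolding B_def by (rule power_image_subgroup)
  have subT: "subgroup T G" "subgroup T' G" unfolding T_def T'_def B_def
    using torsion_subgroup power_image_subgroup by (auto intro: subgroups_Inter_pair)
  have T'T: "T' \<subseteq> T" using power_image_mult_subset[of "p ^ s" p]
    by (auto simp: T_def T'_def B_def mult.commute)
  have finT: "finite T" "finite T'" using subT fin finite_subset subgroup.subset by metis+
  have finF: "finite F" using Suc.prems(1) fin finite_subset by metis
  show ?case
  proof (cases "F = {}")
    case True then show ?thesis by simp
  next
    case False
    then obtain x0 where x0: "x0 \<in> F" by blast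
    have x0c: "x0 \<in> carrier G" using x0 Suc.prems(1) by blast
    define R where "R = (\<lambda>x t. x \<otimes> inv x0 \<otimes> inv t \<in> B)"
    have lower: "card T' \<le> card {t \<in> T. R x t}" if x: "x \<in> F" for x
    proof -
      have xc: "x \<in> carrier G" using x Suc.prems(1) by blast
      let ?u = "x \<otimes> inv x0"
      have u: "?u \<in> power_image (p ^ s)" using Suc.prems(2) x x0 by blast
      have "?u [^] p \<in> power_image (p ^ Suc s * p)"
        using Suc.prems(3)[OF x x0 order_refl u] by (simp add: ac_simps)
      then obtain w where w: "w \<in> B" "?u [^] p = w [^] p" using power_image_root B_def by metis
      have wc: "w \<in> carrier G" using w B_def power_image_carrier by metis
      have ws: "w \<in> power_image (p ^ s)"
        using w(1) power_image_mult_subset[of "p ^ s" p] by (auto simp: B_def mult.commute)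
      \<comment> \<open>u and w have the same p-th power, so their quotient is the torsion element close to u.\<close>
      have t0: "?u \<otimes> inv w \<in> T"
        using u ws w(2) xc x0c wc subgroup.m_closed[OF power_image_subgroup] subgroup.m_inv_closed[OF power_image_subgroup]
        by (auto simp: T_def torsion_def nat_pow_distrib nat_pow_inv)
      have "(\<lambda>t. (?u \<otimes> inv w) \<otimes> t) ` T' \<subseteq> {t \<in> T. R x t}"
      proof clarify
        fix t assume t: "t \<in> T'"
        have tc: "t \<in> carrier G" using t subgroup.mem_carrier[OF subT(2)] by blast
        have "x \<otimes> inv x0 \<otimes> inv (x \<otimes> inv x0 \<otimes> inv w \<otimes> t) = w \<otimes> inv t"
        proof -
          have "u \<otimes> inv (u \<otimes> inv w \<otimes> t) = w \<otimes> inv t" if "u \<in> carrier G" for u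
            using that wc tc by (simp add: inv_mult m_assoc[symmetric])
          from this[of ?u] show ?thesis using xc x0c by simp
        qed
        moreover have "w \<otimes> inv t \<in> B"
          using w(1) t subgroup.m_closed[OF subB] subgroup.m_inv_closed[OF subB] by (auto simp: T'_def)
        ultimately show "x \<otimes> inv x0 \<otimes> inv w \<otimes> t \<in> T \<and> R x (x \<otimes> inv x0 \<otimes> inv w \<otimes> t)"
          using subgroup.m_closed[OF subT(1) t0] T'T t by (auto simp: R_def)
      qed
      moreover have "inj_on (\<lambda>t. (?u \<otimes> inv w) \<otimes> t) T'"
        using inj_on_cmult[of "?u \<otimes> inv w"] xc x0c wc subgroup.subset[OF subT(2)] by (auto intro: inj_on_subset)
      ultimately show ?thesis using finT(1) by (intro card_inj_on_le) auto
    qed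
    have upper: "card {x \<in> F. R x t} \<le> card T'" if t: "t \<in> T" for t
      unfolding T'_def B_def
    proof (rule Suc.hyps(1))
      show "d = e - Suc s" using Suc.hyps(2) by simp
      show "{x \<in> F. R x t} \<subseteq> carrier G" using Suc.prems(1) by blast
      fix x y assume "x \<in> {x \<in> F. R x t}" "y \<in> {x \<in> F. R x t}"
      then have xy: "x \<in> F" "y \<in> F" "x \<otimes> inv x0 \<otimes> inv t \<in> B" "y \<otimes> inv x0 \<otimes> inv t \<in> B"
        by (auto simp: R_def)
      have c: "x \<in> carrier G" "y \<in> carrier G" "t \<in> carrier G"
        using xy Suc.prems(1) t subgroup.mem_carrier[OF subT(1)] by auto
      have "x \<otimes> inv x0 \<otimes> inv t \<otimes> inv (y \<otimes> inv x0 \<otimes> inv t) \<in> B"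
        using xy(3,4) subgroup.m_closed[OF subB] subgroup.m_inv_closed[OF subB] by blast
      moreover have "x \<otimes> inv x0 \<otimes> inv t \<otimes> inv (y \<otimes> inv x0 \<otimes> inv t) = x \<otimes> inv y"
      proof -
        let ?z = "inv x0 \<otimes> inv t"
        have z: "?z \<in> carrier G" using x0c c by simp
        have "x \<otimes> inv x0 \<otimes> inv t \<otimes> inv (y \<otimes> inv x0 \<otimes> inv t) = (x \<otimes> ?z) \<otimes> inv (y \<otimes> ?z)"
          using c x0c by (simp add: m_assoc)
        also have "\<dots> = x \<otimes> (?z \<otimes> inv ?z) \<otimes> inv y"
          using c z by (simp only: inv_mult_group m_assoc m_closed inv_closed)
        finally show ?thesis using c z by (simp only: r_inv r_one)
      qed
      ultimately show "x \<otimes> inv y \<in> power_image (p ^ Suc s)" by (simp add: B_def)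
      fix r assume r: "Suc s \<le> r" "x \<otimes> inv y \<in> power_image (p ^ r)"
      then show "(x \<otimes> inv y) [^] p \<in> power_image (p ^ (r + 2))"
        using Suc.prems(3)[OF xy(1,2), of r] by simp
    qed
    have "card F * card T' = (\<Sum>x\<in>F. card T')" by simp
    also have "\<dots> \<le> (\<Sum>x\<in>F. card {t \<in> T. R x t})" by (rule sum_mono[OF lower])
    also have "\<dots> = (\<Sum>x\<in>F. \<Sum>t\<in>T. if R x t then 1 else 0)"
      by (intro sum.cong refl) (simp only: card_eq_sum sum.inter_filter[OF finT(1)])
    also have "\<dots> = (\<Sum>t\<in>T. \<Sum>x\<in>F. if R x t then 1 else 0)" by (rule sum.swap)
    also have "\<dots> = (\<Sum>t\<in>T. card {x \<in> F. R x t})"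
      by (intro sum.cong refl) (simp only: card_eq_sum sum.inter_filter[OF finF])
    also have "\<dots> \<le> (\<Sum>t\<in>T. card T')" by (rule sum_mono[OF upper])
    finally have "card F * card T' \<le> card T * card T'" by simp
    moreover have "card T' > 0" using card_subgroup_pos[OF fin subT(2)] .
    ultimately show ?thesis by (simp add: T_def)
  qed
qed

end

section \<open>Groups acting on p-groups and invariant flags\<close>

lemma (in group) product_group_pow:
  assumes "x \<in> carrier (product_group I (\<lambda>_. G))"
  shows "x [^]\<^bsub>product_group I (\<lambda>_. G)\<^esub> (n::nat) = (\<lambda>i\<in>I. x i [^] n)"
  using assms by (induction n) (auto simp: fun_eq_iff)

text \<open>
  The preceding estimate in the power \<open>G^I\<close>; automorphisms enter through their values on generators.
\<close>

lemma (in comm_group) card_tuples_le_torsion_of_gain: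
  assumes fin: "finite (carrier G)" and triv: "power_image (p ^ e) = {\<one>}" and I: "finite I"
    and F: "F \<subseteq> I \<rightarrow>\<^sub>E carrier G"
    and close: "\<And>x y i. x \<in> F \<Longrightarrow> y \<in> F \<Longrightarrow> i \<in> I \<Longrightarrow> x i \<otimes> inv y i \<in> power_image (p ^ s)"
    and gain: "\<And>x y t. x \<in> F \<Longrightarrow> y \<in> F \<Longrightarrow> s \<le> t \<Longrightarrow> \<forall>i\<in>I. x i \<otimes> inv y i \<in> power_image (p ^ t) \<Longrightarrow>
        \<forall>i\<in>I. (x i \<otimes> inv y i) [^] p \<in> power_image (p ^ (t + 2))"
  shows "card F \<le> card (torsion p) ^ card I"
proof -
  let ?M = "product_group I (\<lambda>_. G)"
  interpret M: comm_group ?M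
    by (rule group.group_comm_groupI) (auto simp: m_comm PiE_iff intro!: restrict_ext)
  have inv: "inv\<^bsub>?M\<^esub> y = (\<lambda>i\<in>I. inv y i)" if "y \<in> carrier ?M" for y
    using that by (subst inv_product_group) auto
  have img: "M.power_image n = (I \<rightarrow>\<^sub>E power_image n)" for n
  proof (intro equalityI subsetI)
    fix x assume "x \<in> M.power_image n"
    then show "x \<in> (I \<rightarrow>\<^sub>E power_image n)"
      by (auto simp: M.power_image_def power_image_def product_group_pow)
  next
    fix x assume x: "x \<in> (I \<rightarrow>\<^sub>E power_image n)"
    then have "\<forall>i\<in>I. \<exists>y. y \<in> carrier G \<and> x i = y [^] n" by (auto simp: power_image_def PiE_iff)
    then obtain y where y: "\<forall>i\<in>I. y i \<in> carrier G \<and> x i = y i [^] n" by metis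
    have yc: "restrict y I \<in> carrier ?M" using y by auto
    moreover have "x = restrict y I [^]\<^bsub>?M\<^esub> n"
      using x y by (auto simp: product_group_pow[OF yc] fun_eq_iff PiE_iff extensional_def)
    ultimately show "x \<in> M.power_image n" unfolding M.power_image_def by blast
  qed
  have diff: "x \<otimes>\<^bsub>?M\<^esub> inv\<^bsub>?M\<^esub> y = (\<lambda>i\<in>I. x i \<otimes> inv y i)" if "x \<in> F" "y \<in> F" for x y
  proof -
    have "y \<in> carrier ?M" using F that by auto
    then show ?thesis by (simp only: inv) (auto simp: fun_eq_iff)
  qed
  have dc: "(\<lambda>i\<in>I. x i \<otimes> inv y i) \<in> carrier ?M" if "x \<in> F" "y \<in> F" for x y
    using F that by (auto simp: PiE_iff subset_iff)
  have "card F \<le> card (M.torsion p \<inter> M.power_image (p ^ s))"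
  proof (rule M.card_le_torsion_of_gain)
    show "finite (carrier ?M)" using fin I by (simp add: finite_PiE)
    show "M.power_image (p ^ e) = {\<one>\<^bsub>?M\<^esub>}"
      by (auto simp: img triv PiE_iff extensional_def fun_eq_iff)
    show "F \<subseteq> carrier ?M" using F by simp
    fix x y assume xy: "x \<in> F" "y \<in> F"
    show "x \<otimes>\<^bsub>?M\<^esub> inv\<^bsub>?M\<^esub> y \<in> M.power_image (p ^ s)"
      using close[OF xy] by (simp only: diff[OF xy] img) (simp add: PiE_iff)
    fix t assume st: "s \<le> t" and "x \<otimes>\<^bsub>?M\<^esub> inv\<^bsub>?M\<^esub> y \<in> M.power_image (p ^ t)"
    then have "\<forall>i\<in>I. x i \<otimes> inv y i \<in> power_image (p ^ t)"
      by (simp only: diff[OF xy] img) (simp add: PiE_iff)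
    then have "\<forall>i\<in>I. (x i \<otimes> inv y i) [^] p \<in> power_image (p ^ (t + 2))" using gain xy st by blast
    then show "(x \<otimes>\<^bsub>?M\<^esub> inv\<^bsub>?M\<^esub> y) [^]\<^bsub>?M\<^esub> p \<in> M.power_image (p ^ (t + 2))"
      by (simp only: diff[OF xy] img product_group_pow[OF dc[OF xy]]) (simp add: PiE_iff)
  qed
  also have "\<dots> \<le> card (I \<rightarrow>\<^sub>E torsion p)"
  proof (rule card_mono)
    show "finite (I \<rightarrow>\<^sub>E torsion p)" using fin I by (auto intro!: finite_PiE simp: torsion_def)
    show "M.torsion p \<inter> M.power_image (p ^ s) \<subseteq> (I \<rightarrow>\<^sub>E torsion p)"
    proof
      fix x assume "x \<in> M.torsion p \<inter> M.power_image (p ^ s)"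
      then have x: "x \<in> carrier ?M" "(\<lambda>i\<in>I. x i [^] p) = (\<lambda>i\<in>I. \<one>)"
        by (auto simp: M.torsion_def product_group_pow)
      then have "x i [^] p = \<one>" if "i \<in> I" for i using that by (metis restrict_apply')
      then show "x \<in> (I \<rightarrow>\<^sub>E torsion p)" using x(1) by (auto simp: torsion_def PiE_iff)
    qed
  qed
  also have "card (I \<rightarrow>\<^sub>E torsion p) = card (torsion p) ^ card I" using I by (simp add: card_PiE)
  finally show ?thesis .
qed

lemma (in comm_group) card_torsion_quotient:
  assumes fin: "finite (carrier G)" and S: "subgroup S G"
  shows "card S = card ((\<lambda>x. x [^] (n::nat)) ` S) * card (S \<inter> torsion n)"
proof (rule card_eq_card_image_times[OF fin S])
  show "subgroup (S \<inter> torsion n) G" using S torsion_subgroup by (rule subgroups_Inter_pair)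
  fix x y assume xy: "x \<in> S" "y \<in> S"
  then have c: "x \<in> carrier G" "y \<in> carrier G" using subgroup.mem_carrier[OF S] by auto
  have "x \<otimes> inv y \<in> S" using xy S by (simp add: subgroup.m_closed subgroup.m_inv_closed)
  moreover have "x [^] n = y [^] n \<longleftrightarrow> (x \<otimes> inv y) [^] n = \<one>"
    using c inv_solve_right[of \<one> "x [^] n" "y [^] n"] by (auto simp: nat_pow_distrib nat_pow_inv inv_solve_right')
  ultimately show "x [^] n = y [^] n \<longleftrightarrow> x \<otimes> inv y \<in> S \<inter> torsion n"
    using c by (simp add: torsion_def)
qed auto

locale p_action = G: finite_p_group G p + H: finite_p_group H p
  for G :: "('a, 'b) monoid_scheme" (structure) and H :: "('h, 'c) monoid_scheme" and p :: nat +
  fixes act :: "'h \<Rightarrow> 'a \<Rightarrow> 'a"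
  assumes act_closed [simp]: "\<And>h x. h \<in> carrier H \<Longrightarrow> x \<in> carrier G \<Longrightarrow> act h x \<in> carrier G"
    and act_mult: "\<And>h x y. h \<in> carrier H \<Longrightarrow> x \<in> carrier G \<Longrightarrow> y \<in> carrier G \<Longrightarrow>
        act h (x \<otimes> y) = act h x \<otimes> act h y"
    and act_id: "\<And>x. x \<in> carrier G \<Longrightarrow> act \<one>\<^bsub>H\<^esub> x = x"
    and act_comp: "\<And>h h' x. h \<in> carrier H \<Longrightarrow> h' \<in> carrier H \<Longrightarrow> x \<in> carrier G \<Longrightarrow>
        act (h \<otimes>\<^bsub>H\<^esub> h') x = act h (act h' x)"
begin

lemma act_group_hom: "h \<in> carrier H \<Longrightarrow> group_hom G G (act h)"
  by unfold_locales (auto simp: hom_def act_mult)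

lemma act_one [simp]: "h \<in> carrier H \<Longrightarrow> act h \<one> = \<one>"
  using group_hom.hom_one[OF act_group_hom] .

lemma act_inv: "h \<in> carrier H \<Longrightarrow> x \<in> carrier G \<Longrightarrow> act h (inv x) = inv (act h x)"
  using group_hom.hom_inv[OF act_group_hom] .

lemma act_pow: "h \<in> carrier H \<Longrightarrow> x \<in> carrier G \<Longrightarrow> act h (x [^] (n::nat)) = act h x [^] n"
  using group_hom.hom_nat_pow[OF act_group_hom] .

lemma act_inv_act [simp]:
  "h \<in> carrier H \<Longrightarrow> x \<in> carrier G \<Longrightarrow> act (inv\<^bsub>H\<^esub> h) (act h x) = x"
  using act_comp[of "inv\<^bsub>H\<^esub> h" h x] act_id by simp

lemma act_act_inv [simp]:
  "h \<in> carrier H \<Longrightarrow> x \<in> carrier G \<Longrightarrow> act h (act (inv\<^bsub>H\<^esub> h) x) = x"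
  using act_comp[of h "inv\<^bsub>H\<^esub> h" x] act_id by simp

definition invariant :: "'a set \<Rightarrow> bool" where
  "invariant W \<longleftrightarrow> subgroup W G \<and> (\<forall>h\<in>carrier H. \<forall>x\<in>W. act h x \<in> W)"

text \<open>
  For \<open>W = {\<one>}\<close> this is the pointwise stabilizer of \<open>V\<close>; for invariant subgroups with
  \<open>W\<close> normal in \<open>V\<close> it is the kernel of the action on \<open>V / W\<close>.
\<close>

definition moves_into :: "'a set \<Rightarrow> 'a set \<Rightarrow> 'h set" where
  "moves_into V W = {h \<in> carrier H. \<forall>x\<in>V. act h x \<otimes> inv x \<in> W}"

lemma moves_into_subgroup:
  assumes V: "V \<subseteq> carrier G" and W: "invariant W"
  shows "subgroup (moves_into V W) H"
proof (rule H.finite_subgroupI[OF H.fin])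
  have sub: "subgroup W G" using W by (simp add: invariant_def)
  show "\<one>\<^bsub>H\<^esub> \<in> moves_into V W"
    using V subgroup.one_closed[OF sub] act_id by (auto simp: moves_into_def subset_iff)
  fix h h' assume h: "h \<in> moves_into V W" "h' \<in> moves_into V W"
  have hc: "h \<in> carrier H" "h' \<in> carrier H" using h by (auto simp: moves_into_def)
  have "act (h \<otimes>\<^bsub>H\<^esub> h') x \<otimes> inv x \<in> W" if x: "x \<in> V" for x
  proof -
    have xc: "x \<in> carrier G" using x V by blast
    have "act (h \<otimes>\<^bsub>H\<^esub> h') x \<otimes> inv x = act h (act h' x \<otimes> inv x) \<otimes> (act h x \<otimes> inv x)"
      using xc hc by (simp add: act_comp act_mult act_inv G.m_assoc[symmetric])
        (simp add: G.m_assoc)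
    moreover have "act h (act h' x \<otimes> inv x) \<in> W"
      using W h(2) hc x by (auto simp: invariant_def moves_into_def)
    moreover have "act h x \<otimes> inv x \<in> W" using h(1) x by (auto simp: moves_into_def)
    ultimately show ?thesis using subgroup.m_closed[OF sub] by simp
  qed
  then show "h \<otimes>\<^bsub>H\<^esub> h' \<in> moves_into V W" using hc by (simp add: moves_into_def)
qed (auto simp: moves_into_def)

end

locale abelian_p_action = p_action G H p act + G: comm_group G
  for G :: "('a, 'b) monoid_scheme" (structure) and H :: "('h, 'c) monoid_scheme" and p :: nat
    and act :: "'h \<Rightarrow> 'a \<Rightarrow> 'a"
begin

lemma power_image_invariant: "invariant (G.power_image n)"
  unfolding invariant_def
proof (intro conjI ballI)
  show "subgroup (G.power_image n) G" by (rule G.power_image_subgroup)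
  fix h x assume h: "h \<in> carrier H" and "x \<in> G.power_image n"
  then obtain y where "y \<in> carrier G" "x = y [^] n" by (auto simp: G.power_image_def)
  then show "act h x \<in> G.power_image n" using h by (auto simp: G.power_image_def act_pow)
qed

lemma power_image_trivial: "\<exists>e. G.power_image (p ^ e) = {\<one>}"
proof -
  obtain e where e: "card (carrier G) = p ^ e" using G.card_prime_power by blast
  have "G.power_image (p ^ e) = {\<one>}"
    unfolding e[symmetric] G.power_image_def using G.pow_card_carrier[OF G.fin] by force
  then show ?thesis by blast
qed

text \<open>
  A fixed coset \<open>W x\<close> has order \<open>p\<close> in \<open>G / W\<close> because \<open>W\<close> contains all \<open>p\<close>-th powers, so \<open>W\<close> and
  \<open>x\<close> generate the next member of a flag.
\<close>

lemma invariant_extension: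
  assumes W: "invariant W" "W \<noteq> carrier G" "G.power_image p \<subseteq> W"
  obtains W' where "invariant W'" "W \<subseteq> W'" "card W' = p * card W"
    "\<And>h x. h \<in> carrier H \<Longrightarrow> x \<in> W' \<Longrightarrow> act h x \<otimes> inv x \<in> W"
proof -
  have sub: "subgroup W G" using W by (simp add: invariant_def)
  have Wc: "w \<in> carrier G" if "w \<in> W" for w using subgroup.mem_carrier[OF sub that] .
  obtain x where x: "x \<in> carrier G" "x \<notin> W"
    and fx: "\<And>h. h \<in> carrier H \<Longrightarrow> act h x \<otimes> inv x \<in> W"
    by (rule p_group_fixes_coset[of G p H W act])
      (use W sub in \<open>auto intro: G.finite_p_group_axioms H.finite_p_group_axioms
          simp: invariant_def act_mult act_id act_comp\<close>)
  have nrm: "x \<otimes> w \<otimes> inv x \<in> W" if "w \<in> W" for w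
    using that x(1) Wc[OF that] G.m_comm[of x w] by (simp add: G.m_assoc)
  have xp: "x [^] p \<in> W" using x(1) W(3) by (auto simp: G.power_image_def)
  let ?W = "G.adjoin W x"
  have subW: "subgroup ?W G" by (rule G.adjoin_is_subgroup[OF G.fin sub x(1) nrm])
  have triv: "act h y \<otimes> inv y \<in> W" if h: "h \<in> carrier H" and y: "y \<in> ?W" for h y
  proof -
    obtain w i where w: "w \<in> W" "y = w \<otimes> x [^] (i::nat)" using G.adjoinE[OF y] .
    have "act h y \<otimes> inv y = (act h w \<otimes> inv w) \<otimes> (act h x \<otimes> inv x) [^] i"
      using w(2) Wc[OF w(1)] x(1) h
      by (simp add: act_mult act_pow G.nat_pow_distrib G.nat_pow_inv G.inv_mult G.m_ac)
    moreover have "act h w \<otimes> inv w \<in> W"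
      using W(1) w(1) h sub by (simp add: invariant_def subgroup.m_closed subgroup.m_inv_closed)
    moreover have "(act h x \<otimes> inv x) [^] i \<in> W"
      using G.subgroup_nat_pow[OF sub fx[OF h]] .
    ultimately show ?thesis using subgroup.m_closed[OF sub] by simp
  qed
  show thesis
  proof (rule that[of ?W])
    show WW: "W \<subseteq> ?W" by (rule G.adjoin_subset[OF sub x(1)])
    show "card ?W = p * card W" by (rule G.card_adjoin[OF sub x xp nrm])
    show "invariant ?W"
      unfolding invariant_def
    proof (intro conjI ballI)
      fix h y assume h: "h \<in> carrier H" and y: "y \<in> ?W"
      have "y \<in> carrier G" using y subgroup.mem_carrier[OF subW] by blast
      then have "act h y = (act h y \<otimes> inv y) \<otimes> y" using h by (simp add: G.m_assoc)
      then show "act h y \<in> ?W" using triv[OF h y] WW y subgroup.m_closed[OF subW] by (metis subsetD)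
    qed (rule subW)
  qed (fact triv)
qed

definition flag :: "nat \<Rightarrow> (nat \<Rightarrow> 'a set) \<Rightarrow> bool" where
  "flag r V \<longleftrightarrow> V r = carrier G \<and> (\<forall>i\<le>r. invariant (V i)) \<and>
     (\<forall>i<r. V i \<subseteq> V (Suc i) \<and> card (V (Suc i)) = p * card (V i) \<and>
       (\<forall>h\<in>carrier H. \<forall>x\<in>V (Suc i). act h x \<otimes> inv x \<in> V i))"

lemma flag_above:
  assumes "invariant W" "G.power_image p \<subseteq> W"
  shows "\<exists>r V. flag r V \<and> V 0 = W"
  using assms
proof (induction "card (carrier G) - card W" arbitrary: W rule: less_induct)
  case less
  show ?case
  proof (cases "W = carrier G")
    case True
    then have "flag 0 (\<lambda>_. W)" using less.prems(1) by (simp add: flag_def)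
    then show ?thesis by blast
  next
    case False
    obtain W' where W': "invariant W'" "W \<subseteq> W'" "card W' = p * card W"
      "\<And>h x. h \<in> carrier H \<Longrightarrow> x \<in> W' \<Longrightarrow> act h x \<otimes> inv x \<in> W"
      using invariant_extension[OF less.prems(1) False less.prems(2)] by blast
    have sub: "subgroup W G" "subgroup W' G" using less.prems(1) W'(1) by (auto simp: invariant_def)
    have "card W < card W'" using W'(3) G.card_subgroup_pos[OF G.fin sub(1)] G.p_gt_1 by simp
    moreover have "card W' \<le> card (carrier G)" using subgroup.subset[OF sub(2)] by (simp add: card_mono)
    ultimately have "card (carrier G) - card W' < card (carrier G) - card W" by simp
    from less.hyps[OF this W'(1)] obtain r V where V: "flag r V" "V 0 = W'"
      using W'(2) less.prems(2) by blast
    have "flag (Suc r) (case_nat W V)"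
      using V W' less.prems(1) by (auto simp: flag_def less_Suc_eq_0_disj le_Suc_eq split: nat.split)
    then show ?thesis by (metis old.nat.simps(4))
  qed
qed

end

section \<open>Automorphisms with equal p-th powers\<close>

lemma (in group) hom_adjoin_subset:
  assumes f: "f \<in> hom G G" and V: "subgroup V G" and x: "x \<in> carrier G" and W: "subgroup W G"
    and fV: "\<And>v. v \<in> V \<Longrightarrow> f v \<in> W" and fx: "f x \<in> W" and y: "y \<in> adjoin V x"
  shows "f y \<in> W"
proof -
  interpret f: group_hom G G f using f by unfold_locales
  obtain v i where v: "v \<in> V" "y = v \<otimes> x [^] (i::nat)" using adjoinE[OF y] .
  have "f x [^] i \<in> W" using subgroup_nat_pow[OF W fx] .
  moreover have "f y = f v \<otimes> f x [^] i"
    using v x subgroup.mem_carrier[OF V v(1)] by (simp add: f.hom_nat_pow)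
  ultimately show ?thesis using fV[OF v(1)] subgroup.m_closed[OF W] by simp
qed

lemma (in group) hom_generate_subset:
  assumes f: "f \<in> hom G G" and W: "subgroup W G" and gs: "gs \<subseteq> carrier G" "generate G gs = carrier G"
    and fgs: "\<And>x. x \<in> gs \<Longrightarrow> f x \<in> W" and y: "y \<in> carrier G"
  shows "f y \<in> W"
proof -
  interpret f: group_hom G G f using f by unfold_locales
  have "f ` generate G gs = generate G (f ` gs)" using f.generate_img[OF gs(1)] by simp
  moreover have "generate G (f ` gs) \<subseteq> W" using fgs W by (intro generate_subgroup_incl) auto
  ultimately show ?thesis using gs(2) y by blast
qed

lemma (in comm_group) hom_power_image:
  assumes f: "f \<in> hom G G" and im: "\<And>x. x \<in> carrier G \<Longrightarrow> f x \<in> power_image m"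
    and x: "x \<in> power_image n"
  shows "f x \<in> power_image (m * n)"
proof -
  interpret f: group_hom G G f using f by unfold_locales
  obtain y where y: "y \<in> carrier G" "x = y [^] n" using x by (auto simp: power_image_def)
  then show ?thesis using power_image_pow[OF im[OF y(1)], of n] by (simp add: f.hom_nat_pow)
qed

context abelian_p_action
begin

abbreviation diff :: "'h \<Rightarrow> 'h \<Rightarrow> 'a \<Rightarrow> 'a" where
  "diff h h' x \<equiv> act h x \<otimes> inv (act h' x)"

lemma diff_hom:
  assumes "h \<in> carrier H" "h' \<in> carrier H"
  shows "diff h h' \<in> hom G G"
  using assms by (auto simp: hom_def act_mult G.inv_mult G.m_ac)

lemma displacement_hom:
  assumes "h \<in> carrier H" shows "(\<lambda>x. act h x \<otimes> inv x) \<in> hom G G"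
  using assms by (auto simp: hom_def act_mult G.inv_mult G.m_ac)

text \<open>
  Cosets of a kernel are described by the differences \<open>diff h h'\<close>, which, unlike \<open>h\<close> and \<open>h'\<close>
  themselves, can be handled additively.
\<close>

lemma quotient_moves_into_iff:
  assumes V: "invariant V" and h: "h \<in> carrier H" "h' \<in> carrier H"
  shows "h \<otimes>\<^bsub>H\<^esub> inv\<^bsub>H\<^esub> h' \<in> moves_into V W \<longleftrightarrow> (\<forall>x\<in>V. diff h h' x \<in> W)"
proof
  have Vc: "x \<in> carrier G" if "x \<in> V" for x
    using that V subgroup.mem_carrier unfolding invariant_def by fast
  have inv: "act g x \<in> V" if "x \<in> V" "g \<in> carrier H" for g x
    using that V by (simp add: invariant_def)
  show "\<forall>x\<in>V. diff h h' x \<in> W" if m: "h \<otimes>\<^bsub>H\<^esub> inv\<^bsub>H\<^esub> h' \<in> moves_into V W"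
  proof
    fix x assume x: "x \<in> V"
    have "act (h \<otimes>\<^bsub>H\<^esub> inv\<^bsub>H\<^esub> h') (act h' x) \<otimes> inv (act h' x) \<in> W"
      using m inv[OF x h(2)] by (simp add: moves_into_def)
    then show "diff h h' x \<in> W" using h Vc[OF x] by (simp add: act_comp)
  qed
  show "h \<otimes>\<^bsub>H\<^esub> inv\<^bsub>H\<^esub> h' \<in> moves_into V W" if d: "\<forall>x\<in>V. diff h h' x \<in> W"
    unfolding moves_into_def
  proof (intro CollectI conjI ballI)
    fix x assume x: "x \<in> V"
    have "diff h h' (act (inv\<^bsub>H\<^esub> h') x) \<in> W" using d inv[OF x, of "inv\<^bsub>H\<^esub> h'"] h by blast
    then show "act (h \<otimes>\<^bsub>H\<^esub> inv\<^bsub>H\<^esub> h') x \<otimes> inv x \<in> W" using h Vc[OF x] by (simp add: act_comp)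
  qed (use h in simp)
qed

lemma quotient_moves_carrier_iff:
  assumes h: "h \<in> carrier H" "h' \<in> carrier H" and W: "subgroup W G"
    and gs: "gs \<subseteq> carrier G" "generate G gs = carrier G"
  shows "h \<otimes>\<^bsub>H\<^esub> inv\<^bsub>H\<^esub> h' \<in> moves_into (carrier G) W \<longleftrightarrow> (\<forall>x\<in>gs. diff h h' x \<in> W)"
proof -
  have "invariant (carrier G)" by (simp add: invariant_def G.subgroup_self)
  from quotient_moves_into_iff[OF this h] show ?thesis
    using G.hom_generate_subset[OF diff_hom[OF h] W gs] gs(1) by blast
qed

text \<open>
  The analogue of the congruence subgroup of level \<open>p^s\<close> in a matrix group.
\<close>

definition congruence_subgroup :: "nat \<Rightarrow> 'h set" where
  "congruence_subgroup s = moves_into (carrier G) (G.power_image (p ^ s))"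

lemma congruence_subgroup_subgroup: "subgroup (congruence_subgroup s) H"
  unfolding congruence_subgroup_def by (rule moves_into_subgroup) (auto simp: power_image_invariant)

lemma congruence_subgroup_carrier: "h \<in> congruence_subgroup s \<Longrightarrow> h \<in> carrier H"
  by (simp add: congruence_subgroup_def moves_into_def)

lemma congruence_subgroup_displacement:
  assumes h: "h \<in> congruence_subgroup s" and x: "x \<in> G.power_image (p ^ t)"
  shows "act h x \<otimes> inv x \<in> G.power_image (p ^ (s + t))"
proof -
  have "act h y \<otimes> inv y \<in> G.power_image (p ^ s)" if "y \<in> carrier G" for y
    using h that by (simp add: congruence_subgroup_def moves_into_def)
  from G.hom_power_image[OF displacement_hom[OF congruence_subgroup_carrier[OF h]] this x]
  show ?thesis by (simp add: power_add)
qed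

text \<open>
  Write \<open>\<alpha> = 1 + \<phi>\<close>, \<open>\<beta> = 1 + \<psi>\<close> and \<open>\<delta> = \<alpha> - \<beta>\<close> additively.  Each of \<open>\<phi>\<close>, \<open>\<psi>\<close>
  raises the filtration by \<open>G^(p^t)\<close> by at least \<open>e\<close> and \<open>\<delta>\<close> raises it by \<open>s\<close>.  Modulo level
  \<open>s + 2\<close> every product with one factor \<open>\<delta>\<close> and two factors from \<open>\<phi>\<close>, \<open>\<psi>\<close> vanishes, which
  leaves \<open>\<alpha>^n - \<beta>^n = n \<delta> + (n choose 2) (\<delta> \<phi> + \<psi> \<delta>)\<close>.  For \<open>n = p\<close> the last term vanishes as
  well: for odd \<open>p\<close> because \<open>p\<close> divides \<open>p choose 2\<close>, and for \<open>e \<ge> 2\<close> because \<open>\<delta> \<phi>\<close> and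
  \<open>\<psi> \<delta>\<close> have level \<open>s + 2\<close> themselves.  The alternative \<open>e \<ge> 2\<close> is what \<open>p = 2\<close> requires.
\<close>

lemma equal_powers_gain:
  assumes ab: "\<alpha> \<in> congruence_subgroup e" "\<beta> \<in> congruence_subgroup e" and e: "e \<ge> 1"
    and odd: "odd p \<or> e \<ge> 2"
    and near: "\<And>x. x \<in> carrier G \<Longrightarrow> diff \<alpha> \<beta> x \<in> G.power_image (p ^ s)" and s: "s \<ge> 1"
    and same: "\<And>x. x \<in> carrier G \<Longrightarrow> act (\<alpha> [^]\<^bsub>H\<^esub> p) x = act (\<beta> [^]\<^bsub>H\<^esub> p) x"
    and x: "x \<in> carrier G"
  shows "diff \<alpha> \<beta> x [^] p \<in> G.power_image (p ^ (s + 2))"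
proof -
  define C where "C = G.power_image (p ^ (s + 2))"
  have subC: "subgroup C G" unfolding C_def by (rule G.power_image_subgroup)
  interpret C: normal C G using subC by (simp add: G.normal_iff_subgroup)
  interpret Q: comm_group "G Mod C" using subC by (rule G.abelian_FactGroup)
  interpret \<pi>: group_hom G "G Mod C" "\<lambda>g. C #> g"
    using C.r_coset_hom_Mod by unfold_locales
  have C_one: "C #> g = \<one>\<^bsub>G Mod C\<^esub>" if "g \<in> C" for g
    using that subC G.coset_join2 subgroup.mem_carrier by fastforce
  have C_mem: "g \<in> C" if "g \<in> carrier G" "C #> g = \<one>\<^bsub>G Mod C\<^esub>" for g
    using that by (metis G.rcos_self one_FactGroup subC)
  have hc: "\<alpha> \<in> carrier H" "\<beta> \<in> carrier H" using ab congruence_subgroup_carrier by auto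
  define \<delta> where "\<delta> = diff \<alpha> \<beta>"
  define \<phi> where "\<phi> = (\<lambda>x. act \<alpha> x \<otimes> inv x)"
  define \<psi> where "\<psi> = (\<lambda>x. act \<beta> x \<otimes> inv x)"
  interpret \<delta>: group_hom G G \<delta> using diff_hom[OF hc] by unfold_locales (simp add: \<delta>_def)
  interpret \<phi>: group_hom G G \<phi> using displacement_hom[OF hc(1)] by unfold_locales (simp add: \<phi>_def)
  interpret \<psi>: group_hom G G \<psi> using displacement_hom[OF hc(2)] by unfold_locales (simp add: \<psi>_def)
  have \<delta>B: "\<delta> y \<in> G.power_image (p ^ (s + t))" if "y \<in> G.power_image (p ^ t)" for y t
    using G.hom_power_image[OF diff_hom[OF hc] near that] by (simp add: \<delta>_def power_add)
  have \<phi>B: "\<phi> y \<in> G.power_image (p ^ (e + t))" if "y \<in> G.power_image (p ^ t)" for y t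
    using congruence_subgroup_displacement[OF ab(1) that] by (simp add: \<phi>_def)
  have \<psi>B: "\<psi> y \<in> G.power_image (p ^ (e + t))" if "y \<in> G.power_image (p ^ t)" for y t
    using congruence_subgroup_displacement[OF ab(2) that] by (simp add: \<psi>_def)
  have B0: "y \<in> G.power_image (p ^ 0)" if "y \<in> carrier G" for y
    using that by (auto simp: G.power_image_def)
  have toC: "y \<in> C" if "y \<in> G.power_image (p ^ t)" "t \<ge> s + 2" for y t
  proof -
    have "p ^ t = p ^ (s + 2) * p ^ (t - (s + 2))"
      using that(2) by (simp only: power_add[symmetric] le_add_diff_inverse)
    then show ?thesis
      using that(1) G.power_image_mult_subset[of "p ^ (s + 2)" "p ^ (t - (s + 2))"]
      by (simp only: C_def) blast
  qed
  have split\<alpha>: "act \<alpha> y = y \<otimes> \<phi> y" if "y \<in> carrier G" for y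
    using that hc by (simp add: \<phi>_def G.m_lcomm[of y])
  have split\<beta>: "act \<beta> y = y \<otimes> \<psi> y" if "y \<in> carrier G" for y
    using that hc by (simp add: \<psi>_def G.m_lcomm[of y])
  have split\<delta>: "act \<alpha> y = act \<beta> y \<otimes> \<delta> y" if "y \<in> carrier G" for y
    using that hc by (simp add: \<delta>_def G.m_lcomm[of "act \<beta> y"])
  have powc: "\<alpha> [^]\<^bsub>H\<^esub> (n::nat) \<in> carrier H" "\<beta> [^]\<^bsub>H\<^esub> (n::nat) \<in> carrier H" for n
    using hc by auto
  have linear: "C #> act (\<beta> [^]\<^bsub>H\<^esub> n) y = (C #> y) \<otimes>\<^bsub>G Mod C\<^esub> (C #> \<psi> y) [^]\<^bsub>G Mod C\<^esub> n"
    if "y \<in> G.power_image (p ^ s)" for y and n :: nat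
    using that
  proof (induction n arbitrary: y)
    case 0
    then have "y \<in> carrier G" using G.power_image_carrier by blast
    then show ?case using act_id Q.r_one[OF \<pi>.hom_closed] by simp
  next
    case (Suc n)
    have yc: "y \<in> carrier G" using Suc.prems G.power_image_carrier by blast
    have \<beta>y: "act \<beta> y \<in> G.power_image (p ^ s)"
      using Suc.prems hc(2) power_image_invariant by (simp add: invariant_def)
    have "\<psi> (\<psi> y) \<in> G.power_image (p ^ (e + (e + s)))" using \<psi>B \<psi>B Suc.prems by blast
    then have z: "C #> \<psi> (\<psi> y) = \<one>\<^bsub>G Mod C\<^esub>" using e by (intro C_one toC) auto
    have \<psi>c: "C #> \<psi> y \<in> carrier (G Mod C)" "C #> y \<in> carrier (G Mod C)"
      using yc by (auto intro!: \<pi>.hom_closed)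
    have "C #> \<psi> (act \<beta> y) = C #> \<psi> y"
      using yc z \<psi>c by (simp only: split\<beta> \<psi>.hom_mult \<psi>.hom_closed \<pi>.hom_mult Q.r_one)
    moreover have "C #> act (\<beta> [^]\<^bsub>H\<^esub> Suc n) y = C #> act (\<beta> [^]\<^bsub>H\<^esub> n) (act \<beta> y)"
      using hc yc powc by (simp add: act_comp)
    ultimately have "C #> act (\<beta> [^]\<^bsub>H\<^esub> Suc n) y =
        ((C #> y) \<otimes>\<^bsub>G Mod C\<^esub> (C #> \<psi> y)) \<otimes>\<^bsub>G Mod C\<^esub> (C #> \<psi> y) [^]\<^bsub>G Mod C\<^esub> n"
      using Suc.IH[OF \<beta>y] yc by (simp only: split\<beta> \<pi>.hom_mult \<psi>.hom_closed)
    then show ?case using \<psi>c by (simp only: Q.nat_pow_Suc2 Q.m_assoc Q.nat_pow_closed)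
  qed
  define \<epsilon> where "\<epsilon> = (\<lambda>y. \<delta> (\<phi> y) \<otimes> \<psi> (\<delta> y))"
  have \<epsilon>c: "\<epsilon> y \<in> carrier G" if "y \<in> carrier G" for y using that by (simp add: \<epsilon>_def)
  have \<epsilon>mult: "\<epsilon> (y \<otimes> z) = \<epsilon> y \<otimes> \<epsilon> z" if "y \<in> carrier G" "z \<in> carrier G" for y z
    using that by (simp add: \<epsilon>_def G.m_ac)
  have \<epsilon>B: "\<epsilon> y \<in> G.power_image (p ^ (s + e + t))" if y: "y \<in> G.power_image (p ^ t)" for y t
  proof -
    have "\<delta> (\<phi> y) \<in> G.power_image (p ^ (s + e + t))" using \<delta>B[OF \<phi>B[OF y]] by (simp add: ac_simps)
    moreover have "\<psi> (\<delta> y) \<in> G.power_image (p ^ (s + e + t))" using \<psi>B[OF \<delta>B[OF y]] by (simp add: ac_simps)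
    ultimately show ?thesis
      using subgroup.m_closed[OF G.power_image_subgroup] by (simp add: \<epsilon>_def)
  qed
  have expand: "C #> act (\<alpha> [^]\<^bsub>H\<^esub> n) y = (C #> act (\<beta> [^]\<^bsub>H\<^esub> n) y) \<otimes>\<^bsub>G Mod C\<^esub>
      ((C #> \<delta> y) [^]\<^bsub>G Mod C\<^esub> n \<otimes>\<^bsub>G Mod C\<^esub> (C #> \<epsilon> y) [^]\<^bsub>G Mod C\<^esub> (n choose 2))"
    if "y \<in> carrier G" for y and n :: nat
    using that
  proof (induction n arbitrary: y)
    case 0
    then have cy: "C #> y \<in> carrier (G Mod C)" by (intro \<pi>.hom_closed)
    have "(0::nat) choose 2 = 0" by simp
    then show ?case
      by (simp only: Group.nat_pow_0 act_id[OF 0] Q.l_one[OF Q.one_closed] Q.r_one[OF cy])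
  next
    case (Suc n)
    note y = Suc.prems
    have ay: "act \<alpha> y \<in> carrier G" using y hc by simp
    define b where "b = C #> act (\<beta> [^]\<^bsub>H\<^esub> Suc n) y"
    define d where "d = C #> \<delta> y"
    define u where "u = C #> \<delta> (\<phi> y)"
    define v where "v = C #> \<psi> (\<delta> y)"
    have cl: "b \<in> carrier (G Mod C)" "d \<in> carrier (G Mod C)" "u \<in> carrier (G Mod C)" "v \<in> carrier (G Mod C)"
      unfolding b_def d_def u_def v_def using y hc powc by (auto intro!: \<pi>.hom_closed act_closed)
    have eps: "C #> \<epsilon> y = u \<otimes>\<^bsub>G Mod C\<^esub> v"
      unfolding \<epsilon>_def u_def v_def using y by (intro \<pi>.hom_mult) auto
    have 1: "C #> \<delta> (act \<alpha> y) = d \<otimes>\<^bsub>G Mod C\<^esub> u"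
      using y by (simp only: split\<alpha> \<delta>.hom_mult \<phi>.hom_closed \<pi>.hom_mult \<delta>.hom_closed d_def u_def)
    have "\<epsilon> (\<phi> y) \<in> G.power_image (p ^ (s + e + (e + 0)))" using \<epsilon>B[OF \<phi>B[OF B0[OF y]]] .
    then have "C #> \<epsilon> (\<phi> y) = \<one>\<^bsub>G Mod C\<^esub>" using e by (intro C_one toC) auto
    then have 2: "C #> \<epsilon> (act \<alpha> y) = u \<otimes>\<^bsub>G Mod C\<^esub> v"
      using y cl by (simp only: split\<alpha> \<epsilon>mult \<phi>.hom_closed \<pi>.hom_mult \<epsilon>c eps Q.r_one Q.m_closed)
    have "act (\<beta> [^]\<^bsub>H\<^esub> n) (act \<alpha> y) = act (\<beta> [^]\<^bsub>H\<^esub> Suc n) y \<otimes> act (\<beta> [^]\<^bsub>H\<^esub> n) (\<delta> y)"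
      using y hc powc by (simp add: split\<delta> act_mult act_comp)
    moreover have "C #> act (\<beta> [^]\<^bsub>H\<^esub> n) (\<delta> y) = d \<otimes>\<^bsub>G Mod C\<^esub> v [^]\<^bsub>G Mod C\<^esub> n"
      unfolding d_def v_def using linear \<delta>B[OF B0[OF y]] by simp
    ultimately have 3: "C #> act (\<beta> [^]\<^bsub>H\<^esub> n) (act \<alpha> y) = b \<otimes>\<^bsub>G Mod C\<^esub> (d \<otimes>\<^bsub>G Mod C\<^esub> v [^]\<^bsub>G Mod C\<^esub> n)"
      unfolding b_def using y powc by (simp only: \<pi>.hom_mult act_closed \<delta>.hom_closed)
    have "C #> act (\<alpha> [^]\<^bsub>H\<^esub> Suc n) y = C #> act (\<alpha> [^]\<^bsub>H\<^esub> n) (act \<alpha> y)"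
      using hc y powc by (simp add: act_comp)
    also have "\<dots> = (b \<otimes>\<^bsub>G Mod C\<^esub> (d \<otimes>\<^bsub>G Mod C\<^esub> v [^]\<^bsub>G Mod C\<^esub> n)) \<otimes>\<^bsub>G Mod C\<^esub>
      ((d \<otimes>\<^bsub>G Mod C\<^esub> u) [^]\<^bsub>G Mod C\<^esub> n \<otimes>\<^bsub>G Mod C\<^esub> (u \<otimes>\<^bsub>G Mod C\<^esub> v) [^]\<^bsub>G Mod C\<^esub> (n choose 2))"
      using Suc.IH[OF ay] 1 2 3 by simp
    also have "\<dots> = b \<otimes>\<^bsub>G Mod C\<^esub> (d [^]\<^bsub>G Mod C\<^esub> Suc n \<otimes>\<^bsub>G Mod C\<^esub>
        (u \<otimes>\<^bsub>G Mod C\<^esub> v) [^]\<^bsub>G Mod C\<^esub> (n + (n choose 2)))"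
      using cl by (simp only: Q.nat_pow_distrib Q.nat_pow_mult[symmetric] Q.nat_pow_Suc Q.m_closed Q.nat_pow_closed Q.m_ac)
    also have "n + (n choose 2) = Suc n choose 2" by (simp add: numeral_2_eq_2)
    finally show ?case by (simp only: b_def d_def eps)
  qed
  let ?d = "C #> \<delta> x" and ?E = "C #> \<epsilon> x"
  have cl: "?d \<in> carrier (G Mod C)" "?E \<in> carrier (G Mod C)" "C #> act (\<beta> [^]\<^bsub>H\<^esub> p) x \<in> carrier (G Mod C)"
    using x \<epsilon>c powc by (auto intro!: \<pi>.hom_closed)
  have "?d [^]\<^bsub>G Mod C\<^esub> p \<otimes>\<^bsub>G Mod C\<^esub> ?E [^]\<^bsub>G Mod C\<^esub> (p choose 2) = \<one>\<^bsub>G Mod C\<^esub>"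
    using expand[OF x, of p] same[OF x] cl Q.l_cancel_one' Q.m_closed Q.nat_pow_closed by metis
  moreover have "?E [^]\<^bsub>G Mod C\<^esub> (p choose 2) = \<one>\<^bsub>G Mod C\<^esub>"
  proof -
    have E: "\<epsilon> x \<in> G.power_image (p ^ (s + e + 0))" using \<epsilon>B[OF B0[OF x]] .
    show ?thesis
    proof (cases "e \<ge> 2")
      case True
      then have "?E = \<one>\<^bsub>G Mod C\<^esub>" using E by (intro C_one toC[OF E]) auto
      then show ?thesis by (simp only: Q.nat_pow_one)
    next
      case False
      then have e1: "e = 1" and "odd p" using e odd by auto
      have "even (p - 1)" using \<open>odd p\<close> by simp
      then obtain q where "p - 1 = 2 * q" by blast
      then have q: "p choose 2 = p * q" by (simp add: choose_two)
      have "\<epsilon> x [^] p \<in> C"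
        using G.power_image_pow[OF E, of p] e1 by (simp add: C_def ac_simps)
      then have "?E [^]\<^bsub>G Mod C\<^esub> p = \<one>\<^bsub>G Mod C\<^esub>"
        using C_one \<pi>.hom_nat_pow[OF \<epsilon>c[OF x]] by metis
      then show ?thesis using cl(2) unfolding q by (metis Q.nat_pow_pow Q.nat_pow_one)
    qed
  qed
  ultimately have "?d [^]\<^bsub>G Mod C\<^esub> p = \<one>\<^bsub>G Mod C\<^esub>" using cl(1) by (metis Q.nat_pow_closed Q.r_one)
  then have "\<delta> x [^] p \<in> C"
    using C_mem \<pi>.hom_nat_pow[of "\<delta> x" p] x by (metis \<delta>.hom_closed G.nat_pow_closed)
  then show ?thesis by (simp add: C_def \<delta>_def)
qed

end

section \<open>Layers of a p-group acting on an abelian p-group\<close>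

context abelian_p_action
begin

lemma trivial_invariant: "invariant {\<one>}"
  by (simp add: invariant_def G.triv_subgroup)

text \<open>
  The restriction of an automorphism to generators determines its class modulo the kernel.  The
  restrictions of automorphisms with a given \<open>p\<close>-th power satisfy the gain condition coordinatewise.
\<close>

lemma layer_congruence_kernel:
  assumes P: "subgroup P H" and pw: "\<And>h. h \<in> carrier H \<Longrightarrow> h [^]\<^bsub>H\<^esub> p \<in> P"
    and gs: "finite gs" "gs \<subseteq> carrier G" "generate G gs = carrier G"
    and e: "e \<ge> 1" and odd: "odd p \<or> e \<ge> 2"
  shows "layer_bound P (card (G.torsion p) ^ card gs) (congruence_subgroup e) (moves_into (carrier G) {\<one>})"
proof (rule H.layer_bound_power[OF H.fin congruence_subgroup_subgroup _ _ P, where f = "\<lambda>h. restrict (act h) gs"])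
  let ?f = "\<lambda>h. restrict (act h) gs"
  let ?N = "moves_into (carrier G) {\<one>}"
  let ?S = "congruence_subgroup e"
  show "subgroup ?N H" using trivial_invariant by (rule moves_into_subgroup[rotated]) simp
  show "?N \<subseteq> ?S" using subgroup.one_closed[OF G.power_image_subgroup]
    by (auto simp: congruence_subgroup_def moves_into_def)
  show "h [^]\<^bsub>H\<^esub> p \<in> P" if "h \<in> ?S" for h using pw congruence_subgroup_carrier[OF that] .
  have eq_iff: "?f h = ?f h' \<longleftrightarrow> h \<otimes>\<^bsub>H\<^esub> inv\<^bsub>H\<^esub> h' \<in> ?N" if "h \<in> carrier H" "h' \<in> carrier H" for h h'
  proof -
    have "?f h = ?f h' \<longleftrightarrow> (\<forall>x\<in>gs. act h x = act h' x)"
      by (metis restrict_apply' restrict_ext)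
    also have "\<dots> \<longleftrightarrow> (\<forall>x\<in>gs. diff h h' x \<in> {\<one>})"
      using that gs(2) G.inv_solve_right'[of \<one>] by (intro ball_cong refl) (auto dest!: subsetD)
    finally show ?thesis using quotient_moves_carrier_iff[OF that G.triv_subgroup gs(2,3)] by simp
  qed
  show "?f h = ?f h' \<longleftrightarrow> h \<otimes>\<^bsub>H\<^esub> inv\<^bsub>H\<^esub> h' \<in> ?N" if "h \<in> ?S" "h' \<in> ?S" for h h'
    using eq_iff that congruence_subgroup_carrier by simp
  fix x assume x: "x \<in> ?S"
  let ?Y = "{y \<in> ?S. ?f (y [^]\<^bsub>H\<^esub> p) = ?f (x [^]\<^bsub>H\<^esub> p)}"
  have same: "act (y [^]\<^bsub>H\<^esub> p) g = act (z [^]\<^bsub>H\<^esub> p) g" if "y \<in> ?Y" "z \<in> ?Y" "g \<in> carrier G" for y z g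
  proof -
    have c: "y [^]\<^bsub>H\<^esub> p \<in> carrier H" "z [^]\<^bsub>H\<^esub> p \<in> carrier H" using that congruence_subgroup_carrier by auto
    have "y [^]\<^bsub>H\<^esub> p \<otimes>\<^bsub>H\<^esub> inv\<^bsub>H\<^esub> (z [^]\<^bsub>H\<^esub> p) \<in> ?N" using that(1,2) eq_iff[OF c] by simp
    moreover have "invariant (carrier G)" by (simp add: invariant_def G.subgroup_self)
    ultimately have "diff (y [^]\<^bsub>H\<^esub> p) (z [^]\<^bsub>H\<^esub> p) g = \<one>"
      using quotient_moves_into_iff[OF _ c] that(3) by blast
    then show ?thesis using c that(3) G.inv_solve_right'[of \<one>] by simp
  qed
  obtain e' where e': "G.power_image (p ^ e') = {\<one>}" using power_image_trivial by blast
  show "card (?f ` ?Y) \<le> card (G.torsion p) ^ card gs"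
  proof (rule G.card_tuples_le_torsion_of_gain[OF G.fin e' gs(1), where s = e])
    show "?f ` ?Y \<subseteq> gs \<rightarrow>\<^sub>E carrier G"
      using gs(2) congruence_subgroup_carrier by auto
    fix u v assume "u \<in> ?f ` ?Y" "v \<in> ?f ` ?Y"
    then obtain y z where y: "y \<in> ?Y" "u = ?f y" and z: "z \<in> ?Y" "v = ?f z" by auto
    have S: "y \<in> ?S" "z \<in> ?S" using y z by auto
    have c: "y \<in> carrier H" "z \<in> carrier H" using S congruence_subgroup_carrier by auto
    show "u i \<otimes> inv v i \<in> G.power_image (p ^ e)" if i: "i \<in> gs" for i
    proof -
      have ic: "i \<in> carrier G" using i gs(2) by blast
      have "y \<otimes>\<^bsub>H\<^esub> inv\<^bsub>H\<^esub> z \<in> moves_into (carrier G) (G.power_image (p ^ e))"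
        using S congruence_subgroup_subgroup[of e]
        by (simp add: congruence_subgroup_def subgroup.m_closed subgroup.m_inv_closed)
      then have "diff y z i \<in> G.power_image (p ^ e)"
        using quotient_moves_carrier_iff[OF c G.power_image_subgroup gs(2,3)] i by blast
      then show ?thesis using i y(2) z(2) by simp
    qed
    fix t assume t: "e \<le> t" and d: "\<forall>i\<in>gs. u i \<otimes> inv v i \<in> G.power_image (p ^ t)"
    have near: "diff y z g \<in> G.power_image (p ^ t)" if "g \<in> carrier G" for g
      by (rule G.hom_generate_subset[OF diff_hom[OF c] G.power_image_subgroup gs(2,3) _ that])
        (use d y(2) z(2) in auto)
    show "\<forall>i\<in>gs. (u i \<otimes> inv v i) [^] p \<in> G.power_image (p ^ (t + 2))"
    proof
      fix i assume i: "i \<in> gs"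
      have "diff y z i [^] p \<in> G.power_image (p ^ (t + 2))"
        by (rule equal_powers_gain[OF S e odd near]) (use e t i gs(2) same[OF y(1) z(1)] in auto)
      then show "(u i \<otimes> inv v i) [^] p \<in> G.power_image (p ^ (t + 2))" using i y(2) z(2) by simp
    qed
  qed
qed

lemma card_image_r_cosets:
  assumes "subgroup B G" "subgroup C G" "C \<subseteq> B"
  shows "card B = card ((\<lambda>b. C #> b) ` B) * card C"
proof (rule G.card_eq_card_image_times[OF G.fin assms(1,2,3)])
  fix x y assume "x \<in> B" "y \<in> B"
  then have c: "x \<in> carrier G" "y \<in> carrier G" using subgroup.mem_carrier[OF assms(1)] by auto
  show "C #> x = C #> y \<longleftrightarrow> x \<otimes> inv y \<in> C"
    using c assms(2) G.repr_independence[OF _ c(2) assms(2), of x] G.rcos_self[OF c(1) assms(2)]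
      subgroup.rcos_module[OF assms(2) G.is_group c(2) c(1)] by auto
qed

lemma r_coset_displacement_eq_iff:
  assumes h: "h \<in> carrier H" "h' \<in> carrier H" and C: "subgroup C G" and x: "x \<in> carrier G"
  shows "C #> (act h x \<otimes> inv x) = C #> (act h' x \<otimes> inv x) \<longleftrightarrow> diff h h' x \<in> C"
proof -
  let ?u = "act h x \<otimes> inv x" and ?v = "act h' x \<otimes> inv x"
  have c: "?u \<in> carrier G" "?v \<in> carrier G" using h x by auto
  have "?u \<otimes> inv ?v = diff h h' x"
    using h x by (simp add: G.inv_mult G.m_assoc) (simp add: G.m_lcomm[of "inv x"])
  then show ?thesis
    using c G.repr_independence[OF _ c(2) C, of ?u] G.rcos_self[OF c(1) C]
      subgroup.rcos_module[OF C G.is_group c(2) c(1)] by auto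
qed

text \<open>
  An automorphism trivial modulo \<open>G^p\<close> is determined modulo the next congruence subgroup by its
  displacements of the generators in \<open>G^p / G^(p^2)\<close>, a quotient no larger than the torsion subgroup.
\<close>

lemma card_congruence_subgroup_step:
  assumes gs: "finite gs" "gs \<subseteq> carrier G" "generate G gs = carrier G"
  shows "card (congruence_subgroup 1) \<le> card (G.torsion p) ^ card gs * card (congruence_subgroup 2)"
proof -
  let ?B = "G.power_image (p ^ 1)" and ?C = "G.power_image (p ^ 2)"
  let ?f = "\<lambda>h. \<lambda>x\<in>gs. ?C #> (act h x \<otimes> inv x)"
  have CB: "?C \<subseteq> ?B" using G.power_image_mult_subset[of p p] by (simp add: power2_eq_square)
  have "card (congruence_subgroup 1) = card (?f ` congruence_subgroup 1) * card (congruence_subgroup 2)"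
  proof (rule H.card_eq_card_image_times[OF H.fin congruence_subgroup_subgroup congruence_subgroup_subgroup])
    show "congruence_subgroup 2 \<subseteq> congruence_subgroup 1"
      using CB by (auto simp: congruence_subgroup_def moves_into_def)
    fix h h' assume "h \<in> congruence_subgroup 1" "h' \<in> congruence_subgroup 1"
    then have c: "h \<in> carrier H" "h' \<in> carrier H" by (auto dest: congruence_subgroup_carrier)
    have "?f h = ?f h' \<longleftrightarrow> (\<forall>x\<in>gs. ?C #> (act h x \<otimes> inv x) = ?C #> (act h' x \<otimes> inv x))"
      by (simp add: fun_eq_iff restrict_def) blast
    also have "\<dots> \<longleftrightarrow> (\<forall>x\<in>gs. diff h h' x \<in> ?C)"
      using r_coset_displacement_eq_iff[OF c G.power_image_subgroup] gs(2) by blast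
    finally show "?f h = ?f h' \<longleftrightarrow> h \<otimes>\<^bsub>H\<^esub> inv\<^bsub>H\<^esub> h' \<in> congruence_subgroup 2"
      unfolding congruence_subgroup_def using quotient_moves_carrier_iff[OF c G.power_image_subgroup gs(2,3)] by simp
  qed
  moreover have "card (?f ` congruence_subgroup 1) \<le> card (G.torsion p) ^ card gs"
  proof -
    let ?R = "(\<lambda>b. ?C #> b) ` ?B"
    have finB: "finite ?B" using G.fin by (simp add: G.power_image_def)
    have "?f ` congruence_subgroup 1 \<subseteq> gs \<rightarrow>\<^sub>E ?R"
      using gs(2) by (auto simp: congruence_subgroup_def moves_into_def)
    then have "card (?f ` congruence_subgroup 1) \<le> card (gs \<rightarrow>\<^sub>E ?R)"
      using finB gs(1) by (intro card_mono finite_PiE) auto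
    also have "\<dots> = card ?R ^ card gs" using gs(1) by (simp add: card_PiE)
    also have "card ?R \<le> card (G.torsion p)"
    proof -
      have "(\<lambda>x. x [^] p) ` ?B = ?C"
        by (auto simp: G.power_image_def image_image G.nat_pow_pow power2_eq_square)
      then have "card ?B = card ?C * card (?B \<inter> G.torsion p)"
        using G.card_torsion_quotient[OF G.fin G.power_image_subgroup, of p "p ^ 1"] by simp
      moreover have "card ?B = card ?R * card ?C"
        by (rule card_image_r_cosets[OF G.power_image_subgroup G.power_image_subgroup CB])
      moreover have "card ?C > 0" using G.card_subgroup_pos[OF G.fin G.power_image_subgroup] .
      ultimately have "card ?R = card (?B \<inter> G.torsion p)" by (simp add: mult.commute)
      also have "\<dots> \<le> card (G.torsion p)"
        using G.fin by (intro card_mono) (auto simp: G.torsion_def)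
      finally show ?thesis .
    qed
    finally show ?thesis by (simp add: power_mono)
  qed
  ultimately show ?thesis by (simp add: mult_le_mono1)
qed

lemma flag_mono:
  assumes "flag r V" "i \<le> j" "j \<le> r" shows "V i \<subseteq> V j"
  using assms(2,3)
proof (induction j rule: dec_induct)
  case (step n)
  then have "V i \<subseteq> V n" by simp
  also have "V n \<subseteq> V (Suc n)" using assms(1) step.prems by (simp add: flag_def Suc_le_eq)
  finally show ?case .
qed simp

lemma flag_step_adjoin:
  assumes fl: "flag r V" and j: "j < r" and x: "x \<in> V (Suc j)" "x \<notin> V j"
  shows "V (Suc j) = G.adjoin (V j) x"
proof -
  have sub: "subgroup (V j) G" "subgroup (V (Suc j)) G"
    using fl j by (auto simp: flag_def invariant_def)
  have le: "V j \<subseteq> V (Suc j)" and card: "card (V (Suc j)) = p * card (V j)" using fl j by (auto simp: flag_def)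
  have xc: "x \<in> carrier G" using x(1) subgroup.mem_carrier[OF sub(2)] by blast
  have Vc: "v \<in> carrier G" if "v \<in> V j" for v using subgroup.mem_carrier[OF sub(1) that] .
  have "x \<otimes> v \<otimes> inv x \<in> V j" if "v \<in> V j" for v
    using that xc Vc[OF that] G.m_comm[of x v] by (simp add: G.m_assoc)
  then have subA: "subgroup (G.adjoin (V j) x) G" by (rule G.adjoin_is_subgroup[OF G.fin sub(1) xc])
  have pw: "x [^] (i::nat) \<in> V (Suc j)" for i
    using G.subgroup_nat_pow[OF sub(2) x(1)] .
  have "G.adjoin (V j) x \<subseteq> V (Suc j)"
    using le pw subgroup.m_closed[OF sub(2)] by (auto simp: G.adjoin_def)
  moreover have "card (V (Suc j)) \<le> card (G.adjoin (V j) x)"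
  proof -
    have "V j \<subset> G.adjoin (V j) x" using G.adjoin_subset[OF sub(1) xc] x(2) by blast
    then show ?thesis using G.index_le[OF sub(1) subA] card by simp
  qed
  moreover have "finite (V (Suc j))" using sub(2) G.fin finite_subset subgroup.subset by metis
  ultimately show ?thesis using card_seteq by blast
qed

text \<open>
  With basis vectors \<open>v_0, v_1, \<dots>\<close> such that \<open>V (Suc j)\<close> is spanned by \<open>V j\<close> and \<open>v_j\<close>, these are the
  unitriangular matrices whose columns before \<open>j\<close> are trivial and whose column \<open>j\<close> has no entry below
  the first \<open>i\<close> rows, apart from the diagonal.  An element of \<open>position V (Suc i) j\<close> outside
  \<open>position V i j\<close> has its leading entry in row \<open>i\<close> and column \<open>j\<close>.  Stated through the flag, no basis has
  to be chosen.
\<close>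

definition position :: "(nat \<Rightarrow> 'a set) \<Rightarrow> nat \<Rightarrow> nat \<Rightarrow> 'h set" where
  "position V i j = moves_into (V j) (V 0) \<inter> moves_into (V (Suc j)) (V i)"

context
  fixes r V assumes fl: "flag r V"
begin

lemma flag_invariant: "i \<le> r \<Longrightarrow> invariant (V i)"
  using fl by (auto simp: flag_def)

lemma flag_subgroup: "i \<le> r \<Longrightarrow> subgroup (V i) G"
  using flag_invariant by (simp add: invariant_def)

lemma flag_carrier: "i \<le> r \<Longrightarrow> x \<in> V i \<Longrightarrow> x \<in> carrier G"
  using subgroup.mem_carrier[OF flag_subgroup] .

lemma flag_displacement:
  "j < r \<Longrightarrow> h \<in> carrier H \<Longrightarrow> x \<in> V (Suc j) \<Longrightarrow> act h x \<otimes> inv x \<in> V j"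
  using fl by (auto simp: flag_def)

lemma position_subgroup:
  assumes "i \<le> j" "j < r" shows "subgroup (position V i j) H"
  unfolding position_def using assms subgroup.subset[OF flag_subgroup]
  by (intro H.subgroups_Inter_pair moves_into_subgroup flag_invariant) auto

lemma position_carrier: "h \<in> position V i j \<Longrightarrow> h \<in> carrier H"
  by (simp add: position_def moves_into_def)

lemma position_mono:
  assumes "i \<le> i'" "i' \<le> r" shows "position V i j \<subseteq> position V i' j"
  using flag_mono[OF fl assms] by (auto simp: position_def moves_into_def)

lemma card_position_step:
  assumes ij: "i < j" "j < r"
  shows "card (position V (Suc i) j) \<le> p * card (position V i j)"
proof -
  have "V j \<noteq> V (Suc j)"
  proof
    assume eq: "V j = V (Suc j)"
    have "card (V (Suc j)) = p * card (V j)" using fl ij by (simp add: flag_def)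
    then have "card (V j) = p * card (V j)" by (simp only: eq[symmetric])
    then show False using G.p_gt_1 G.card_subgroup_pos[OF G.fin flag_subgroup, of j] ij by simp
  qed
  then obtain x where x: "x \<in> V (Suc j)" "x \<notin> V j" using flag_mono[OF fl, of j "Suc j"] ij by auto
  have xc: "x \<in> carrier G" using flag_carrier x(1) ij by (metis Suc_leI)
  note Vj = flag_step_adjoin[OF fl ij(2) x]
  let ?f = "\<lambda>h. V i #> (act h x \<otimes> inv x)"
  have "card (position V (Suc i) j) = card (?f ` position V (Suc i) j) * card (position V i j)"
  proof (rule H.card_eq_card_image_times[OF H.fin])
    show "subgroup (position V (Suc i) j) H" "subgroup (position V i j) H"
      using ij by (auto intro: position_subgroup)
    show "position V i j \<subseteq> position V (Suc i) j" using ij by (intro position_mono) auto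
    fix h h' assume hS: "h \<in> position V (Suc i) j" "h' \<in> position V (Suc i) j"
    then have c: "h \<in> carrier H" "h' \<in> carrier H" by (auto dest: position_carrier)
    have quot: "h \<otimes>\<^bsub>H\<^esub> inv\<^bsub>H\<^esub> h' \<in> position V (Suc i) j"
      using hS position_subgroup[of "Suc i" j] ij by (simp add: subgroup.m_closed subgroup.m_inv_closed)
    have V0: "diff h h' v \<in> V 0" if "v \<in> V j" for v
      using quot quotient_moves_into_iff[OF flag_invariant c, of j "V 0"] that ij by (auto simp: position_def)
    have "?f h = ?f h' \<longleftrightarrow> diff h h' x \<in> V i"
      using r_coset_displacement_eq_iff[OF c flag_subgroup xc] ij by simp
    also have "\<dots> \<longleftrightarrow> (\<forall>y\<in>V (Suc j). diff h h' y \<in> V i)"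
    proof
      assume dx: "diff h h' x \<in> V i"
      have "diff h h' v \<in> V i" if "v \<in> V j" for v
        using V0[OF that] flag_mono[OF fl, of 0 i] ij by auto
      then show "\<forall>y\<in>V (Suc j). diff h h' y \<in> V i"
        using G.hom_adjoin_subset[OF diff_hom[OF c] flag_subgroup xc flag_subgroup _ dx, of j] ij Vj by auto
    qed (use x in blast)
    also have "\<dots> \<longleftrightarrow> h \<otimes>\<^bsub>H\<^esub> inv\<^bsub>H\<^esub> h' \<in> moves_into (V (Suc j)) (V i)"
      using quotient_moves_into_iff[OF flag_invariant c, of "Suc j" "V i"] ij by simp
    also have "\<dots> \<longleftrightarrow> h \<otimes>\<^bsub>H\<^esub> inv\<^bsub>H\<^esub> h' \<in> position V i j"
      using quot by (auto simp: position_def)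
    finally show "?f h = ?f h' \<longleftrightarrow> h \<otimes>\<^bsub>H\<^esub> inv\<^bsub>H\<^esub> h' \<in> position V i j" .
  qed
  moreover have "card (?f ` position V (Suc i) j) \<le> p"
  proof -
    have sub: "subgroup (V (Suc i)) G" "subgroup (V i) G" using ij by (auto intro: flag_subgroup)
    have "card (V (Suc i)) = card ((\<lambda>b. V i #> b) ` V (Suc i)) * card (V i)"
      using card_image_r_cosets[OF sub] flag_mono[OF fl, of i "Suc i"] ij by simp
    then have "card ((\<lambda>b. V i #> b) ` V (Suc i)) = p"
      using fl ij G.card_subgroup_pos[OF G.fin sub(2)] by (simp add: flag_def)
    moreover have "?f ` position V (Suc i) j \<subseteq> (\<lambda>b. V i #> b) ` V (Suc i)"
      using x(1) by (auto simp: position_def moves_into_def)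
    moreover have "finite ((\<lambda>b. V i #> b) ` V (Suc i))"
      using finite_subset[OF subgroup.subset[OF sub(1)] G.fin] by simp
    ultimately show ?thesis using card_mono by metis
  qed
  ultimately show ?thesis by (simp add: mult_le_mono1)
qed

text \<open>
  With \<open>\<alpha> = 1 + \<phi>\<close> and \<open>\<beta> = 1 + \<psi>\<close>, the difference of \<open>\<alpha> \<beta>\<close> and \<open>\<beta> \<alpha>\<close> is
  \<open>\<phi> \<psi> - \<psi> \<phi>\<close>.  On \<open>V (Suc k)\<close> the map \<open>\<phi>\<close> leads into \<open>V k\<close>, where \<open>\<psi>\<close> vanishes, so only
  \<open>\<phi> \<psi>\<close> remains, and its leading entry is the product of those of \<open>\<phi>\<close> and \<open>\<psi>\<close>.
\<close>

lemma commutator_position: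
  assumes ijk: "i < j" "j < k" "k < r"
    and \<alpha>: "\<alpha> \<in> position V (Suc i) j" "\<alpha> \<notin> position V i j"
    and \<beta>: "\<beta> \<in> position V (Suc j) k" "\<beta> \<notin> position V j k"
  defines "c \<equiv> \<alpha> \<otimes>\<^bsub>H\<^esub> \<beta> \<otimes>\<^bsub>H\<^esub> inv\<^bsub>H\<^esub> \<alpha> \<otimes>\<^bsub>H\<^esub> inv\<^bsub>H\<^esub> \<beta>"
  shows "c \<in> position V (Suc i) k" "c \<notin> position V i k"
proof -
  have hc: "\<alpha> \<in> carrier H" "\<beta> \<in> carrier H" using \<alpha> \<beta> position_carrier by auto
  let ?ab = "\<alpha> \<otimes>\<^bsub>H\<^esub> \<beta>" and ?ba = "\<beta> \<otimes>\<^bsub>H\<^esub> \<alpha>"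
  have c: "c = ?ab \<otimes>\<^bsub>H\<^esub> inv\<^bsub>H\<^esub> ?ba"
    using hc by (simp add: c_def H.inv_mult_group H.m_assoc)
  have abc: "?ab \<in> carrier H" "?ba \<in> carrier H" using hc by auto
  define \<phi> where "\<phi> = (\<lambda>x. act \<alpha> x \<otimes> inv x)"
  define \<psi> where "\<psi> = (\<lambda>x. act \<beta> x \<otimes> inv x)"
  have cl: "\<phi> y \<in> carrier G" "\<psi> y \<in> carrier G" if "y \<in> carrier G" for y
    using that hc by (auto simp: \<phi>_def \<psi>_def)
  have formula: "diff ?ab ?ba y = \<phi> (\<psi> y) \<otimes> inv (\<psi> (\<phi> y))" if y: "y \<in> carrier G" for y
  proof -
    have 1: "act \<alpha> z = z \<otimes> \<phi> z" "act \<beta> z = z \<otimes> \<psi> z" if "z \<in> carrier G" for z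
      using that hc by (simp_all add: \<phi>_def \<psi>_def G.m_lcomm[of z])
    have "act ?ab y = act \<alpha> (y \<otimes> \<psi> y)" using y hc 1 by (simp add: act_comp)
    also have "\<dots> = (y \<otimes> \<phi> y) \<otimes> (\<psi> y \<otimes> \<phi> (\<psi> y))" using y hc cl 1 by (simp add: act_mult)
    finally have ab: "act ?ab y = (y \<otimes> \<phi> y \<otimes> \<psi> y) \<otimes> \<phi> (\<psi> y)" using y cl by (simp add: G.m_assoc)
    have "act ?ba y = act \<beta> (y \<otimes> \<phi> y)" using y hc 1 by (simp add: act_comp)
    also have "\<dots> = (y \<otimes> \<psi> y) \<otimes> (\<phi> y \<otimes> \<psi> (\<phi> y))" using y hc cl 1 by (simp add: act_mult)
    finally have ba: "act ?ba y = (y \<otimes> \<phi> y \<otimes> \<psi> y) \<otimes> \<psi> (\<phi> y)" using y cl by (simp add: G.m_ac)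
    have canc: "(u \<otimes> a) \<otimes> inv (u \<otimes> b) = a \<otimes> inv b" if "u \<in> carrier G" "a \<in> carrier G" "b \<in> carrier G" for u a b
    proof -
      have "(u \<otimes> a) \<otimes> inv (u \<otimes> b) = (u \<otimes> inv u) \<otimes> (a \<otimes> inv b)"
        using that by (simp only: G.inv_mult G.m_ac G.m_closed G.inv_closed)
      then show ?thesis using that by simp
    qed
    show ?thesis unfolding ab ba using y cl by (intro canc) auto
  qed
  have V0: "V 0 \<subseteq> V l" if "l \<le> r" for l using flag_mono[OF fl _ that] by simp
  have \<psi>\<phi>: "\<psi> (\<phi> y) \<in> V 0" if "y \<in> V (Suc k)" for y
  proof -
    have "\<phi> y \<in> V k" using flag_displacement[OF ijk(3) hc(1) that] by (simp add: \<phi>_def)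
    then show ?thesis using \<beta>(1) by (simp add: position_def moves_into_def \<psi>_def)
  qed
  have mem: "diff ?ab ?ba y \<in> V l" if "y \<in> V (Suc k)" "\<phi> (\<psi> y) \<in> V l" "l \<le> r" for y l
    using that \<psi>\<phi>[OF that(1)] V0[OF that(3)] formula[OF flag_carrier[of "Suc k"]] ijk flag_subgroup[OF that(3)]
    by (auto simp: subgroup.m_closed subgroup.m_inv_closed)
  have deep: "diff ?ab ?ba y \<in> V 0" if "y \<in> V k" for y
  proof (rule mem)
    show "y \<in> V (Suc k)" using that flag_mono[OF fl, of k "Suc k"] ijk by auto
    have "\<psi> y \<in> V 0" using \<beta>(1) that by (simp add: position_def moves_into_def \<psi>_def)
    then show "\<phi> (\<psi> y) \<in> V 0"
      using flag_invariant[of 0] hc flag_subgroup[of 0]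
      by (simp add: \<phi>_def invariant_def subgroup.m_closed subgroup.m_inv_closed)
  qed simp
  have top: "diff ?ab ?ba y \<in> V (Suc i)" if "y \<in> V (Suc k)" for y
  proof (rule mem[OF that])
    have "\<psi> y \<in> V (Suc j)" using \<beta>(1) that by (simp add: position_def moves_into_def \<psi>_def)
    then show "\<phi> (\<psi> y) \<in> V (Suc i)" using \<alpha>(1) by (simp add: position_def moves_into_def \<phi>_def)
  qed (use ijk in simp)
  have kr: "k \<le> r" "Suc k \<le> r" using ijk by auto
  have iff: "c \<in> position V l k \<longleftrightarrow> (\<forall>y\<in>V (Suc k). diff ?ab ?ba y \<in> V l)" for l
    unfolding position_def c
    using quotient_moves_into_iff[OF flag_invariant[OF kr(1)] abc, of "V 0"] deep
      quotient_moves_into_iff[OF flag_invariant[OF kr(2)] abc, of "V l"] by blast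
  show "c \<in> position V (Suc i) k" using iff top by blast
  show "c \<notin> position V i k"
  proof
    assume cm: "c \<in> position V i k"
    obtain y where y: "y \<in> V (Suc k)" "\<psi> y \<notin> V j"
      using \<beta> by (auto simp: position_def moves_into_def \<psi>_def)
    have yc: "y \<in> carrier G" using flag_carrier[OF kr(2) y(1)] .
    have \<psi>y: "\<psi> y \<in> V (Suc j)" using \<beta>(1) y(1) by (simp add: position_def moves_into_def \<psi>_def)
    have subi: "subgroup (V i) G" using ijk by (intro flag_subgroup) simp
    have "\<phi> (\<psi> y) = diff ?ab ?ba y \<otimes> \<psi> (\<phi> y)"
      using formula[OF yc] yc cl by (simp add: G.m_assoc)
    moreover have "\<psi> (\<phi> y) \<in> V i" using \<psi>\<phi>[OF y(1)] V0[of i] ijk by auto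
    moreover have "diff ?ab ?ba y \<in> V i" using cm iff y(1) by blast
    ultimately have x: "\<phi> (\<psi> y) \<in> V i" using subgroup.m_closed[OF subi] by simp
    have low: "\<phi> v \<in> V i" if "v \<in> V j" for v
      using \<alpha>(1) that V0[of i] ijk by (auto simp: position_def moves_into_def \<phi>_def)
    have "\<phi> v \<in> V i" if "v \<in> V (Suc j)" for v
    proof (rule G.hom_adjoin_subset[where f = \<phi> and V = "V j" and x = "\<psi> y" and y = v])
      show "\<phi> \<in> hom G G" unfolding \<phi>_def using hc(1) by (rule displacement_hom)
      show "subgroup (V j) G" using ijk by (intro flag_subgroup) simp
      show "\<psi> y \<in> carrier G" using cl yc by simp
      show "v \<in> G.adjoin (V j) (\<psi> y)" using flag_step_adjoin[OF fl _ \<psi>y y(2)] that ijk by simp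
    qed (fact subi low x)+
    then have "\<alpha> \<in> position V i j" using \<alpha>(1) hc by (simp add: position_def moves_into_def \<phi>_def)
    then show False using \<alpha>(2) by blast
  qed
qed

text \<open>
  Only positions that occur in \<open>H\<close> but not in \<open>P\<close> contribute a factor \<open>p\<close>.  Since commutators lie in
  \<open>P\<close>, three such positions \<open>(i, j)\<close>, \<open>(j, k)\<close>, \<open>(i, k)\<close> cannot coexist.
\<close>

lemma layer_flag:
  assumes P: "subgroup P H"
    and comm: "\<And>x y. x \<in> carrier H \<Longrightarrow> y \<in> carrier H \<Longrightarrow>
      x \<otimes>\<^bsub>H\<^esub> y \<otimes>\<^bsub>H\<^esub> inv\<^bsub>H\<^esub> x \<otimes>\<^bsub>H\<^esub> inv\<^bsub>H\<^esub> y \<in> P"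
  shows "layer_bound P (p ^ (r\<^sup>2 div 4)) (carrier H) (moves_into (carrier G) (V 0))"
proof -
  define E where "E = {(i, j). i < j \<and> j < r \<and> position V (Suc i) j \<inter> P \<subseteq> position V i j
    \<and> position V (Suc i) j \<noteq> position V i j}"
  have Esub: "E \<subseteq> {..<r} \<times> {..<r}" by (auto simp: E_def)
  have finE: "finite E" using Esub finite_subset by blast
  have "4 * card E \<le> (card {..<r})\<^sup>2"
  proof (rule triangle_free_card_le[OF _ Esub])
    fix i j k assume ij: "(i, j) \<in> E" and jk: "(j, k) \<in> E"
    have lt: "i < j" "j < k" "k < r" using ij jk by (auto simp: E_def)
    obtain \<alpha> where \<alpha>: "\<alpha> \<in> position V (Suc i) j" "\<alpha> \<notin> position V i j"
      using ij position_mono[of i "Suc i" j] lt by (auto simp: E_def)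
    obtain \<beta> where \<beta>: "\<beta> \<in> position V (Suc j) k" "\<beta> \<notin> position V j k"
      using jk position_mono[of j "Suc j" k] lt by (auto simp: E_def)
    show "(i, k) \<notin> E"
      using commutator_position[OF lt \<alpha> \<beta>] comm[of \<alpha> \<beta>] position_carrier \<alpha>(1) \<beta>(1)
      by (auto simp: E_def)
  qed (auto simp: E_def)
  then have cE: "card E \<le> r\<^sup>2 div 4" by simp
  have pos: "card S > 0 \<and> card (S \<inter> P) > 0" if "subgroup S H" for S
    using H.card_subgroup_pos[OF H.fin] that H.subgroups_Inter_pair[OF that P] by blast
  have step: "layer_bound P (if (i, j) \<in> E then p else 1) (position V (Suc i) j) (position V i j)"
    if ij: "i < j" "j < r" for i j
  proof -
    have sub: "subgroup (position V (Suc i) j) H" "subgroup (position V i j) H"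
      using ij by (auto intro: position_subgroup)
    have le: "position V i j \<subseteq> position V (Suc i) j" using ij by (intro position_mono) auto
    show ?thesis
    proof (cases "(i, j) \<in> E")
      case True
      have "finite (position V (Suc i) j)" using sub(1) H.fin finite_subset subgroup.subset by metis
      then show ?thesis using True layer_bound_index[OF card_position_step[OF ij] le] by simp
    next
      case False
      show ?thesis
      proof (cases "position V (Suc i) j = position V i j")
        case True then show ?thesis using False by (simp add: layer_bound_def)
      next
        case ne: False
        then obtain c where "c \<in> position V (Suc i) j" "c \<in> P" "c \<notin> position V i j"
          using False ij by (auto simp: E_def)
        then show ?thesis
          using False H.layer_bound_jump[OF sub le P card_position_step[OF ij]] by simp
      qed
    qed
  qed
  have row: "layer_bound P (p ^ card {l. l < i \<and> (l, j) \<in> E}) (position V i j) (position V 0 j)"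
    if "i \<le> j" "j < r" for i j
    using that(1)
  proof (induction i)
    case 0 then show ?case by (simp add: layer_bound_def)
  next
    case (Suc i)
    have "{l. l < Suc i \<and> (l, j) \<in> E} = (if (i, j) \<in> E then insert i {l. l < i \<and> (l, j) \<in> E} else {l. l < i \<and> (l, j) \<in> E})"
      by (auto simp: less_Suc_eq)
    then have "p ^ card {l. l < Suc i \<and> (l, j) \<in> E} = (if (i, j) \<in> E then p else 1) * p ^ card {l. l < i \<and> (l, j) \<in> E}"
      by simp
    moreover have "layer_bound P ((if (i, j) \<in> E then p else 1) * p ^ card {l. l < i \<and> (l, j) \<in> E})
        (position V (Suc i) j) (position V 0 j)"
      using Suc that(2) pos[OF position_subgroup[of i j]]
      by (intro layer_bound_trans[OF step Suc.IH]) auto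
    ultimately show ?case by simp
  qed
  have top: "position V j j = moves_into (V j) (V 0)" if "j < r" for j
    using flag_displacement[OF that] by (auto simp: position_def moves_into_def)
  have bot: "position V 0 j = moves_into (V (Suc j)) (V 0)" if "j < r" for j
    using flag_mono[OF fl, of j "Suc j"] that by (auto simp: position_def moves_into_def)
  have all: "layer_bound P (p ^ card {(i, l) \<in> E. l < j}) (carrier H) (moves_into (V j) (V 0))"
    if "j \<le> r" for j
    using that
  proof (induction j)
    case 0
    have "moves_into (V 0) (V 0) = carrier H"
      using flag_invariant[of 0]
      by (auto simp: moves_into_def invariant_def subgroup.m_closed subgroup.m_inv_closed)
    then show ?case by (simp add: layer_bound_def)
  next
    case (Suc j)
    have j: "j < r" using Suc.prems by simp
    have "{(i, l) \<in> E. l < Suc j} = {(i, l) \<in> E. l < j} \<union> (\<lambda>i. (i, j)) ` {i. i < j \<and> (i, j) \<in> E}"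
      by (auto simp: less_Suc_eq E_def)
    also have "card \<dots> = card {(i, l) \<in> E. l < j} + card ((\<lambda>i. (i, j)) ` {i. i < j \<and> (i, j) \<in> E})"
      using finE by (intro card_Un_disjoint) (auto intro: finite_subset[of _ E])
    also have "card ((\<lambda>i. (i, j)) ` {i. i < j \<and> (i, j) \<in> E}) = card {i. i < j \<and> (i, j) \<in> E}"
      by (intro card_image inj_onI) simp
    finally have pw: "p ^ card {(i, l) \<in> E. l < Suc j} = p ^ card {(i, l) \<in> E. l < j} * p ^ card {i. i < j \<and> (i, j) \<in> E}"
      by (simp add: power_add)
    have "layer_bound P (p ^ card {i. i < j \<and> (i, j) \<in> E}) (moves_into (V j) (V 0)) (moves_into (V (Suc j)) (V 0))"
      using row[of j j] j top[OF j] bot[OF j] by simp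
    then show ?case
      unfolding pw using Suc.IH j pos[OF position_subgroup[of j j]] top[OF j]
      by (intro layer_bound_trans[where N = "moves_into (V j) (V 0)"]) auto
  qed
  have "{(i, l) \<in> E. l < r} = E" by (auto simp: E_def)
  then have "layer_bound P (p ^ card E) (carrier H) (moves_into (V r) (V 0))" using all[of r] by simp
  moreover have "V r = carrier G" using fl by (simp add: flag_def)
  moreover have "p ^ card E \<le> p ^ (r\<^sup>2 div 4)" using cE G.p_gt_1 by (simp add: power_increasing)
  ultimately show ?thesis using layer_bound_mono by metis
qed

lemma card_flag: "card (carrier G) = p ^ r * card (V 0)"
proof -
  have "card (V i) = p ^ i * card (V 0)" if "i \<le> r" for i
    using that fl by (induction i) (auto simp: flag_def)
  from this[of r] show ?thesis using fl by (simp add: flag_def)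
qed

end

text \<open>
  The group \<open>G\<close> has as many elements of order dividing \<open>p\<close> as cosets of \<open>G^p\<close>; so the torsion bound
  also limits the length of the flag above \<open>G^p\<close>.
\<close>

theorem layer_kernel_on_abelian:
  assumes P: "subgroup P H" and pw: "\<And>h. h \<in> carrier H \<Longrightarrow> h [^]\<^bsub>H\<^esub> p \<in> P"
    and comm: "\<And>x y. x \<in> carrier H \<Longrightarrow> y \<in> carrier H \<Longrightarrow>
      x \<otimes>\<^bsub>H\<^esub> y \<otimes>\<^bsub>H\<^esub> inv\<^bsub>H\<^esub> x \<otimes>\<^bsub>H\<^esub> inv\<^bsub>H\<^esub> y \<in> P"
    and gs: "finite gs" "gs \<subseteq> carrier G" "generate G gs = carrier G" "card gs \<le> k"
    and tors: "card (G.torsion p) \<le> p ^ k"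
  shows "layer_bound P (p ^ (k\<^sup>2 div 4 + (if p = 2 then 2 else 1) * k\<^sup>2)) (carrier H)
    (moves_into (carrier G) {\<one>})"
proof -
  obtain r V where V: "flag r V" "V 0 = G.power_image p"
    using flag_above[OF power_image_invariant] by blast
  have pos: "card (congruence_subgroup s) > 0 \<and> card (congruence_subgroup s \<inter> P) > 0" for s
    using H.card_subgroup_pos[OF H.fin] congruence_subgroup_subgroup
      H.subgroups_Inter_pair[OF congruence_subgroup_subgroup P] by blast
  have tk: "card (G.torsion p) ^ card gs \<le> p ^ k\<^sup>2"
  proof -
    have "card (G.torsion p) ^ card gs \<le> (p ^ k) ^ card gs" using tors by (rule power_mono) simp
    also have "\<dots> \<le> (p ^ k) ^ k" using gs(4) G.p_gt_1 by (intro power_increasing) auto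
    finally show ?thesis by (simp add: power_mult[symmetric] power2_eq_square)
  qed
  have "card (carrier G) = card (G.power_image p) * card (G.torsion p)"
    using G.card_torsion_quotient[OF G.fin G.subgroup_self, of p]
    by (simp add: G.power_image_def G.torsion_def Collect_conj_eq Int_commute)
  then have "p ^ r = card (G.torsion p)"
    using card_flag[OF V(1)] V(2) G.card_subgroup_pos[OF G.fin G.power_image_subgroup[of p]] by simp
  then have "p ^ r \<le> p ^ k" using tors by simp
  then have "r \<le> k" using power_le_imp_le_exp[OF G.p_gt_1] by blast
  then have "r\<^sup>2 div 4 \<le> k\<^sup>2 div 4" by (intro div_le_mono power_mono) auto
  then have "p ^ (r\<^sup>2 div 4) \<le> p ^ (k\<^sup>2 div 4)" using G.p_gt_1 by (intro power_increasing) auto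
  then have 1: "layer_bound P (p ^ (k\<^sup>2 div 4)) (carrier H) (congruence_subgroup 1)"
    using layer_bound_mono[OF layer_flag[OF V(1) P comm]] V(2) by (simp add: congruence_subgroup_def)
  show ?thesis
  proof (cases "p = 2")
    case False
    then have "odd p" using G.prime_p prime_odd_nat by (metis nat_less_le prime_ge_2_nat)
    then have "layer_bound P (p ^ k\<^sup>2) (congruence_subgroup 1) (moves_into (carrier G) {\<one>})"
      using layer_bound_mono[OF layer_congruence_kernel[OF P pw gs(1-3), of 1] tk] by simp
    from layer_bound_trans[OF 1 this] pos show ?thesis using False by (simp add: power_add)
  next
    case True
    have "card (congruence_subgroup 1) \<le> p ^ k\<^sup>2 * card (congruence_subgroup 2)"
      using card_congruence_subgroup_step[OF gs(1-3)] tk by (meson le_trans mult_le_mono1)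
    moreover have "congruence_subgroup 2 \<subseteq> congruence_subgroup 1"
      using G.power_image_mult_subset[of p p]
      by (auto simp: congruence_subgroup_def moves_into_def power2_eq_square)
    ultimately have 2: "layer_bound P (p ^ k\<^sup>2) (congruence_subgroup 1) (congruence_subgroup 2)"
      using finite_subset[OF subgroup.subset[OF congruence_subgroup_subgroup] H.fin]
      by (intro layer_bound_index) auto
    have 3: "layer_bound P (p ^ k\<^sup>2) (congruence_subgroup 2) (moves_into (carrier G) {\<one>})"
      using layer_bound_mono[OF layer_congruence_kernel[OF P pw gs(1-3), of 2] tk] by simp
    from layer_bound_trans[OF layer_bound_trans[OF 1 2] 3] pos
    show ?thesis using True by (simp add: power_add mult.assoc mult_2)
  qed
qed

end

section \<open>A self-centralizing abelian normal subgroup\<close>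

context p_action
begin

definition normal_abelian :: "'a set \<Rightarrow> bool" where
  "normal_abelian A \<longleftrightarrow> invariant A \<and> (\<forall>a\<in>A. \<forall>b\<in>A. a \<otimes> b = b \<otimes> a) \<and>
     (\<forall>g\<in>carrier G. \<forall>a\<in>A. g \<otimes> a \<otimes> inv g \<in> A)"

definition centralizer :: "'a set \<Rightarrow> 'a set" where
  "centralizer A = {g \<in> carrier G. \<forall>a\<in>A. g \<otimes> a = a \<otimes> g}"

lemma normal_abelian_subgroup: "normal_abelian A \<Longrightarrow> subgroup A G"
  by (simp add: normal_abelian_def invariant_def)

lemma act_conj:
  assumes "h \<in> carrier H" "g \<in> carrier G" "x \<in> carrier G"
  shows "g \<otimes> act h x \<otimes> inv g = act h (act (inv\<^bsub>H\<^esub> h) g \<otimes> x \<otimes> inv (act (inv\<^bsub>H\<^esub> h) g))"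
  using assms by (simp add: act_mult act_inv)

lemma centralizer_subgroup:
  assumes A: "A \<subseteq> carrier G" shows "subgroup (centralizer A) G"
proof (rule G.finite_subgroupI[OF G.fin])
  fix x y assume "x \<in> centralizer A" "y \<in> centralizer A"
  then have c: "x \<in> carrier G" "y \<in> carrier G" and xa: "\<And>a. a \<in> A \<Longrightarrow> x \<otimes> a = a \<otimes> x"
    and ya: "\<And>a. a \<in> A \<Longrightarrow> y \<otimes> a = a \<otimes> y" by (auto simp: centralizer_def)
  have "x \<otimes> y \<otimes> a = a \<otimes> (x \<otimes> y)" if a: "a \<in> A" for a
  proof -
    have ac: "a \<in> carrier G" using a A by blast
    have "x \<otimes> y \<otimes> a = x \<otimes> (a \<otimes> y)" using c ac ya[OF a] by (simp add: G.m_assoc)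
    also have "\<dots> = (x \<otimes> a) \<otimes> y" using c ac by (simp add: G.m_assoc)
    also have "\<dots> = a \<otimes> (x \<otimes> y)" using c ac xa[OF a] by (simp add: G.m_assoc)
    finally show ?thesis .
  qed
  then show "x \<otimes> y \<in> centralizer A" using c by (simp add: centralizer_def)
qed (use A in \<open>auto simp: centralizer_def\<close>)

lemma centralizer_invariant:
  assumes A: "normal_abelian A"
  shows "h \<in> carrier H \<Longrightarrow> x \<in> centralizer A \<Longrightarrow> act h x \<in> centralizer A"
    and "g \<in> carrier G \<Longrightarrow> x \<in> centralizer A \<Longrightarrow> g \<otimes> x \<otimes> inv g \<in> centralizer A"
proof -
  have Ac: "a \<in> carrier G" if "a \<in> A" for a
    using subgroup.mem_carrier[OF normal_abelian_subgroup[OF A] that] .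
  show "act h x \<in> centralizer A" if h: "h \<in> carrier H" and x: "x \<in> centralizer A"
  proof -
    have xc: "x \<in> carrier G" using x by (simp add: centralizer_def)
    have "act h x \<otimes> a = a \<otimes> act h x" if a: "a \<in> A" for a
    proof -
      let ?b = "act (inv\<^bsub>H\<^esub> h) a"
      have b: "?b \<in> A" using A a h by (simp add: normal_abelian_def invariant_def)
      have "act h (x \<otimes> ?b) = act h (?b \<otimes> x)" using x b by (simp add: centralizer_def)
      then show ?thesis using h xc Ac[OF a] by (simp add: act_mult)
    qed
    then show ?thesis using h xc by (simp add: centralizer_def)
  qed
  show "g \<otimes> x \<otimes> inv g \<in> centralizer A" if g: "g \<in> carrier G" and x: "x \<in> centralizer A"
  proof -
    have xc: "x \<in> carrier G" using x by (simp add: centralizer_def)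
    have "g \<otimes> x \<otimes> inv g \<otimes> a = a \<otimes> (g \<otimes> x \<otimes> inv g)" if a: "a \<in> A" for a
    proof -
      let ?b = "inv g \<otimes> a \<otimes> g"
      have ac: "a \<in> carrier G" using Ac[OF a] .
      have "inv g \<otimes> a \<otimes> inv (inv g) \<in> A" using A a g unfolding normal_abelian_def by blast
      then have "x \<otimes> ?b = ?b \<otimes> x" using x g by (simp add: centralizer_def)
      then have "g \<otimes> (x \<otimes> ?b) \<otimes> inv g = g \<otimes> (?b \<otimes> x) \<otimes> inv g" by simp
      moreover have "g \<otimes> (x \<otimes> ?b) \<otimes> inv g = g \<otimes> x \<otimes> inv g \<otimes> a" using g xc ac by (simp add: G.m_assoc)
      moreover have "g \<otimes> (?b \<otimes> x) \<otimes> inv g = a \<otimes> (g \<otimes> x \<otimes> inv g)"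
        using g xc ac by (simp add: G.m_assoc[symmetric])
      ultimately show ?thesis by simp
    qed
    then show ?thesis using g xc by (simp add: centralizer_def)
  qed
qed

text \<open>
  An extension by one element \<open>x\<close> of the centralizer \<open>C\<close> is abelian.  For it to be normal and
  invariant, the coset of \<open>x\<close> in \<open>C / A\<close> has to be fixed both by conjugation with \<open>G\<close> and by \<open>H\<close>.  The
  fixed point argument for \<open>G\<close> shows that the cosets fixed under conjugation form a nontrivial group
  \<open>Z / A\<close>, and the one for \<open>H\<close> acting on \<open>Z / A\<close> then provides \<open>x\<close>.
\<close>

lemma normal_abelian_extension:
  assumes A: "normal_abelian A" and ne: "\<not> centralizer A \<subseteq> A"
  obtains B where "normal_abelian B" "A \<subset> B"
proof -
  let ?C = "centralizer A"
  have sub: "subgroup A G" using normal_abelian_subgroup[OF A] .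
  have Ac: "a \<in> carrier G" if "a \<in> A" for a using subgroup.mem_carrier[OF sub that] .
  have subC: "subgroup ?C G" using centralizer_subgroup subgroup.subset[OF sub] .
  have Cc: "x \<in> carrier G" if "x \<in> ?C" for x using that by (simp add: centralizer_def)
  have AC: "A \<subseteq> ?C" using A Ac by (auto simp: centralizer_def normal_abelian_def)
  have conjA: "g \<otimes> a \<otimes> inv g \<in> A" if "g \<in> carrier G" "a \<in> A" for g a
    using A that by (simp add: normal_abelian_def)
  have actA: "act h a \<in> A" if "h \<in> carrier H" "a \<in> A" for h a
    using A that by (simp add: normal_abelian_def invariant_def)
  define Z where "Z = {x \<in> ?C. \<forall>g\<in>carrier G. g \<otimes> x \<otimes> inv g \<otimes> inv x \<in> A}"
  have Zc: "x \<in> carrier G" if "x \<in> Z" for x using that Cc by (simp add: Z_def)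
  have AZ: "A \<subseteq> Z"
    using AC conjA subgroup.m_closed[OF sub] subgroup.m_inv_closed[OF sub] by (auto simp: Z_def)
  have subZ: "subgroup Z G"
  proof (rule G.finite_subgroupI[OF G.fin])
    show "Z \<subseteq> carrier G" using Zc by blast
    show "\<one> \<in> Z" using AZ subgroup.one_closed[OF sub] by blast
    fix x y assume x: "x \<in> Z" and y: "y \<in> Z"
    have c: "x \<in> carrier G" "y \<in> carrier G" using x y Zc by auto
    have "g \<otimes> (x \<otimes> y) \<otimes> inv g \<otimes> inv (x \<otimes> y) \<in> A" if g: "g \<in> carrier G" for g
    proof -
      let ?b = "g \<otimes> y \<otimes> inv g \<otimes> inv y"
      have b: "?b \<in> A" using y g by (simp add: Z_def)
      have "x \<otimes> ?b = ?b \<otimes> x" using x b by (simp add: Z_def centralizer_def)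
      then have xb: "x \<otimes> ?b \<otimes> inv x = ?b" using c g by (simp add: G.m_assoc)
      have "g \<otimes> (x \<otimes> y) \<otimes> inv g \<otimes> inv (x \<otimes> y) = (g \<otimes> x \<otimes> inv g \<otimes> inv x) \<otimes> (x \<otimes> ?b \<otimes> inv x)"
      proof -
        have canc: "inv a \<otimes> (a \<otimes> b) = b" if "a \<in> carrier G" "b \<in> carrier G" for a b
          using that by (simp add: G.m_assoc[symmetric])
        show ?thesis using c g by (simp add: G.m_assoc G.inv_mult_group canc)
      qed
      then have "g \<otimes> (x \<otimes> y) \<otimes> inv g \<otimes> inv (x \<otimes> y) = (g \<otimes> x \<otimes> inv g \<otimes> inv x) \<otimes> ?b"
        by (simp only: xb)
      moreover have "g \<otimes> x \<otimes> inv g \<otimes> inv x \<in> A" using x g by (simp add: Z_def)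
      ultimately show ?thesis using b subgroup.m_closed[OF sub] by simp
    qed
    then show "x \<otimes> y \<in> Z" using x y subgroup.m_closed[OF subC] by (simp add: Z_def)
  qed
  have actZ: "act h x \<in> Z" if h: "h \<in> carrier H" and x: "x \<in> Z" for h x
  proof -
    have "g \<otimes> act h x \<otimes> inv g \<otimes> inv (act h x) \<in> A" if g: "g \<in> carrier G" for g
    proof -
      let ?g = "act (inv\<^bsub>H\<^esub> h) g"
      have gc: "?g \<in> carrier G" using g h by simp
      have "g \<otimes> act h x \<otimes> inv g \<otimes> inv (act h x) = act h (?g \<otimes> x \<otimes> inv ?g \<otimes> inv x)"
        using h g gc Zc[OF x] act_conj[OF h g Zc[OF x]] by (simp add: act_mult act_inv)
      moreover have "?g \<otimes> x \<otimes> inv ?g \<otimes> inv x \<in> A" using x gc by (simp add: Z_def)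
      ultimately show ?thesis using actA[OF h] by simp
    qed
    then show ?thesis using x centralizer_invariant(1)[OF A h] by (simp add: Z_def)
  qed
  have invs: "inv\<^bsub>G\<lparr>carrier := ?C\<rparr>\<^esub> x = inv x" if "x \<in> ?C" for x
    using that subC by (simp add: G.m_inv_consistent)
  have invsZ: "inv\<^bsub>G\<lparr>carrier := Z\<rparr>\<^esub> x = inv x" if "x \<in> Z" for x
    using that subZ by (simp add: G.m_inv_consistent)
  have "Z \<noteq> A"
  proof -
    obtain x where "x \<in> carrier (G\<lparr>carrier := ?C\<rparr>)" "x \<notin> A" and
      x: "\<And>g. g \<in> carrier G \<Longrightarrow> (g \<otimes> x \<otimes> inv g) \<otimes>\<^bsub>G\<lparr>carrier := ?C\<rparr>\<^esub> inv\<^bsub>G\<lparr>carrier := ?C\<rparr>\<^esub> x \<in> A"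
    proof (rule p_group_fixes_coset[of "G\<lparr>carrier := ?C\<rparr>" p G A "\<lambda>g x. g \<otimes> x \<otimes> inv g"])
      show "finite_p_group (G\<lparr>carrier := ?C\<rparr>) p" by (rule G.subgroup_p_group[OF subC])
      show "finite_p_group G p" by (rule G.finite_p_group_axioms)
      show "subgroup A (G\<lparr>carrier := ?C\<rparr>)" using G.subgroup_incl[OF sub subC AC] .
      show "A \<noteq> carrier (G\<lparr>carrier := ?C\<rparr>)" using ne by auto
      show "g \<otimes> a \<otimes> inv g \<in> A" if "g \<in> carrier G" "a \<in> A" for g a using conjA that .
      show "g \<otimes> x \<otimes> inv g \<in> carrier (G\<lparr>carrier := ?C\<rparr>)"
        if "g \<in> carrier G" "x \<in> carrier (G\<lparr>carrier := ?C\<rparr>)" for g x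
        using that centralizer_invariant(2)[OF A] by simp
      show "\<one> \<otimes> x \<otimes> inv \<one> = x" if "x \<in> carrier (G\<lparr>carrier := ?C\<rparr>)" for x using that Cc by simp
      show "g \<otimes> (x \<otimes>\<^bsub>G\<lparr>carrier := ?C\<rparr>\<^esub> y) \<otimes> inv g =
          (g \<otimes> x \<otimes> inv g) \<otimes>\<^bsub>G\<lparr>carrier := ?C\<rparr>\<^esub> (g \<otimes> y \<otimes> inv g)"
        if g: "g \<in> carrier G" and "x \<in> carrier (G\<lparr>carrier := ?C\<rparr>)" "y \<in> carrier (G\<lparr>carrier := ?C\<rparr>)" for g x y
      proof -
        have c: "x \<in> carrier G" "y \<in> carrier G" using that Cc by auto
        have canc: "inv g \<otimes> (g \<otimes> b) = b" if "b \<in> carrier G" for b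
          using that g by (simp add: G.m_assoc[symmetric])
        show ?thesis using g c by (simp add: G.m_assoc canc)
      qed
      show "(g \<otimes> g') \<otimes> x \<otimes> inv (g \<otimes> g') = g \<otimes> (g' \<otimes> x \<otimes> inv g') \<otimes> inv g"
        if "g \<in> carrier G" "g' \<in> carrier G" "x \<in> carrier (G\<lparr>carrier := ?C\<rparr>)" for g g' x
        using that Cc by (simp add: G.m_assoc G.inv_mult_group)
    qed (rule that)
    then have "x \<in> Z" using invs by (simp add: Z_def)
    then show ?thesis using \<open>x \<notin> A\<close> by blast
  qed
  obtain x where x: "x \<in> carrier (G\<lparr>carrier := Z\<rparr>)" "x \<notin> A" and
    fx: "\<And>h. h \<in> carrier H \<Longrightarrow> act h x \<otimes>\<^bsub>G\<lparr>carrier := Z\<rparr>\<^esub> inv\<^bsub>G\<lparr>carrier := Z\<rparr>\<^esub> x \<in> A"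
  proof (rule p_group_fixes_coset[of "G\<lparr>carrier := Z\<rparr>" p H A act])
    show "finite_p_group (G\<lparr>carrier := Z\<rparr>) p" by (rule G.subgroup_p_group[OF subZ])
    show "finite_p_group H p" by (rule H.finite_p_group_axioms)
    show "subgroup A (G\<lparr>carrier := Z\<rparr>)" using G.subgroup_incl[OF sub subZ AZ] .
    show "A \<noteq> carrier (G\<lparr>carrier := Z\<rparr>)" using \<open>Z \<noteq> A\<close> by auto
    show "act h a \<in> A" if "h \<in> carrier H" "a \<in> A" for h a using actA that .
    show "act h y \<in> carrier (G\<lparr>carrier := Z\<rparr>)" if "h \<in> carrier H" "y \<in> carrier (G\<lparr>carrier := Z\<rparr>)" for h y
      using actZ that by simp
    show "act h (y \<otimes>\<^bsub>G\<lparr>carrier := Z\<rparr>\<^esub> z) = act h y \<otimes>\<^bsub>G\<lparr>carrier := Z\<rparr>\<^esub> act h z"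
      if "h \<in> carrier H" "y \<in> carrier (G\<lparr>carrier := Z\<rparr>)" "z \<in> carrier (G\<lparr>carrier := Z\<rparr>)" for h y z
      using that Zc by (simp add: act_mult)
    show "act \<one>\<^bsub>H\<^esub> y = y" if "y \<in> carrier (G\<lparr>carrier := Z\<rparr>)" for y
      using that Zc by (simp add: act_id)
    show "act (h \<otimes>\<^bsub>H\<^esub> h') y = act h (act h' y)"
      if "h \<in> carrier H" "h' \<in> carrier H" "y \<in> carrier (G\<lparr>carrier := Z\<rparr>)" for h h' y
      using that Zc by (simp add: act_comp)
  qed (rule that)
  have xZ: "x \<in> Z" using x(1) by simp
  have xc: "x \<in> carrier G" using Zc[OF xZ] .
  have xC: "x \<in> ?C" using xZ by (simp add: Z_def)
  have xA: "x \<otimes> a = a \<otimes> x" if "a \<in> A" for a using xC that by (simp add: centralizer_def)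
  have nrm: "x \<otimes> a \<otimes> inv x \<in> A" if "a \<in> A" for a using conjA[OF xc that] .
  let ?B = "G.adjoin A x"
  have subB: "subgroup ?B G" by (rule G.adjoin_is_subgroup[OF G.fin sub xc nrm])
  have AB: "A \<subseteq> ?B" "x \<in> ?B" using G.adjoin_subset[OF sub xc] by auto
  have homB: "f y \<in> ?B" if f: "f \<in> hom G G" "\<And>a. a \<in> A \<Longrightarrow> f a \<in> A" "f x \<otimes> inv x \<in> A"
    and y: "y \<in> ?B" for f y
  proof (rule G.hom_adjoin_subset[OF f(1) sub xc subB _ _ y])
    show "f a \<in> ?B" if "a \<in> A" for a using f(2)[OF that] AB by blast
    have "f x \<in> carrier G" using f(1) xc by (simp add: hom_in_carrier)
    then have "f x = (f x \<otimes> inv x) \<otimes> x" using xc by (simp add: G.m_assoc)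
    then show "f x \<in> ?B" using f(3) AB subgroup.m_closed[OF subB] by (metis subsetD)
  qed
  have "normal_abelian ?B"
    unfolding normal_abelian_def invariant_def
  proof (intro conjI ballI)
    show "subgroup ?B G" by (rule subB)
    fix h y assume h: "h \<in> carrier H" and y: "y \<in> ?B"
    show "act h y \<in> ?B"
    proof (rule homB[OF _ _ _ y])
      show "act h \<in> hom G G" using h by (auto simp: hom_def act_mult)
      show "act h x \<otimes> inv x \<in> A" using fx[OF h] invsZ[OF xZ] by simp
    qed (rule actA[OF h])
  next
    fix g y assume g: "g \<in> carrier G" and y: "y \<in> ?B"
    show "g \<otimes> y \<otimes> inv g \<in> ?B"
    proof (rule homB[OF _ _ _ y, of "\<lambda>y. g \<otimes> y \<otimes> inv g"])
      have canc: "inv g \<otimes> (g \<otimes> b) = b" if "b \<in> carrier G" for b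
        using that g by (simp add: G.m_assoc[symmetric])
      show "(\<lambda>y. g \<otimes> y \<otimes> inv g) \<in> hom G G" using g by (auto simp: hom_def G.m_assoc canc)
      show "g \<otimes> x \<otimes> inv g \<otimes> inv x \<in> A" using xZ g by (simp add: Z_def)
    qed (rule conjA[OF g])
  next
    fix y z assume y: "y \<in> ?B" and z: "z \<in> ?B"
    have xB: "x \<in> centralizer ?B"
    proof -
      have "x \<otimes> (a \<otimes> x [^] i) = a \<otimes> x [^] i \<otimes> x" if "a \<in> A" for a and i :: nat
      proof -
        have "x \<otimes> (a \<otimes> x [^] i) = (a \<otimes> x) \<otimes> x [^] i" using xc Ac[OF that] xA[OF that] by (simp add: G.m_assoc[symmetric])
        also have "\<dots> = a \<otimes> x [^] Suc i" using xc Ac[OF that] by (simp only: G.nat_pow_Suc2 G.m_assoc G.nat_pow_closed)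
        finally show ?thesis using xc Ac[OF that] by (simp add: G.m_assoc)
      qed
      then show ?thesis using xc by (auto simp: centralizer_def G.adjoin_def)
    qed
    have aB: "a \<in> centralizer ?B" if a: "a \<in> A" for a
    proof -
      have "?B \<subseteq> centralizer A"
        using AC xC by (auto simp: G.adjoin_def intro!: subgroup.m_closed[OF subC] G.subgroup_nat_pow[OF subC])
      then show ?thesis using a Ac[OF a] by (auto simp: centralizer_def)
    qed
    have subCB: "subgroup (centralizer ?B) G" using centralizer_subgroup subgroup.subset[OF subB] .
    have "x [^] (i::nat) \<in> centralizer ?B" for i
      using G.subgroup_nat_pow[OF subCB xB] .
    then have "?B \<subseteq> centralizer ?B"
      using aB subgroup.m_closed[OF subCB] by (auto simp: G.adjoin_def)
    then show "y \<otimes> z = z \<otimes> y" using y z by (auto simp: centralizer_def)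
  qed
  moreover have "A \<subset> ?B" using AB x(2) by blast
  ultimately show thesis using that by blast
qed

lemma self_centralizing_normal_abelian:
  obtains A where "normal_abelian A" "centralizer A \<subseteq> A"
proof -
  let ?S = "{A. normal_abelian A}"
  have "?S \<subseteq> Pow (carrier G)" using normal_abelian_subgroup subgroup.subset by blast
  then have "finite ?S" using finite_subset G.fin by blast
  moreover have "{\<one>} \<in> ?S" using G.triv_subgroup by (auto simp: normal_abelian_def invariant_def)
  ultimately obtain A where A: "A \<in> ?S" "\<forall>B\<in>?S. A \<subseteq> B \<longrightarrow> A = B"
    using finite_has_maximal2[of ?S "{\<one>}"] by blast
  have "centralizer A \<subseteq> A"
  proof (rule ccontr)
    assume "\<not> centralizer A \<subseteq> A"
    then obtain B where "normal_abelian B" "A \<subset> B" using normal_abelian_extension A(1) by blast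
    then show False using A(2) by blast
  qed
  then show thesis using that A(1) by blast
qed

text \<open>
  If \<open>h\<close> fixes \<open>A\<close> pointwise then, for \<open>a \<in> A\<close>, it fixes \<open>g a g\<^sup>-\<^sup>1\<close>, so \<open>g\<^sup>-\<^sup>1 h(g)\<close> centralizes
  \<open>A\<close> and hence lies in \<open>A\<close>.  Thus \<open>h^n(g) = g d(g)^n\<close>, and two automorphisms with the same \<open>p\<close>-th
  power differ on each generator by an element of \<open>A\<close> of order dividing \<open>p\<close>.
\<close>

lemma layer_stabilizer:
  assumes A: "normal_abelian A" "centralizer A \<subseteq> A"
    and faithful: "\<And>h. h \<in> carrier H \<Longrightarrow> \<forall>x\<in>carrier G. act h x = x \<Longrightarrow> h = \<one>\<^bsub>H\<^esub>"
    and P: "subgroup P H" and pw: "\<And>h. h \<in> carrier H \<Longrightarrow> h [^]\<^bsub>H\<^esub> p \<in> P"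
    and gs: "finite gs" "gs \<subseteq> carrier G" "generate G gs = carrier G"
  shows "layer_bound P (card {a \<in> A. a [^] p = \<one>} ^ card gs) (moves_into A {\<one>}) {\<one>\<^bsub>H\<^esub>}"
proof (rule H.layer_bound_power[OF H.fin _ H.triv_subgroup _ P, where f = "\<lambda>h. restrict (act h) gs"])
  let ?f = "\<lambda>h. restrict (act h) gs"
  let ?N = "moves_into A {\<one>}"
  let ?T = "{a \<in> A. a [^] p = \<one>}"
  have sub: "subgroup A G" using normal_abelian_subgroup[OF A(1)] .
  have Ac: "a \<in> carrier G" if "a \<in> A" for a using subgroup.mem_carrier[OF sub that] .
  have Acomm: "a \<otimes> b = b \<otimes> a" if "a \<in> A" "b \<in> A" for a b using A(1) that by (simp add: normal_abelian_def)
  show subN: "subgroup ?N H"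
    using subgroup.subset[OF sub] by (rule moves_into_subgroup) (simp add: invariant_def G.triv_subgroup)
  show "{\<one>\<^bsub>H\<^esub>} \<subseteq> ?N" using subgroup.one_closed[OF subN] by simp
  have Nc: "h \<in> carrier H" if "h \<in> ?N" for h using that by (simp add: moves_into_def)
  show "h [^]\<^bsub>H\<^esub> p \<in> P" if "h \<in> ?N" for h using pw Nc[OF that] .
  have Nfix: "act h a = a" if h: "h \<in> ?N" and a: "a \<in> A" for h a
  proof -
    have "act h a \<otimes> inv a = \<one>" using h a by (simp add: moves_into_def)
    then show ?thesis using Nc[OF h] Ac[OF a] G.inv_equality[of "act h a" "inv a"] by simp
  qed
  define d where "d = (\<lambda>h g. inv g \<otimes> act h g)"
  have split: "act h g = g \<otimes> d h g" if "h \<in> carrier H" "g \<in> carrier G" for h g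
    using that by (simp add: d_def G.m_assoc[symmetric])
  have dA: "d h g \<in> A" if h: "h \<in> ?N" and g: "g \<in> carrier G" for h g
  proof -
    have dc: "d h g \<in> carrier G" using Nc[OF h] g by (simp add: d_def)
    have "d h g \<otimes> a = a \<otimes> d h g" if a: "a \<in> A" for a
    proof -
      let ?b = "g \<otimes> a \<otimes> inv g"
      have "?b \<in> A" using A(1) g a by (simp add: normal_abelian_def)
      then have "act h ?b = ?b" by (rule Nfix[OF h])
      then have "act h g \<otimes> a \<otimes> inv (act h g) = ?b"
        using Nc[OF h] g Ac[OF a] Nfix[OF h a] by (simp add: act_mult act_inv)
      then have eq: "act h g \<otimes> a = ?b \<otimes> act h g"
        using Nc[OF h] g Ac[OF a] by (metis G.inv_solve_right' G.m_closed G.inv_closed act_closed)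
      have "d h g \<otimes> a = inv g \<otimes> (act h g \<otimes> a)" using Nc[OF h] g Ac[OF a] by (simp add: d_def G.m_assoc)
      also have "\<dots> = a \<otimes> d h g"
        unfolding eq using Nc[OF h] g Ac[OF a] by (simp add: d_def G.m_assoc[symmetric])
      finally show ?thesis .
    qed
    then show ?thesis using A(2) dc by (auto simp: centralizer_def)
  qed
  have pow: "act (h [^]\<^bsub>H\<^esub> (n::nat)) g = g \<otimes> d h g [^] n" if h: "h \<in> ?N" and g: "g \<in> carrier G" for h g n
  proof (induction n)
    case 0 then show ?case using act_id g by simp
  next
    case (Suc n)
    have dc: "d h g \<in> carrier G" using Ac[OF dA[OF h g]] .
    have powA: "d h g [^] k \<in> A" for k :: nat
      using G.subgroup_nat_pow[OF sub dA[OF h g]] .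
    have "act (h [^]\<^bsub>H\<^esub> Suc n) g = act h (act (h [^]\<^bsub>H\<^esub> n) g)"
      using Nc[OF h] g by (simp only: H.nat_pow_Suc2 act_comp H.nat_pow_closed)
    also have "\<dots> = act h g \<otimes> d h g [^] n"
      using Suc.IH Nc[OF h] g dc Nfix[OF h powA] by (simp add: act_mult)
    also have "\<dots> = g \<otimes> d h g [^] Suc n"
      using Nc[OF h] g dc by (simp only: split G.nat_pow_Suc2 G.m_assoc G.nat_pow_closed)
    finally show ?case .
  qed
  show "?f h = ?f h' \<longleftrightarrow> h \<otimes>\<^bsub>H\<^esub> inv\<^bsub>H\<^esub> h' \<in> {\<one>\<^bsub>H\<^esub>}" if "h \<in> ?N" "h' \<in> ?N" for h h'
  proof
    have c: "h \<in> carrier H" "h' \<in> carrier H" using that Nc by auto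
    show "?f h = ?f h'" if "h \<otimes>\<^bsub>H\<^esub> inv\<^bsub>H\<^esub> h' \<in> {\<one>\<^bsub>H\<^esub>}"
      using that c H.inv_equality[of h "inv\<^bsub>H\<^esub> h'"] by simp
    assume eq: "?f h = ?f h'"
    have "subgroup {g \<in> carrier G. act h g = act h' g} G"
      using c by (intro G.finite_subgroupI[OF G.fin]) (auto simp: act_mult)
    moreover have "gs \<subseteq> {g \<in> carrier G. act h g = act h' g}"
      using gs(2) eq by (auto dest: fun_cong simp: restrict_def split: if_splits)
    ultimately have all: "act h g = act h' g" if "g \<in> carrier G" for g
      using G.generate_subgroup_incl gs(3) that by blast
    have "act (h \<otimes>\<^bsub>H\<^esub> inv\<^bsub>H\<^esub> h') g = g" if "g \<in> carrier G" for g
      using that c by (simp add: act_comp all)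
    then show "h \<otimes>\<^bsub>H\<^esub> inv\<^bsub>H\<^esub> h' \<in> {\<one>\<^bsub>H\<^esub>}" using faithful c by simp
  qed
  fix x assume x: "x \<in> ?N"
  let ?Y = "{y \<in> ?N. ?f (y [^]\<^bsub>H\<^esub> p) = ?f (x [^]\<^bsub>H\<^esub> p)}"
  have finT: "finite ?T" using Ac G.fin by (metis (mono_tags, lifting) finite_subset mem_Collect_eq subsetI)
  show "card (?f ` ?Y) \<le> card ?T ^ card gs"
  proof -
    let ?t = "\<lambda>u. \<lambda>g\<in>gs. inv (act x g) \<otimes> u g"
    have gc: "g \<in> carrier G" if "g \<in> gs" for g using that gs(2) by blast
    have "?t ` ?f ` ?Y \<subseteq> gs \<rightarrow>\<^sub>E ?T"
    proof clarify
      fix y assume y: "y \<in> ?N" and eq: "?f (y [^]\<^bsub>H\<^esub> p) = ?f (x [^]\<^bsub>H\<^esub> p)"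
      have "inv (act x g) \<otimes> act y g \<in> ?T" if g: "g \<in> gs" for g
      proof -
        let ?a = "d x g" and ?b = "d y g"
        have ab: "?a \<in> A" "?b \<in> A" using dA x y gc[OF g] by auto
        have abc: "?a \<in> carrier G" "?b \<in> carrier G" using ab Ac by auto
        have "act (y [^]\<^bsub>H\<^esub> p) g = act (x [^]\<^bsub>H\<^esub> p) g" using fun_cong[OF eq, of g] g by simp
        then have pp: "?b [^] p = ?a [^] p" using pow x y gc[OF g] abc by simp
        have e: "inv (act x g) \<otimes> act y g = inv ?a \<otimes> ?b"
          using Nc x y gc[OF g] abc by (simp add: split G.inv_mult_group G.m_assoc)
            (simp add: G.m_assoc[symmetric])
        have "inv ?a \<otimes> ?b \<in> A" using ab sub by (simp add: subgroup.m_closed subgroup.m_inv_closed)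
        moreover have "(inv ?a \<otimes> ?b) [^] p = \<one>"
          using G.pow_mult_distrib[of "inv ?a" ?b p] Acomm[OF subgroup.m_inv_closed[OF sub ab(1)] ab(2)] abc pp
          by (simp add: G.nat_pow_inv)
        ultimately show ?thesis by (simp add: e)
      qed
      then show "?t (?f y) \<in> gs \<rightarrow>\<^sub>E ?T" by simp
    qed
    moreover have "inj_on ?t (?f ` ?Y)"
    proof (rule inj_onI)
      fix u v assume "u \<in> ?f ` ?Y" "v \<in> ?f ` ?Y" and eq: "?t u = ?t v"
      then obtain y z where y: "y \<in> ?N" "u = ?f y" and z: "z \<in> ?N" "v = ?f z" by auto
      have "act y g = act z g" if g: "g \<in> gs" for g
      proof -
        have "inv (act x g) \<otimes> act y g = inv (act x g) \<otimes> act z g"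
          using fun_cong[OF eq, of g] g y(2) z(2) by simp
        then show ?thesis using Nc x y(1) z(1) gc[OF g] by simp
      qed
      then show "u = v" using y(2) z(2) by (auto intro: restrict_ext)
    qed
    ultimately have "card (?f ` ?Y) \<le> card (gs \<rightarrow>\<^sub>E ?T)"
      using finT gs(1) by (intro card_inj_on_le[where f = ?t] finite_PiE) auto
    then show ?thesis using gs(1) by (simp add: card_PiE)
  qed
qed

end

section \<open>The bound on the number of generators\<close>

lemma (in comm_group) card_le_exponent_power:
  assumes fin: "finite (carrier G)" and S: "finite S" "S \<subseteq> carrier G"
    and ex: "\<And>x. x \<in> carrier G \<Longrightarrow> x [^] (p::nat) = \<one>" and p: "p > 0"
  shows "card (generate G S) \<le> p ^ card S"
  using S
proof (induction S rule: finite_induct)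
  case empty then show ?case by (simp add: generate_empty)
next
  case (insert x S)
  let ?V = "generate G S"
  have sub: "subgroup ?V G" using insert.prems by (intro generate_is_subgroup) simp
  have x: "x \<in> carrier G" using insert.prems by simp
  have "x \<otimes> v \<otimes> inv x \<in> ?V" if "v \<in> ?V" for v
    using that x subgroup.mem_carrier[OF sub that] m_comm[of x v] by (simp add: m_assoc)
  then have "subgroup (adjoin ?V x) G" by (rule adjoin_is_subgroup[OF fin sub x])
  moreover have "insert x S \<subseteq> adjoin ?V x"
    using adjoin_subset[OF sub x] generate.incl[of _ S G] by blast
  ultimately have "generate G (insert x S) \<subseteq> adjoin ?V x" by (intro generate_subgroup_incl)
  then have "card (generate G (insert x S)) \<le> card (adjoin ?V x)"
    using adjoin_subset(3)[OF sub x] fin by (intro card_mono) (auto intro: finite_subset)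
  also have "\<dots> \<le> p * card ?V"
    using ex[OF x] subgroup.one_closed[OF sub] by (intro card_adjoin_le[OF fin sub x _ p]) simp
  also have "\<dots> \<le> p * p ^ card S" using insert by simp
  finally show ?case using insert.hyps by simp
qed

lemma prufer_rank_generators:
  assumes "group G" "finite (carrier G)" "prufer_rank G \<le> enat k" "subgroup K G"
  obtains S where "finite S" "S \<subseteq> K" "card S \<le> k" "generate (G\<lparr>carrier := K\<rparr>) S = K"
proof -
  interpret group G by fact
  interpret K: group "G\<lparr>carrier := K\<rparr>" using assms(4) by (rule subgroup_imp_group)
  have finK: "finite K" using finite_subset[OF subgroup.subset[OF assms(4)] assms(2)] .
  have gen: "generate (G\<lparr>carrier := K\<rparr>) K = K"
    using K.generate_incl[of K] generate.incl[of _ K "G\<lparr>carrier := K\<rparr>"] by auto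
  have "finitely_generated_group (G\<lparr>carrier := K\<rparr>)"
    unfolding finitely_generated_group_def using K.is_group gen finK by auto
  then have "min_gens (G\<lparr>carrier := K\<rparr>) \<le> prufer_rank G"
    unfolding prufer_rank_def using assms(4) by (intro SUP_upper) auto
  also note assms(3)
  finally have le: "min_gens (G\<lparr>carrier := K\<rparr>) \<le> enat k" .
  let ?S = "{S. S \<subseteq> K \<and> finite S \<and> generate (G\<lparr>carrier := K\<rparr>) S = K}"
  have "K \<in> ?S" using gen finK by simp
  then have "enat (card K) \<in> (\<lambda>S. enat (card S)) ` ?S" by (rule imageI)
  then have "(INF S\<in>?S. enat (card S)) \<in> (\<lambda>S. enat (card S)) ` ?S" by (rule wellorder_InfI)
  then obtain S where S: "S \<in> ?S" "(INF S\<in>?S. enat (card S)) = enat (card S)" by blast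
  have "min_gens (G\<lparr>carrier := K\<rparr>) = enat (card S)" using S(2) by (simp add: min_gens_def)
  then show thesis using le S(1) by (intro that[of S]) simp_all
qed

text \<open>
  The rank hypothesis is used for three subgroups: \<open>G\<close> and \<open>A\<close> have at most \<open>k\<close> generators, and so has
  the elementary abelian torsion subgroup of \<open>A\<close>, whose order is therefore at most \<open>p^k\<close>.
\<close>

theorem (in p_action) min_gens_faithful_action:
  assumes faithful: "\<And>h. h \<in> carrier H \<Longrightarrow> \<forall>x\<in>carrier G. act h x = x \<Longrightarrow> h = \<one>\<^bsub>H\<^esub>"
    and rank: "prufer_rank G \<le> enat k"
  shows "min_gens H \<le> enat (k\<^sup>2 div 4 + (if p = 2 then 3 else 2) * k\<^sup>2)"
proof (rule H.min_gens_le)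
  fix P assume P: "subgroup P H" and pw: "\<And>x. x \<in> carrier H \<Longrightarrow> x [^]\<^bsub>H\<^esub> p \<in> P"
    and comm: "\<And>x y. x \<in> carrier H \<Longrightarrow> y \<in> carrier H \<Longrightarrow>
      x \<otimes>\<^bsub>H\<^esub> y \<otimes>\<^bsub>H\<^esub> inv\<^bsub>H\<^esub> x \<otimes>\<^bsub>H\<^esub> inv\<^bsub>H\<^esub> y \<in> P"
  obtain A where A: "normal_abelian A" "centralizer A \<subseteq> A" by (rule self_centralizing_normal_abelian)
  have sub: "subgroup A G" using normal_abelian_subgroup[OF A(1)] .
  have Ac: "a \<in> carrier G" if "a \<in> A" for a using subgroup.mem_carrier[OF sub that] .
  let ?A = "G\<lparr>carrier := A\<rparr>"
  interpret A: finite_p_group ?A p by (rule G.subgroup_p_group[OF sub])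
  interpret A: comm_group ?A
    using A(1) by (intro A.group_comm_groupI) (simp add: normal_abelian_def)
  interpret A: abelian_p_action ?A H p act
    using A(1) Ac by unfold_locales (auto simp: normal_abelian_def invariant_def act_mult act_id act_comp)
  have pow: "x [^]\<^bsub>?A\<^esub> (n::nat) = x [^] n" for x n by (simp add: G.nat_pow_consistent[symmetric])
  obtain gs where gs: "finite gs" "gs \<subseteq> A" "card gs \<le> k" "generate ?A gs = A"
    by (rule prufer_rank_generators[OF G.is_group G.fin rank sub])
  obtain gG where gG: "finite gG" "gG \<subseteq> carrier G" "card gG \<le> k" "generate (G\<lparr>carrier := carrier G\<rparr>) gG = carrier G"
    by (rule prufer_rank_generators[OF G.is_group G.fin rank G.subgroup_self])
  let ?T = "A.torsion p"
  have T: "?T = {a \<in> A. a [^] p = \<one>}" by (simp add: A.torsion_def pow)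
  have subT: "subgroup ?T G"
    using G.incl_subgroup[OF sub A.torsion_subgroup] .
  have cT: "card ?T \<le> p ^ k"
  proof -
    let ?TG = "G\<lparr>carrier := ?T\<rparr>"
    interpret T: group ?TG using subT by (rule G.subgroup_imp_group)
    interpret T: comm_group ?TG
      using A(1) by (intro T.group_comm_groupI) (simp add: normal_abelian_def T)
    obtain S where S: "finite S" "S \<subseteq> ?T" "card S \<le> k" "generate ?TG S = ?T"
      by (rule prufer_rank_generators[OF G.is_group G.fin rank subT])
    have "card (generate ?TG S) \<le> p ^ card S"
    proof (rule T.card_le_exponent_power)
      show "finite (carrier ?TG)" using finite_subset[OF subgroup.subset[OF subT] G.fin] by simp
      show "x [^]\<^bsub>?TG\<^esub> p = \<one>\<^bsub>?TG\<^esub>" if "x \<in> carrier ?TG" for x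
        using that by (simp add: G.nat_pow_consistent[symmetric] T)
    qed (use S G.p_gt_1 in auto)
    also have "\<dots> \<le> p ^ k" using S(3) G.p_gt_1 by (intro power_increasing) auto
    finally show ?thesis using S(4) by simp
  qed
  let ?m = "k\<^sup>2 div 4 + (if p = 2 then 2 else 1) * k\<^sup>2"
  have NA: "A.moves_into (carrier ?A) {\<one>\<^bsub>?A\<^esub>} = moves_into A {\<one>}"
    unfolding A.moves_into_def moves_into_def using G.m_inv_consistent[OF sub] by simp
  have 1: "layer_bound P (p ^ ?m) (carrier H) (moves_into A {\<one>})"
    using A.layer_kernel_on_abelian[OF P pw comm gs(1) _ _ gs(3)] gs(2,4) cT unfolding NA by simp
  have "card {a \<in> A. a [^] p = \<one>} ^ card gG \<le> (p ^ k) ^ card gG"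
    using cT unfolding T by (rule power_mono) simp
  also have "\<dots> \<le> (p ^ k) ^ k" using gG(3) G.p_gt_1 by (intro power_increasing) auto
  also have "\<dots> = p ^ k\<^sup>2" by (simp add: power_mult[symmetric] power2_eq_square)
  finally have "layer_bound P (p ^ k\<^sup>2) (moves_into A {\<one>}) {\<one>\<^bsub>H\<^esub>}"
    using layer_bound_mono[OF layer_stabilizer[OF A faithful P pw gG(1,2)]] gG(4) by simp
  moreover have subN: "subgroup (moves_into A {\<one>}) H"
    using subgroup.subset[OF sub] by (rule moves_into_subgroup) (simp add: invariant_def G.triv_subgroup)
  ultimately have "layer_bound P (p ^ ?m * p ^ k\<^sup>2) (carrier H) {\<one>\<^bsub>H\<^esub>}"
    using H.card_subgroup_pos[OF H.fin] H.subgroups_Inter_pair[OF subN P] subN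
    by (intro layer_bound_trans[OF 1]) blast+
  moreover have "{\<one>\<^bsub>H\<^esub>} \<inter> P = {\<one>\<^bsub>H\<^esub>}" using subgroup.one_closed[OF P] by blast
  moreover have "carrier H \<inter> P = P" using subgroup.subset[OF P] by blast
  moreover have "p ^ ?m * p ^ k\<^sup>2 = p ^ (k\<^sup>2 div 4 + (if p = 2 then 3 else 2) * k\<^sup>2)"
    by (simp add: power_add[symmetric] mult_2 add.assoc)
  ultimately show "card (carrier H) \<le> p ^ (k\<^sup>2 div 4 + (if p = 2 then 3 else 2) * k\<^sup>2) * card P"
    by (simp add: layer_bound_def)
qed

theorem corollaryD:
  fixes p k :: nat and G :: "('a, 'b) monoid_scheme" and Q :: "('a \<Rightarrow> 'a) set"
  assumes "Factorial_Ring.prime p"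
    and "p_group p G"
    and "finite (carrier G)"
    and "prufer_rank G = enat k"
    and "subgroup Q (AutoGroup G)"
    and "p_group p ((AutoGroup G)\<lparr>carrier := Q\<rparr>)"
  shows "(p > 2 \<longrightarrow>
            ereal_of_enat (min_gens ((AutoGroup G)\<lparr>carrier := Q\<rparr>)) \<le> ereal (9 * (real k)\<^sup>2 / 4))
       \<and> (p = 2 \<longrightarrow>
            ereal_of_enat (min_gens ((AutoGroup G)\<lparr>carrier := Q\<rparr>)) \<le> ereal ((7 * (real k)\<^sup>2 - real k) / 2))"
proof -
  interpret G: finite_p_group G p using assms(2,3,1) by (rule p_group_imp_finite_p_group)
  let ?H = "(AutoGroup G)\<lparr>carrier := Q\<rparr>"
  have "Q \<subseteq> auto G" using subgroup.subset[OF assms(5)] by (simp add: AutoGroup_def)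
  then have Q: "f \<in> hom G G" "f \<in> Bij (carrier G)" if "f \<in> Q" for f
    using that by (auto simp: auto_def)
  have "Q \<subseteq> carrier G \<rightarrow>\<^sub>E carrier G"
    using Q by (auto simp: Bij_def PiE_def hom_def)
  then have "finite Q" using G.fin finite_PiE[of "carrier G" "\<lambda>_. carrier G"] finite_subset by blast
  then interpret H: finite_p_group ?H p
    using assms(6,1) by (intro p_group_imp_finite_p_group) auto
  interpret p_action G ?H p "\<lambda>f. f"
  proof unfold_locales
    fix f x y assume "f \<in> carrier ?H" and x: "x \<in> carrier G"
    then have f: "f \<in> hom G G" using Q by simp
    show "f x \<in> carrier G" using f x by (rule hom_in_carrier)
    show "f (x \<otimes>\<^bsub>G\<^esub> y) = f x \<otimes>\<^bsub>G\<^esub> f y" if "y \<in> carrier G" using f x that by (rule hom_mult)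
  next
    fix x assume "x \<in> carrier G"
    then show "\<one>\<^bsub>?H\<^esub> x = x" by (simp add: AutoGroup_def BijGroup_def)
  next
    fix f g x assume "f \<in> carrier ?H" "g \<in> carrier ?H" "x \<in> carrier G"
    then show "(f \<otimes>\<^bsub>?H\<^esub> g) x = f (g x)" using Q by (simp add: AutoGroup_def BijGroup_def compose_eq)
  qed
  have bound: "min_gens ?H \<le> enat (k\<^sup>2 div 4 + (if p = 2 then 3 else 2) * k\<^sup>2)"
  proof (rule min_gens_faithful_action)
    fix f assume f: "f \<in> carrier ?H" "\<forall>x\<in>carrier G. f x = x"
    have "f \<in> extensional (carrier G)" using Q(2) f(1) by (simp add: Bij_def)
    then have "f = (\<lambda>x\<in>carrier G. x)" using f(2) by (auto simp: fun_eq_iff extensional_def)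
    then show "f = \<one>\<^bsub>?H\<^esub>" by (simp add: AutoGroup_def BijGroup_def)
  qed (use assms(4) in simp)
  then obtain m where m: "min_gens ?H = enat m" by (cases "min_gens ?H") auto
  have mle: "m \<le> k\<^sup>2 div 4 + (if p = 2 then 3 else 2) * k\<^sup>2" using bound m by simp
  have "4 * (k\<^sup>2 div 4) \<le> k\<^sup>2" by simp
  then have "real (4 * (k\<^sup>2 div 4)) \<le> real (k\<^sup>2)" by (simp only: of_nat_le_iff)
  then have q: "4 * real (k\<^sup>2 div 4) \<le> (real k)\<^sup>2" by simp
  have "real m \<le> real (k\<^sup>2 div 4 + (if p = 2 then 3 else 2) * k\<^sup>2)" using mle by (simp only: of_nat_le_iff)
  then have mr: "real m \<le> real (k\<^sup>2 div 4) + (if p = 2 then 3 else 2) * (real k)\<^sup>2" by (simp split: if_splits)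
  have "real m \<le> 9 * (real k)\<^sup>2 / 4" if "p > 2" using mr q that by simp
  moreover have "real m \<le> (7 * (real k)\<^sup>2 - real k) / 2" if "p = 2"
  proof -
    have "2 * real (k\<^sup>2 div 4) + real k \<le> (real k)\<^sup>2"
    proof (cases "k \<le> 1")
      case True
      then consider "k = 0" | "k = 1" by linarith
      then show ?thesis by cases auto
    next
      case False
      then have "real k * 2 \<le> real k * real k" by (intro mult_left_mono) auto
      then show ?thesis using q by (simp add: power2_eq_square)
    qed
    then show ?thesis using mr that by simp
  qed
  ultimately show ?thesis unfolding m by simp
qed

end
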